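(* Let $\Pi_0$ be the law of the random density $\theta$ sampled by a Pólya tree $PT(\mathcal B,\mathcal A)$ on a compact set $\mathcal X\subset\mathbb R^d$ ($d\ge 1$) such that (1) $\alpha_\epsilon=a_{l(\epsilon)}$ depends only on the length of $\epsilon$; (2) $\sum_{l\ge1} l/a_l<\infty$; (3) $\lambda(B_\epsilon)=2^{-l(\epsilon)}$ for all $\epsilon\in E$. Let $f_0$ be a probability density on $\mathcal X$ for which there exists $\epsilon>0$ with $\Pi_0(\theta: K(f_0,\theta)\le\epsilon)>0$. Let $X_1,X_2,\dots$ be i.i.d. with density $f_0$ and $\mathbf X_n=(X_1,\dots,X_n)$. Then $$\mathbb E[K(f_0,\theta)\mid\mathbf X_n]\to 0\quad\text{as } n\to\infty,$$ almost surely and in $L_1$. If additionally $\mathcal X=[0,1]$ with $\mathcal B$ the dyadic intervals, $f_0$ satisfies, for some $m,M\in\mathbb R^+$ and $\alpha\in[0,1]$, $f_0(t)>m$ for all $t\in[0,1]$ and $|f_0(x)-f_0(y)|\le M|x-y|^\alpha$ for all $x,y\in[0,1]$, and $a_l=2^{2\alpha l}$, then $$\mathbb E_0\big[\mathbb E[K(f_0,\theta)\mid\mathbf X_n]\big]=O\left(n^{-\frac{2\alpha}{1+2\alpha}}\right).$$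
   Context: $E$ is the set of all finite binary sequences, including the empty sequence $\emptyset$; $l(\epsilon)$ is the length of $\epsilon$; $\lambda$ is Lebesgue measure. $\mathcal B=\{B_\epsilon:\epsilon\in E\}$ is a family of Borel subsets of $\mathcal X$ with $B_\emptyset=\mathcal X$, $\{B_{\epsilon0},B_{\epsilon1}\}$ a partition of $B_\epsilon$ for every $\epsilon\in E$, and $\mathcal B$ generating the Borel $\sigma$-algebra of $\mathcal X$. $\mathcal A=\{\alpha_\epsilon:\epsilon\in E\}$ is a family of positive reals. A Pólya tree $PT(\mathcal B,\mathcal A)$ is the law of a random probability measure $\mathcal P$ on $\mathcal X$ such that the variables $\mathcal P(B_{\epsilon0}\mid B_\epsilon)$, $\epsilon\in E$, are independent with $\mathcal P(B_{\epsilon0}\mid B_\epsilon)\sim\mathrm{Beta}(\alpha_{\epsilon0},\alpha_{\epsilon1})$. Under (1)–(3), $\mathcal P$ is a.s. absolutely continuous with respect to $\lambda$, and $\theta$ denotes its density. Given $\mathbf X_n$, the posterior is the Pólya tree $PT(\mathcal B,\{\alpha_\epsilon+N_\epsilon:\epsilon\in E\})$ with $N_\epsilon=\sum_{i=1}^n I_{B_\epsilon}(X_i)$; $\mathbb E[\cdot\mid\mathbf X_n]$ denotes expectation over $\theta$ under this posterior, and $\mathbb E_0$ denotes expectation over the sample when the $X_i$ are i.i.d. with density $f_0$. Almost sure and $L_1$ convergence are with respect to the law of the i.i.d. sequence $X_1,X_2,\dots$ from $f_0$. $K(f,\theta)=\int_{\mathcal X} f\log(f/\theta)\,d\lambda$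 is the Kullback–Leibler divergence. When $\mathcal X=[0,1]$, the dyadic intervals are $B_\epsilon=[\sum_i\epsilon_i2^{-i},\ \sum_i\epsilon_i2^{-i}+2^{-l(\epsilon)}]$, with endpoints assigned so that siblings partition their parent. *)

theory Defs
  imports "HOL-Probability.Probability"
begin

text \<open>
  Finite binary sequences are boolean lists, with False for 0 and True for 1;
  the successors of \<open>e\<close> are \<open>e @ [False]\<close> and \<open>e @ [True]\<close>.
\<close>

definition partition_tree :: "'a::euclidean_space set \<Rightarrow> (bool list \<Rightarrow> 'a set) \<Rightarrow> bool" where
  "partition_tree \<X> B \<longleftrightarrow>
     B [] = \<X> \<and>
     (\<forall>e. B e \<in> sets borel) \<and>
     (\<forall>e. B (e @ [False]) \<union> B (e @ [True]) = B e \<and> B (e @ [False]) \<inter> B (e @ [True]) = {}) \<and>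
     sigma_sets \<X> (range B) = sets (restrict_space borel \<X>)"

definition beta_density :: "real \<Rightarrow> real \<Rightarrow> real \<Rightarrow> real" where
  "beta_density a b x =
     (if 0 < x \<and> x < 1 then x powr (a - 1) * (1 - x) powr (b - 1) / Beta a b else 0)"

text \<open>
  Laws of random probability measures on \<open>\<X>\<close> are probability measures on the space of all Borel
  probability measures on \<open>\<X>\<close>. A conditional probability given a null set is 0 by the convention of
  division by zero; this matters only on a null set of the law, as the Beta distributions with
  positive parameters have no atom at 0 or 1.
\<close>

definition is_polya_tree ::
  "'a::euclidean_space set \<Rightarrow> (bool list \<Rightarrow> 'a set) \<Rightarrow> (bool list \<Rightarrow> real) \<Rightarrow> 'a measure measure \<Rightarrow> bool"
where
  "is_polya_tree \<X> B \<A> \<Phi> \<longleftrightarrow>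
     prob_space \<Phi> \<and>
     sets \<Phi> = sets (prob_algebra (restrict_space borel \<X>)) \<and>
     prob_space.indep_vars \<Phi> (\<lambda>_. borel)
       (\<lambda>e P. \<P>(x in P. x \<in> B (e @ [False]) \<bar> x \<in> B e)) UNIV \<and>
     (\<forall>e. distributed \<Phi> lborel (\<lambda>P. \<P>(x in P. x \<in> B (e @ [False]) \<bar> x \<in> B e))
            (\<lambda>x. ennreal (beta_density (\<A> (e @ [False])) (\<A> (e @ [True])) x)))"

text \<open>
  The law is unique, because the sets \<open>B e\<close> form, up to the empty set, a generating family that is
  closed under intersection. It exists in particular under the assumptions of the locale below, for
  the parameters \<open>\<A>\<close> as well as for \<open>\<A>\<close> plus the counts of any finite sample.
\<close>

definition PT ::
  "'a::euclidean_space set \<Rightarrow> (bool list \<Rightarrow> 'a set) \<Rightarrow> (bool list \<Rightarrow> real) \<Rightarrow> 'a measure measure"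
where
  "PT \<X> B \<A> = (THE \<Phi>. is_polya_tree \<X> B \<A> \<Phi>)"

abbreviation leb_on :: "'a::euclidean_space set \<Rightarrow> 'a measure" where
  "leb_on \<X> \<equiv> restrict_space lborel \<X>"

definition leb_density :: "'a::euclidean_space set \<Rightarrow> 'a measure \<Rightarrow> 'a \<Rightarrow> real" where
  "leb_density \<X> P x = enn2real (RN_deriv (leb_on \<X>) P x)"

text \<open>
  The conventions are \<open>0 log (0 / b) = 0\<close> and \<open>a log (a / 0) = \<infinity>\<close> for \<open>a > 0\<close>. The divergence is the
  integral of the positive part minus the integral of the negative part, with values in \<open>[0, \<infinity>]\<close>:
  for probability densities the second integral is finite and at most the first one, since
  \<open>a log (a / b) \<ge> a - b\<close>, so that the truncated subtraction is harmless.
\<close>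

definition KL_integrand :: "real \<Rightarrow> real \<Rightarrow> ereal" where
  "KL_integrand a b = (if a = 0 then 0 else if b = 0 then \<infinity> else ereal (a * ln (a / b)))"

definition KL :: "'a::euclidean_space set \<Rightarrow> ('a \<Rightarrow> real) \<Rightarrow> ('a \<Rightarrow> real) \<Rightarrow> ennreal" where
  "KL \<X> f \<theta> =
     (\<integral>\<^sup>+x. e2ennreal (KL_integrand (f x) (\<theta> x)) \<partial>leb_on \<X>) -
     (\<integral>\<^sup>+x. e2ennreal (- KL_integrand (f x) (\<theta> x)) \<partial>leb_on \<X>)"

text \<open>The observations are numbered from 0, so the first \<open>n\<close> of them are \<open>x 0, \<dots>, x (n - 1)\<close>.\<close>

definition posterior ::
  "'a::euclidean_space set \<Rightarrow> (bool list \<Rightarrow> 'a set) \<Rightarrow> (bool list \<Rightarrow> real) \<Rightarrow> nat \<Rightarrow> (nat \<Rightarrow> 'a)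
     \<Rightarrow> 'a measure measure"
where
  "posterior \<X> B \<A> n x = PT \<X> B (\<lambda>e. \<A> e + (\<Sum>i<n. indicator (B e) (x i)))"

definition posterior_KL ::
  "'a::euclidean_space set \<Rightarrow> (bool list \<Rightarrow> 'a set) \<Rightarrow> (bool list \<Rightarrow> real) \<Rightarrow> ('a \<Rightarrow> real) \<Rightarrow> nat
     \<Rightarrow> (nat \<Rightarrow> 'a) \<Rightarrow> ennreal"
where
  "posterior_KL \<X> B \<A> f0 n x = (\<integral>\<^sup>+P. KL \<X> f0 (leb_density \<X> P) \<partial>posterior \<X> B \<A> n x)"

locale polya_tree_sampling = prob_space M
  for M :: "'w measure"
    and \<X> :: "'a::euclidean_space set"
    and B :: "bool list \<Rightarrow> 'a set"
    and \<A> :: "bool list \<Rightarrow> real"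
    and a :: "nat \<Rightarrow> real"
    and f0 :: "'a \<Rightarrow> real"
    and X :: "nat \<Rightarrow> 'w \<Rightarrow> 'a" +
  assumes compact_domain: "compact \<X>"
    and tree: "partition_tree \<X> B"
    and pos: "\<And>e. \<A> e > 0"
    and level: "\<And>e. \<A> e = a (length e)"
    and summable_level: "summable (\<lambda>l. real l / a l)"
    and lebesgue_tree: "\<And>e. emeasure lborel (B e) = ennreal ((1 / 2) ^ length e)"
    and f0_measurable: "f0 \<in> borel_measurable (leb_on \<X>)"
    and f0_nonneg: "\<And>x. x \<in> \<X> \<Longrightarrow> 0 \<le> f0 x"
    and f0_integral: "(\<integral>\<^sup>+x. ennreal (f0 x) \<partial>leb_on \<X>) = 1"
    and KL_prior: "\<exists>\<epsilon>>0. \<P>(P in PT \<X> B \<A>. KL \<X> f0 (leb_density \<X> P) \<le> ennreal \<epsilon>) > 0"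
    and X_indep: "indep_vars (\<lambda>_. restrict_space borel \<X>) X UNIV"
    and X_distributed: "\<And>i. distributed M (leb_on \<X>) (X i) (\<lambda>x. ennreal (f0 x))"

definition dyadic_left :: "bool list \<Rightarrow> real" where
  "dyadic_left e = (\<Sum>i<length e. of_bool (e ! i) / 2 ^ (i + 1))"

text \<open>The assignment of the endpoints is left open; it is constrained by \<open>partition_tree\<close> only.\<close>

definition dyadic_tree :: "(bool list \<Rightarrow> real set) \<Rightarrow> bool" where
  "dyadic_tree B \<longleftrightarrow>
     (\<forall>e. {dyadic_left e <..< dyadic_left e + (1 / 2) ^ length e} \<subseteq> B e \<and>
          B e \<subseteq> {dyadic_left e .. dyadic_left e + (1 / 2) ^ length e})"

end

theory Submission
  imports Defs
begin

text \<open>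
  The summability of \<open>1 / a\<^sub>l\<close> makes the masses of a Polya tree a martingale bounded in \<open>L\<^sup>2\<close>, so that the
  random measure has a density; this also constructs the tree from independent Beta splits. Relative entropy
  is the supremum over the levels of the partition, and the chain rule turns the posterior expectation of
  \<open>K(f\<^sub>0, \<theta>)\<close> into the sum over all nodes \<open>e\<close> of \<open>F(B\<^sub>e)\<close> times the expected divergence of the split \<open>V\<^sub>e\<close> from
  the true conditional probability \<open>q\<^sub>e\<close>.

  As the prior splits are independent and symmetric about \<open>1 / 2\<close>, comparing Laplace transforms shows that the
  support condition forces the sum of \<open>F(B\<^sub>e) (2 q\<^sub>e - 1)\<^sup>2\<close> to be finite. At a single node the posterior term is at most
  \<open>2 (2 q\<^sub>e - 1)\<^sup>2 + 1 / a + W\<^sup>2 + W'\<^sup>2\<close> uniformly in \<open>n\<close>, where \<open>W, W'\<close> are the maximal normalised deviations of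
  the counts, and Doob's inequality bounds the mean of \<open>W\<^sup>2\<close> by a multiple of \<open>1 / a + 1 / a\<^sup>2\<close>. Each term tends to \<open>0\<close> by the law of large
  numbers, so dominated convergence gives both limits. For the rate, binomial moments bound the mean of
  the terms of level \<open>l\<close> by a multiple of the minimum of \<open>2\<^sup>-\<^sup>2\<^sup>\<alpha>\<^sup>l\<close> and \<open>2\<^sup>l / n\<close>, and this is summed over \<open>l\<close>.
\<close>


section \<open>Divergence of Bernoulli laws\<close>

text \<open>The limits need a bound that is uniform in the sample size and still summable over the
  nodes. Counts may stay far below their means, so a deviation has to be divided by the random
  quantity \<open>a + succ_count\<close>, and this ratio is no martingale. Doob's inequality is
  applied instead to the sum of the increments, each divided by the value of
  \<open>a + succ_count\<close> just before it; summation by parts returns to the ratio at the price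
  of a factor 2. The support condition enters quantitatively: if the divergence is at most
  \<epsilon> with prior probability \<open>p\<close>, then \<open>exp (- \<epsilon>) * p\<close> is
  at most a product of Laplace transforms over the nodes, the factor of a node being at most
  \<open>exp (- (F e * (2 * q e - 1)\<^sup>2 / 32))\<close>. For the rate, the two bounds on a level
  cross where \<open>2 ^ l\<close> is about \<open>n\<close> to the power
  \<open>1 / (1 + 2 * \<alpha>)\<close>. Coarse levels are governed by the sampling variance and
  fine ones by the smoothness; both geometric sums are dominated by their terms at the
  crossing.\<close>

definition bernoulli_kl :: "real \<Rightarrow> real \<Rightarrow> real" where
  "bernoulli_kl q v = q * ln (q / v) + (1 - q) * ln ((1 - q) / (1 - v))"

lemma ln_ratio_le_diff:
  fixes a b :: real
  assumes "0 \<le> a" "0 < b"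
  shows "a * ln (a / b) \<ge> a - b"
proof (cases "a = 0")
  case False
  with assms have a: "a > 0" by simp
  have "ln (b / a) \<le> b / a - 1" using a assms by (intro ln_le_minus_one) auto
  then have "a * ln (b / a) \<le> a * (b / a - 1)" using a by (intro mult_left_mono) auto
  then show ?thesis using a assms by (simp add: ln_div algebra_simps)
qed (use assms in auto)

text \<open>The bound \<open>ln_ratio_le_diff\<close> at the square roots, multiplied by
  \<open>2 * sqrt q\<close>. Adding the same bound for \<open>1 - q\<close> and \<open>1 - v\<close>
  produces the squared Hellinger distance.\<close>

lemma hellinger_le_ln:
  fixes q v :: real
  assumes "0 \<le> q" "0 < v"
  shows "q * ln (q / v) \<ge> 2 * q - 2 * sqrt q * sqrt v"
proof (cases "q = 0")
  case False
  with assms have q: "q > 0" by simp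
  have "ln (q / v) = 2 * ln (sqrt q / sqrt v)"
    using q assms by (simp add: ln_div ln_sqrt)
  moreover have "sqrt q * ln (sqrt q / sqrt v) \<ge> sqrt q - sqrt v"
    using q assms by (intro ln_ratio_le_diff) auto
  then have "2 * sqrt q * (sqrt q * ln (sqrt q / sqrt v)) \<ge> 2 * sqrt q * (sqrt q - sqrt v)"
    using q by (intro mult_left_mono) auto
  moreover have "2 * sqrt q * (sqrt q * ln (sqrt q / sqrt v)) = q * (2 * ln (sqrt q / sqrt v))"
    using q by (simp add: mult.assoc[symmetric])
  moreover have "2 * sqrt q * (sqrt q - sqrt v) = 2 * q - 2 * sqrt q * sqrt v"
    using q by (simp add: algebra_simps)
  ultimately show ?thesis by simp
qed (use assms in auto)

lemma sq_diff_le_hellinger: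
  fixes q v :: real
  assumes "0 \<le> q" "q \<le> 1" "0 \<le> v" "v \<le> 1"
  shows "(q - v)\<^sup>2 \<le> 4 * (sqrt q - sqrt v)\<^sup>2"
proof -
  have "q - v = (sqrt q - sqrt v) * (sqrt q + sqrt v)"
    using assms by (simp add: algebra_simps)
  then have "(q - v)\<^sup>2 = (sqrt q - sqrt v)\<^sup>2 * (sqrt q + sqrt v)\<^sup>2"
    by (simp add: power_mult_distrib)
  moreover have "(sqrt q + sqrt v)\<^sup>2 \<le> 2\<^sup>2"
  proof (rule power_mono)
    have "sqrt q \<le> 1" "sqrt v \<le> 1" using assms by simp_all
    then show "sqrt q + sqrt v \<le> 2" by linarith
  qed (use assms in simp)
  ultimately show ?thesis
    using mult_left_mono[of "(sqrt q + sqrt v)\<^sup>2" "2\<^sup>2" "(sqrt q - sqrt v)\<^sup>2"] by simp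
qed

text \<open>A weak form of Pinsker's inequality: the divergence dominates the squared Hellinger
  distance, and each of the two summands of the latter is at least
  \<open>(q - v)\<^sup>2 / 4\<close>.\<close>

lemma bernoulli_kl_ge_sq:
  assumes q: "0 \<le> q" "q \<le> 1" and v: "0 < v" "v < 1"
  shows "(q - v)\<^sup>2 / 2 \<le> bernoulli_kl q v"
proof -
  have "bernoulli_kl q v \<ge> (2 * q - 2 * sqrt q * sqrt v) + (2 * (1 - q) - 2 * sqrt (1 - q) * sqrt (1 - v))"
    unfolding bernoulli_kl_def using q v by (intro add_mono hellinger_le_ln) auto
  also have "(2 * q - 2 * sqrt q * sqrt v) + (2 * (1 - q) - 2 * sqrt (1 - q) * sqrt (1 - v)) =
      (sqrt q - sqrt v)\<^sup>2 + (sqrt (1 - q) - sqrt (1 - v))\<^sup>2"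
    using q v by (simp add: power2_diff)
  finally have "(sqrt q - sqrt v)\<^sup>2 + (sqrt (1 - q) - sqrt (1 - v))\<^sup>2 \<le> bernoulli_kl q v" .
  moreover have "(q - v)\<^sup>2 \<le> 4 * (sqrt q - sqrt v)\<^sup>2"
    using q v by (intro sq_diff_le_hellinger) auto
  moreover have "((1 - q) - (1 - v))\<^sup>2 \<le> 4 * (sqrt (1 - q) - sqrt (1 - v))\<^sup>2"
    using q v by (intro sq_diff_le_hellinger) auto
  moreover have "((1 - q) - (1 - v))\<^sup>2 = (q - v)\<^sup>2" by (simp add: power2_commute)
  ultimately show ?thesis by simp
qed

lemma bernoulli_kl_nonneg:
  assumes "0 \<le> q" "q \<le> 1" "0 < v" "v < 1"
  shows "0 \<le> bernoulli_kl q v"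
  using bernoulli_kl_ge_sq[OF assms] by (rule order_trans[rotated]) simp

lemma mult_ln_ratio_le:
  fixes q v :: real
  assumes "0 \<le> q" "0 < v"
  shows "q * ln (q / v) \<le> q * (q / v - 1)"
proof (cases "q = 0")
  case False
  then have "ln (q / v) \<le> q / v - 1" using assms by (intro ln_le_minus_one) auto
  then show ?thesis using assms by (intro mult_left_mono) auto
qed simp

text \<open>Bounding both logarithms by \<open>ln x \<le> x - 1\<close> leaves the chi-square
  divergence of the two Bernoulli laws.\<close>

lemma bernoulli_kl_le_chi2:
  assumes q: "0 \<le> q" "q \<le> 1" and v: "0 < v" "v < 1"
  shows "bernoulli_kl q v \<le> (q - v)\<^sup>2 / (v * (1 - v))"
proof -
  have "bernoulli_kl q v \<le> q * (q / v - 1) + (1 - q) * ((1 - q) / (1 - v) - 1)"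
    unfolding bernoulli_kl_def using q v by (intro add_mono mult_ln_ratio_le) auto
  also have "\<dots> = (q - v)\<^sup>2 / (v * (1 - v))"
    using v by (simp add: field_simps power2_eq_square)
  finally show ?thesis .
qed

text \<open>
  \<open>(a + n0) / (2 * a + n0 + n1)\<close> is the mean of the Beta posterior of a split after \<open>n0\<close> and \<open>n1\<close>
  observations in the two children; here the counts are replaced by \<open>q * n\<close> and \<open>(1 - q) * n\<close>.
\<close>

lemma bernoulli_kl_smoothed:
  assumes q: "0 \<le> q" "q \<le> 1" and a: "0 < a" and n: "0 \<le> n"
  shows "bernoulli_kl q ((a + q * n) / (2 * a + n)) \<le> (2 * q - 1)\<^sup>2 * (a / (a + n))"
proof -
  define v where "v = (a + q * n) / (2 * a + n)"
  have pos: "2 * a + n > 0" using a n by simp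
  have qn: "0 \<le> q * n" "q * n \<le> n" using q n by (auto simp: mult_left_le_one_le)
  have v1: "1 - v = (a + (1 - q) * n) / (2 * a + n)"
    using pos by (simp add: v_def field_simps)
  have v: "0 < v" "v < 1"
    using a n qn pos by (auto simp: v_def)
  have "bernoulli_kl q v \<le> (q - v)\<^sup>2 / (v * (1 - v))"
    by (rule bernoulli_kl_le_chi2) (use q v in auto)
  also have "q - v = (2 * q - 1) * a / (2 * a + n)"
    using pos by (simp add: v_def field_simps)
  also have "v * (1 - v) = (a + q * n) * (a + (1 - q) * n) / (2 * a + n)\<^sup>2"
    using pos by (simp add: v1) (simp add: v_def power2_eq_square)
  also have "((2 * q - 1) * a / (2 * a + n))\<^sup>2 / ((a + q * n) * (a + (1 - q) * n) / (2 * a + n)\<^sup>2)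
      = (2 * q - 1)\<^sup>2 * (a\<^sup>2 / ((a + q * n) * (a + (1 - q) * n)))"
    using pos by (simp add: power_divide power_mult_distrib)
  also have "\<dots> \<le> (2 * q - 1)\<^sup>2 * (a\<^sup>2 / (a * (a + n)))"
  proof (intro mult_left_mono divide_left_mono)
    have "(a + q * n) * (a + (1 - q) * n) - a * (a + n) = (q * n) * ((1 - q) * n)"
      by (simp add: algebra_simps)
    moreover have "\<dots> \<ge> 0" using q n by simp
    ultimately show "a * (a + n) \<le> (a + q * n) * (a + (1 - q) * n)" by linarith
    show "0 < (a + q * n) * (a + (1 - q) * n) * (a * (a + n))"
      using a n q by (intro mult_pos_pos add_pos_nonneg) auto
  qed auto
  also have "a\<^sup>2 / (a * (a + n)) = a / (a + n)"
    using a by (simp add: power2_eq_square)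
  finally show ?thesis by (simp add: v_def)
qed

text \<open>Only the second argument changes, so the terms \<open>q * ln q\<close> and
  \<open>(1 - q) * ln (1 - q)\<close> cancel, also at \<open>q = 0\<close> and \<open>q = 1\<close>.
  The identity separates idealised counts from the errors of the observed ones.\<close>

lemma bernoulli_kl_change:
  assumes q: "0 \<le> q" "q \<le> 1" and pos: "0 < x0" "0 < x1" "0 < y0" "0 < y1"
  shows "bernoulli_kl q (y0 / (y0 + y1)) =
    bernoulli_kl q (x0 / (x0 + x1)) + ln ((y0 + y1) / (x0 + x1)) + q * ln (x0 / y0) + (1 - q) * ln (x1 / y1)"
proof -
  have e: "1 - y0 / (y0 + y1) = y1 / (y0 + y1)" "1 - x0 / (x0 + x1) = x1 / (x0 + x1)"
    using pos by (auto simp: field_simps)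
  have split: "r * ln (r / (u / w)) = r * ln r - r * ln u + r * ln w"
    if "0 \<le> r" "0 < u" "0 < w" for r u w :: real
  proof (cases "r = 0")
    case False
    then have "ln (r / (u / w)) = ln r - ln u + ln w" using that by (simp add: ln_div ln_mult)
    then show ?thesis by (simp only:) (simp add: algebra_simps)
  qed simp
  have "q * ln (q / (y0 / (y0 + y1))) = q * ln q - q * ln y0 + q * ln (y0 + y1)"
    "q * ln (q / (x0 / (x0 + x1))) = q * ln q - q * ln x0 + q * ln (x0 + x1)"
    "(1 - q) * ln ((1 - q) / (y1 / (y0 + y1))) = (1 - q) * ln (1 - q) - (1 - q) * ln y1 + (1 - q) * ln (y0 + y1)"
    "(1 - q) * ln ((1 - q) / (x1 / (x0 + x1))) = (1 - q) * ln (1 - q) - (1 - q) * ln x1 + (1 - q) * ln (x0 + x1)"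
    by (intro split; use q pos in auto)+
  moreover have "ln ((y0 + y1) / (x0 + x1)) = ln (y0 + y1) - ln (x0 + x1)"
    "ln (x0 / y0) = ln x0 - ln y0" "ln (x1 / y1) = ln x1 - ln y1"
    using pos by (auto simp: ln_div)
  ultimately show ?thesis
    unfolding bernoulli_kl_def e by (simp only:) (simp add: algebra_simps)
qed

text \<open>The counts are compared with \<open>q * n\<close> and \<open>(1 - q) * n\<close> for the
  same total \<open>n\<close>. As the totals agree, the logarithm of their ratio vanishes, and what
  remains is at most a term quadratic in \<open>Z\<close> plus a cross term with the factor
  \<open>1 - 2 * q\<close>.\<close>

lemma bernoulli_kl_le_pathwise:
  fixes n0 n1 :: real
  assumes q: "0 \<le> q" "q \<le> 1" and a: "0 < a" and n: "0 \<le> n0" "0 \<le> n1"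
  defines "Z \<equiv> n0 - q * (n0 + n1)"
  shows "bernoulli_kl q ((a + n0) / (2 * a + n0 + n1)) \<le>
    2 * (2 * q - 1)\<^sup>2 + (Z / (a + n0))\<^sup>2 + (Z / (a + n1))\<^sup>2"
proof -
  define y0 y1 where "y0 = a + n0" and "y1 = a + n1"
  define x0 x1 where "x0 = a + q * (n0 + n1)" and "x1 = a + (1 - q) * (n0 + n1)"
  have y: "y0 \<ge> a" "y1 \<ge> a" "y0 > 0" "y1 > 0" using a n by (auto simp: y0_def y1_def)
  have x: "x0 > 0" "x1 > 0" using a q n by (auto simp: x0_def x1_def intro!: add_pos_nonneg)
  have xy: "x0 + x1 = y0 + y1" "y0 + y1 = 2 * a + n0 + n1" "x0 = y0 - Z" "x1 = y1 + Z"
    by (auto simp: x0_def x1_def y0_def y1_def Z_def algebra_simps)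
  have "bernoulli_kl q (x0 / (x0 + x1)) \<le> (2 * q - 1)\<^sup>2 * (a / (a + (n0 + n1)))"
    using bernoulli_kl_smoothed[of q a "n0 + n1"] q a n xy
    by (simp add: x0_def add.assoc)
  also have "\<dots> \<le> (2 * q - 1)\<^sup>2 * 1"
    using a n by (intro mult_left_mono) auto
  finally have 1: "bernoulli_kl q (x0 / (x0 + x1)) \<le> (2 * q - 1)\<^sup>2" by simp
  have "q * ln (x0 / y0) \<le> q * (x0 / y0 - 1)" "(1 - q) * ln (x1 / y1) \<le> (1 - q) * (x1 / y1 - 1)"
    using q x y by (auto intro!: mult_left_mono ln_le_minus_one)
  moreover have "q * (x0 / y0 - 1) + (1 - q) * (x1 / y1 - 1) = Z\<^sup>2 / (y0 * y1) + a * (1 - 2 * q) * Z / (y0 * y1)"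
  proof -
    have "q * (x0 / y0 - 1) + (1 - q) * (x1 / y1 - 1) = - Z * (q * y1 - (1 - q) * y0) / (y0 * y1)"
      using y unfolding xy(3,4) by (simp add: field_simps)
    also have "q * y1 - (1 - q) * y0 = - Z - a * (1 - 2 * q)"
      by (simp add: y0_def y1_def Z_def algebra_simps)
    finally show ?thesis by (simp add: power2_eq_square add_divide_distrib diff_divide_distrib algebra_simps)
  qed
  moreover have "Z\<^sup>2 / (y0 * y1) \<le> ((Z / y0)\<^sup>2 + (Z / y1)\<^sup>2) / 2"
    using sum_squares_bound[of "Z / y0" "Z / y1"] y by (simp add: power2_eq_square algebra_simps)
  \<comment> \<open>The factor \<open>a / y1\<close> is at most 1, so the prior parameter disappears
    from the cross term.\<close>
  moreover have "a * (1 - 2 * q) * Z / (y0 * y1) \<le> ((2 * q - 1)\<^sup>2 + (Z / y0)\<^sup>2) / 2"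
  proof -
    have "a * (1 - 2 * q) * Z / (y0 * y1) = (a / y1) * ((1 - 2 * q) * (Z / y0))" by (simp add: mult_ac)
    also have "\<dots> \<le> (a / y1) * (((1 - 2 * q)\<^sup>2 + (Z / y0)\<^sup>2) / 2)"
      using sum_squares_bound[of "1 - 2 * q" "Z / y0"] y a by (intro mult_left_mono) (auto simp: algebra_simps)
    also have "\<dots> \<le> 1 * (((1 - 2 * q)\<^sup>2 + (Z / y0)\<^sup>2) / 2)"
      using y a by (intro mult_right_mono) auto
    also have "(1 - 2 * q)\<^sup>2 = (2 * q - 1)\<^sup>2" by (simp add: power2_commute)
    finally show ?thesis by simp
  qed
  moreover have "bernoulli_kl q (y0 / (y0 + y1)) = bernoulli_kl q (x0 / (x0 + x1)) + q * ln (x0 / y0) + (1 - q) * ln (x1 / y1)"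
    using bernoulli_kl_change[of q x0 x1 y0 y1] q x y by (simp add: xy(1))
  moreover have "0 \<le> (2 * q - 1)\<^sup>2" "0 \<le> (Z / y1)\<^sup>2" by simp_all
  ultimately have "bernoulli_kl q (y0 / (y0 + y1)) \<le> 2 * (2 * q - 1)\<^sup>2 + (Z / y0)\<^sup>2 + (Z / y1)\<^sup>2"
    using 1 unfolding add_divide_distrib by linarith
  then show ?thesis by (simp only: xy(2)) (simp only: y0_def y1_def)
qed

text \<open>The linear term keeps the denominator \<open>x\<close>, which is not random in the
  application, so that its mean vanishes; only the quadratic remainder has the random denominator
  \<open>y\<close>.\<close>

lemma ln_ratio_le_second_order:
  fixes x y :: real
  assumes "0 < x" "0 < y"
  shows "ln (x / y) \<le> (x - y) / x + (y - x)\<^sup>2 / (y * x)"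
proof -
  have "ln (x / y) \<le> x / y - 1" using assms by (intro ln_le_minus_one) auto
  also have "x / y - 1 = (x - y) / x + (y - x)\<^sup>2 / (y * x)"
    using assms by (simp add: field_simps power2_eq_square)
  finally show ?thesis .
qed

text \<open>
  The linear terms have mean zero when \<open>m0, m1\<close> are the means of the counts \<open>n0, n1\<close>.
\<close>

lemma bernoulli_kl_le_centred:
  fixes n0 n1 m0 m1 :: real
  assumes q: "0 \<le> q" "q \<le> 1" and a: "0 < a" and n: "0 \<le> n0" "0 \<le> n1" and m: "0 \<le> m0" "0 \<le> m1"
    and m0: "m0 = q * (m0 + m1)"
  shows "bernoulli_kl q ((a + n0) / (2 * a + n0 + n1)) \<le>
     (2 * q - 1)\<^sup>2 * (a / (a + (m0 + m1)))
     + ((n0 - m0) * (1 / (2 * a + m0 + m1) - q / (a + m0)) + (n1 - m1) * (1 / (2 * a + m0 + m1) - (1 - q) / (a + m1)))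
     + q * ((n0 - m0)\<^sup>2 / ((a + n0) * (a + m0))) + (1 - q) * ((n1 - m1)\<^sup>2 / ((a + n1) * (a + m1)))"
proof -
  have pos: "a + n0 > 0" "a + n1 > 0" "a + m0 > 0" "a + m1 > 0" using a n m by auto
  have "bernoulli_kl q ((a + n0) / (2 * a + n0 + n1)) = bernoulli_kl q ((a + m0) / (2 * a + m0 + m1))
      + ln ((2 * a + n0 + n1) / (2 * a + m0 + m1)) + q * ln ((a + m0) / (a + n0)) + (1 - q) * ln ((a + m1) / (a + n1))"
    using bernoulli_kl_change[of q "a + m0" "a + m1" "a + n0" "a + n1"] q pos
    by (simp add: algebra_simps)
  moreover have "bernoulli_kl q ((a + m0) / (2 * a + m0 + m1)) \<le> (2 * q - 1)\<^sup>2 * (a / (a + (m0 + m1)))"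
    using bernoulli_kl_smoothed[of q a "m0 + m1"] q a m m0 by (simp add: add.assoc)
  moreover have "ln ((2 * a + n0 + n1) / (2 * a + m0 + m1)) \<le> (2 * a + n0 + n1) / (2 * a + m0 + m1) - 1"
    using pos by (intro ln_le_minus_one divide_pos_pos) auto
  moreover have "(2 * a + n0 + n1) / (2 * a + m0 + m1) - 1 = ((n0 - m0) + (n1 - m1)) * (1 / (2 * a + m0 + m1))"
  proof -
    have "(2 * a + n0 + n1) / (2 * a + m0 + m1) - 1 = (2 * a + n0 + n1 - (2 * a + m0 + m1)) / (2 * a + m0 + m1)"
      unfolding diff_divide_distrib using pos by simp
    then show ?thesis by simp
  qed
  moreover have "q * ln ((a + m0) / (a + n0)) \<le> q * ((m0 - n0) / (a + m0) + (n0 - m0)\<^sup>2 / ((a + n0) * (a + m0)))"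
    using ln_ratio_le_second_order[of "a + m0" "a + n0"] pos q by (intro mult_left_mono) auto
  moreover have "(1 - q) * ln ((a + m1) / (a + n1)) \<le> (1 - q) * ((m1 - n1) / (a + m1) + (n1 - m1)\<^sup>2 / ((a + n1) * (a + m1)))"
    using ln_ratio_le_second_order[of "a + m1" "a + n1"] pos q by (intro mult_left_mono) auto
  moreover have "((n0 - m0) + (n1 - m1)) * (1 / (2 * a + m0 + m1)) + q * ((m0 - n0) / (a + m0) + (n0 - m0)\<^sup>2 / ((a + n0) * (a + m0)))
     + (1 - q) * ((m1 - n1) / (a + m1) + (n1 - m1)\<^sup>2 / ((a + n1) * (a + m1))) =
     ((n0 - m0) * (1 / (2 * a + m0 + m1) - q / (a + m0)) + (n1 - m1) * (1 / (2 * a + m0 + m1) - (1 - q) / (a + m1)))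
     + q * ((n0 - m0)\<^sup>2 / ((a + n0) * (a + m0))) + (1 - q) * ((n1 - m1)\<^sup>2 / ((a + n1) * (a + m1)))"
    by (simp add: algebra_simps diff_divide_distrib add_divide_distrib)
  ultimately show ?thesis by linarith
qed

section \<open>Beta laws\<close>

definition beta_measure :: "real \<Rightarrow> real \<Rightarrow> real measure" where
  "beta_measure a b = density lborel (\<lambda>x. ennreal (beta_density a b x))"

lemma sets_beta_measure [simp, measurable_cong]: "sets (beta_measure a b) = sets borel"
  by (simp add: beta_measure_def)

lemma space_beta_measure [simp]: "space (beta_measure a b) = UNIV"
  by (simp add: beta_measure_def)

lemma beta_density_measurable [measurable]: "beta_density a b \<in> borel_measurable borel"
  unfolding beta_density_def[abs_def] by measurable

lemma Beta_real_pos: "0 < a \<Longrightarrow> 0 < b \<Longrightarrow> 0 < Beta a (b::real)"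
  by (simp add: Beta_def Gamma_real_pos)

lemma beta_density_nonneg: "0 < a \<Longrightarrow> 0 < b \<Longrightarrow> 0 \<le> beta_density a b x"
  using Beta_real_pos[of a b] by (simp add: beta_density_def)

lemma nn_integral_beta_density:
  assumes "0 < a" "0 < b"
  shows "(\<integral>\<^sup>+x. ennreal (beta_density a b x) \<partial>lborel) = 1"
proof -
  have "((\<lambda>t. t powr (a - 1) * (1 - t) powr (b - 1) / Beta a b) has_integral Beta a b / Beta a b) {0..1}"
    using has_integral_Beta_real[OF assms] by (rule has_integral_divide)
  then have "((\<lambda>t. if t \<in> {0..1} then t powr (a - 1) * (1 - t) powr (b - 1) / Beta a b else 0)
      has_integral 1) UNIV"
    using Beta_real_pos[OF assms] by (subst has_integral_restrict_UNIV) simp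
  moreover have "(\<lambda>t. if t \<in> {0..1} then t powr (a - 1) * (1 - t) powr (b - 1) / Beta a b else 0) = beta_density a b"
    by (auto simp: fun_eq_iff beta_density_def)
  ultimately have "(beta_density a b has_integral 1) UNIV" by simp
  then show ?thesis
    using nn_integral_has_integral_lborel[of "beta_density a b" 1] beta_density_nonneg[OF assms] by simp
qed

lemma prob_space_beta_measure:
  assumes "0 < a" "0 < b"
  shows "prob_space (beta_measure a b)"
  unfolding beta_measure_def
  by (rule prob_spaceI) (simp add: emeasure_density nn_integral_beta_density[OF assms])

lemma nn_integral_beta_measure:
  assumes [measurable]: "f \<in> borel_measurable borel"
  shows "(\<integral>\<^sup>+x. f x \<partial>beta_measure a b) = (\<integral>\<^sup>+x. ennreal (beta_density a b x) * f x \<partial>lborel)"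
  unfolding beta_measure_def by (subst nn_integral_density) auto

lemma AE_beta_measure: "AE x in beta_measure a b. 0 < x \<and> x < 1"
  unfolding beta_measure_def by (subst AE_density) (auto simp: beta_density_def)

text \<open>Tilting a Beta density by powers of \<open>x\<close> and \<open>1 - x\<close>, possibly
  negative ones, gives another Beta density up to the ratio of the normalising constants. Quadratic
  and logarithmic moments are both read off from this.\<close>

lemma nn_integral_beta_tilt:
  assumes pos: "0 < a" "0 < b" "0 < a + s" "0 < b + t" and [measurable]: "f \<in> borel_measurable borel"
  shows "(\<integral>\<^sup>+x. ennreal (x powr s * (1 - x) powr t) * f x \<partial>beta_measure a b) =
    ennreal (Beta (a + s) (b + t) / Beta a b) * (\<integral>\<^sup>+x. f x \<partial>beta_measure (a + s) (b + t))"
proof -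
  have "ennreal (beta_density a b x) * (ennreal (x powr s * (1 - x) powr t) * f x) =
    ennreal (Beta (a + s) (b + t) / Beta a b) * (ennreal (beta_density (a + s) (b + t) x) * f x)" for x
  proof (cases "0 < x \<and> x < 1")
    case True
    have "beta_density a b x * (x powr s * (1 - x) powr t) =
      Beta (a + s) (b + t) / Beta a b * beta_density (a + s) (b + t) x"
    proof -
      have "x powr (a + s - 1) = x powr (a - 1) * x powr s"
        "(1 - x) powr (b + t - 1) = (1 - x) powr (b - 1) * (1 - x) powr t"
        by (simp_all add: powr_add[symmetric] algebra_simps)
      then show ?thesis
        using True Beta_real_pos[OF pos(3,4)] by (simp add: beta_density_def mult_ac)
    qed
    then have "ennreal (beta_density a b x) * ennreal (x powr s * (1 - x) powr t) =
      ennreal (Beta (a + s) (b + t) / Beta a b) * ennreal (beta_density (a + s) (b + t) x)"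
      using beta_density_nonneg[OF pos(1,2)] beta_density_nonneg[OF pos(3,4)] Beta_real_pos[OF pos(3,4)]
        Beta_real_pos[OF pos(1,2)]
      by (simp add: ennreal_mult[symmetric])
    then show ?thesis by (simp add: mult.assoc[symmetric])
  qed (auto simp: beta_density_def)
  then show ?thesis
    by (simp add: nn_integral_beta_measure nn_integral_cmult)
qed

lemma nn_integral_beta_reflect:
  assumes [measurable]: "f \<in> borel_measurable borel"
  shows "(\<integral>\<^sup>+x. f (1 - x) \<partial>beta_measure a b) = (\<integral>\<^sup>+x. f x \<partial>beta_measure b a)"
proof -
  have "(\<integral>\<^sup>+x. f x \<partial>beta_measure b a) = (\<integral>\<^sup>+x. ennreal (beta_density b a x) * f x \<partial>lborel)"
    by (rule nn_integral_beta_measure) measurable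
  also have "\<dots> = (\<integral>\<^sup>+x. ennreal (beta_density b a (1 - x)) * f (1 - x) \<partial>lborel)"
    by (subst nn_integral_real_affine[of _ "-1" 1]) auto
  also have "\<dots> = (\<integral>\<^sup>+x. ennreal (beta_density a b x) * f (1 - x) \<partial>lborel)"
    by (rule nn_integral_cong) (auto simp: beta_density_def Beta_commute mult.commute)
  also have "\<dots> = (\<integral>\<^sup>+x. f (1 - x) \<partial>beta_measure a b)"
    by (rule nn_integral_beta_measure[symmetric]) measurable
  finally show ?thesis ..
qed

section \<open>Quadratic and logarithmic moments of Beta laws\<close>

lemma ennreal_add_le_imp_le_diff:
  assumes "I + ennreal x \<le> ennreal y" "0 \<le> x"
  shows "I \<le> ennreal (y - x)"
proof (cases I)
  case (real r)
  then show ?thesis using assms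
    by (cases "0 \<le> y") (auto simp: ennreal_plus[symmetric] ennreal_neg simp del: ennreal_plus intro: ennreal_leI)
qed (use assms in \<open>simp add: top_unique\<close>)

text \<open>Since \<open>(2 * x - 1)\<^sup>2 = 1 - 4 * x * (1 - x)\<close>, one tilt with
  \<open>s = t = 1\<close> suffices. The right-hand side is the exact second moment, in the form in
  which the parameters of a tree are later controlled.\<close>

lemma nn_integral_beta_centred_sq:
  assumes ab: "0 < a" "0 < b"
  shows "(\<integral>\<^sup>+x. ennreal ((2 * x - 1)\<^sup>2) \<partial>beta_measure a b) \<le>
    ennreal (((a - b)\<^sup>2 + (a + b)) / ((a + b) * (a + b + 1)))"
proof -
  interpret prob_space "beta_measure a b" by (rule prob_space_beta_measure[OF ab])
  define c where "c = 4 * (a * b) / ((a + b) * (a + b + 1))"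
  have nz: "a \<notin> \<int>\<^sub>\<le>\<^sub>0" "b \<notin> \<int>\<^sub>\<le>\<^sub>0" using ab by (auto simp: nonpos_Ints_def)
  have 1: "Beta (a + 1) (b + 1) / Beta a b = a * b / ((a + b) * (a + b + 1))"
  proof -
    have "(a + b) * Beta (a + 1) b = a * Beta a b"
      "(a + 1 + b) * Beta (a + 1) (b + 1) = b * Beta (a + 1) b"
      using Beta_plus1_left[OF nz(1), of b] Beta_plus1_right[OF nz(2), of "a + 1"] by auto
    then have "(a + b) * ((a + b + 1) * Beta (a + 1) (b + 1)) = b * (a * Beta a b)"
      by (simp add: algebra_simps)
    then have "Beta (a + 1) (b + 1) * ((a + b) * (a + b + 1)) = a * b * Beta a b"
      by (simp only: mult_ac)
    then show ?thesis using ab Beta_real_pos[OF ab] by (subst frac_eq_eq) auto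
  qed
  have "(\<integral>\<^sup>+x. ennreal (4 * (x * (1 - x))) \<partial>beta_measure a b) =
      (\<integral>\<^sup>+x. ennreal (x powr 1 * (1 - x) powr 1) * 4 \<partial>beta_measure a b)"
    using AE_beta_measure
  proof (intro nn_integral_cong_AE, eventually_elim)
    case (elim x)
    then show ?case by (simp add: ennreal_mult mult.commute)
  qed
  also have "\<dots> = ennreal (a * b / ((a + b) * (a + b + 1))) * 4"
    using prob_space.emeasure_space_1[OF prob_space_beta_measure[of "a + 1" "b + 1"]] ab
    by (subst nn_integral_beta_tilt) (auto simp: 1)
  also have "\<dots> = ennreal c"
    using ab by (simp add: c_def ennreal_mult'[symmetric] mult_ac flip: ennreal_numeral)
  finally have 2: "(\<integral>\<^sup>+x. ennreal (4 * (x * (1 - x))) \<partial>beta_measure a b) = ennreal c" .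
  have "(\<integral>\<^sup>+x. ennreal ((2 * x - 1)\<^sup>2) \<partial>beta_measure a b) + ennreal c =
      (\<integral>\<^sup>+x. ennreal ((2 * x - 1)\<^sup>2) + ennreal (4 * (x * (1 - x))) \<partial>beta_measure a b)"
    unfolding 2[symmetric] by (subst nn_integral_add) auto
  also have "\<dots> = (\<integral>\<^sup>+x. 1 \<partial>beta_measure a b)"
    using AE_beta_measure
  proof (intro nn_integral_cong_AE, eventually_elim)
    case (elim x)
    have "(2 * x - 1)\<^sup>2 + 4 * (x * (1 - x)) = 1" by (simp add: power2_eq_square algebra_simps)
    then show ?case using elim by (simp add: ennreal_plus[symmetric] del: ennreal_plus)
  qed
  also have "\<dots> = ennreal 1" using emeasure_space_1 by simp
  finally have "(\<integral>\<^sup>+x. ennreal ((2 * x - 1)\<^sup>2) \<partial>beta_measure a b) \<le> ennreal (1 - c)"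
    using ab by (intro ennreal_add_le_imp_le_diff) (auto simp: c_def)
  also have "1 - c = ((a - b)\<^sup>2 + (a + b)) / ((a + b) * (a + b + 1))"
  proof -
    have "(a + b) * (a + b + 1) > 0" using ab by simp
    then show ?thesis by (simp add: c_def field_simps power2_eq_square)
  qed
  finally show ?thesis .
qed

text \<open>The mean value theorem for \<open>ln_Gamma\<close> on the interval from \<open>x\<close>
  to \<open>x + 1\<close>: the increment is \<open>ln x\<close> by the functional equation, and it
  is a value of the increasing function \<open>Digamma\<close> in between.\<close>

lemma Digamma_le_ln:
  assumes x: "(0::real) < x"
  shows "Digamma x \<le> ln x" "ln x \<le> Digamma (x + 1)"
proof -
  have "\<exists>z>x. z < x + 1 \<and> ln_Gamma (x + 1) - ln_Gamma x = (x + 1 - x) * Digamma z"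
    by (rule MVT2) (use x in \<open>auto intro!: has_field_derivative_ln_Gamma_real\<close>)
  then obtain z where z: "x < z" "z < x + 1" "ln_Gamma (x + 1) - ln_Gamma x = Digamma z"
    by auto
  have "ln_Gamma (x + 1) = ln (Gamma (x + 1))" "ln_Gamma x = ln (Gamma x)"
    by (rule ln_Gamma_real_pos; use x in simp)+
  moreover have "Gamma (x + 1) = x * Gamma x"
    using x by (intro Gamma_plus1) (auto simp: nonpos_Ints_def)
  ultimately have "ln x = Digamma z"
    using z(3) x Gamma_real_pos[of x] by (simp add: ln_mult_pos)
  then show "Digamma x \<le> ln x" "ln x \<le> Digamma (x + 1)"
    using z x Digamma_real_mono[of x z] Digamma_real_mono[of z "x + 1"] by auto
qed

text \<open>The mean of \<open>- ln x\<close> is the derivative at 0 of \<open>g s\<close>, the mean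
  of \<open>x powr (- s)\<close>. Convexity of the exponential bounds it by every difference
  quotient of \<open>g\<close>, so there is no differentiation under the integral. The limit
  \<open>Digamma (a + b) - Digamma a\<close> is bounded by logarithms, where the shift of
  \<open>Digamma\<close> by one costs \<open>1 / a\<close>.\<close>

lemma nn_integral_beta_ln:
  assumes ab: "0 < a" "0 < b"
  shows "(\<integral>\<^sup>+x. ennreal (- ln x) \<partial>beta_measure a b) \<le> ennreal (ln ((a + b) / a) + 1 / a)"
proof -
  interpret prob_space "beta_measure a b" by (rule prob_space_beta_measure[OF ab])
  define g where "g s = Beta (a - s) b / Beta a b" for s
  have *: "(\<integral>\<^sup>+x. ennreal (- ln x) \<partial>beta_measure a b) \<le> ennreal ((g s - g 0) / s)" if s: "0 < s" "s < a" for s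
  proof -
    have "(\<integral>\<^sup>+x. ennreal (- ln x) \<partial>beta_measure a b) + ennreal (1 / s) =
      (\<integral>\<^sup>+x. ennreal (- ln x) + ennreal (1 / s) \<partial>beta_measure a b)"
      using emeasure_space_1 by (subst nn_integral_add) auto
    also have "\<dots> \<le> (\<integral>\<^sup>+x. ennreal (x powr (- s) * (1 - x) powr 0) * ennreal (1 / s) \<partial>beta_measure a b)"
      using AE_beta_measure
    proof (intro nn_integral_mono_AE, eventually_elim)
      case (elim x)
      have "- ln x \<ge> 0" using elim by simp
      have "1 + s * (- ln x) \<le> exp (s * (- ln x))" by (rule exp_ge_add_one_self)
      also have "\<dots> = x powr (- s)" using elim by (simp add: powr_def)
      finally have "(1 + s * (- ln x)) / s \<le> x powr (- s) / s"
        using s by (intro divide_right_mono) auto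
      then have "- ln x + 1 / s \<le> x powr (- s) * (1 / s)"
        using s by (simp add: diff_divide_distrib)
      then show ?case using elim s
        by (simp add: ennreal_mult[symmetric] ennreal_plus[symmetric] del: ennreal_plus)
    qed
    also have "\<dots> = ennreal (g s) * ennreal (1 / s)"
      using prob_space.emeasure_space_1[OF prob_space_beta_measure[of "a - s" b]] ab s
      by (subst nn_integral_beta_tilt) (auto simp: g_def)
    also have "\<dots> = ennreal (g s / s)"
      using s ab Beta_real_pos[of "a - s" b] Beta_real_pos[of a b] by (simp add: ennreal_mult[symmetric] g_def)
    finally have "(\<integral>\<^sup>+x. ennreal (- ln x) \<partial>beta_measure a b) \<le> ennreal (g s / s - 1 / s)"
      using s by (intro ennreal_add_le_imp_le_diff) auto
    moreover have "g 0 = 1" using Beta_real_pos[OF ab] by (simp add: g_def)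
    ultimately show ?thesis by (simp add: diff_divide_distrib)
  qed
  have "(g has_field_derivative (Digamma (a + b) - Digamma a)) (at 0)"
  proof -
    have 1: "((\<lambda>s. a - s) has_field_derivative (-1)) (at 0)"
      by (auto intro!: derivative_eq_intros)
    have 2: "((\<lambda>x. Beta x b) has_field_derivative (Beta a b * (Digamma a - Digamma (a + b)))) (at (a - 0))"
      using ab by (auto intro!: derivative_eq_intros simp: nonpos_Ints_def)
    have "((\<lambda>s. Beta (a - s) b / Beta a b) has_field_derivative ((Beta a b * (Digamma a - Digamma (a + b))) * (-1)) / Beta a b) (at 0)"
      by (intro DERIV_cdivide DERIV_chain2[OF 2 1])
    then show ?thesis using Beta_real_pos[OF ab] unfolding g_def[abs_def] by simp
  qed
  then have "((\<lambda>s. (g s - g 0) / s) \<longlongrightarrow> Digamma (a + b) - Digamma a) (at 0)"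
    by (simp add: has_field_derivative_iff)
  then have "((\<lambda>s. ennreal ((g s - g 0) / s)) \<longlongrightarrow> ennreal (Digamma (a + b) - Digamma a)) (at_right 0)"
    by (intro tendsto_ennrealI) (rule tendsto_mono[OF at_le[OF subset_UNIV]])
  then have "(\<integral>\<^sup>+x. ennreal (- ln x) \<partial>beta_measure a b) \<le> ennreal (Digamma (a + b) - Digamma a)"
  proof (rule tendsto_lowerbound)
    show "\<forall>\<^sub>F s in at_right 0. (\<integral>\<^sup>+x. ennreal (- ln x) \<partial>beta_measure a b) \<le> ennreal ((g s - g 0) / s)"
      using eventually_at_right_less[of 0] eventually_at_right[of 0 a] *
      by (auto simp: eventually_at_right[OF ab(1)] intro!: exI[of _ a] ab)
  qed simp
  also have "\<dots> \<le> ennreal (ln ((a + b) / a) + 1 / a)"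
    using Digamma_le_ln[of "a + b"] Digamma_le_ln[of a] Digamma_plus1[of a] ab
    by (intro ennreal_leI) (auto simp: ln_div)
  finally show ?thesis .
qed

text \<open>Compared with the divergence at the mean \<open>a / (a + b)\<close>, the fluctuation of
  \<open>v\<close> costs only the terms \<open>1 / a\<close> and \<open>1 / b\<close> of the two
  logarithmic moments.\<close>

lemma nn_integral_beta_bernoulli_kl:
  assumes ab: "0 < a" "0 < b" and q: "0 \<le> q" "q \<le> 1"
  shows "(\<integral>\<^sup>+v. ennreal (bernoulli_kl q v) \<partial>beta_measure a b) \<le>
    ennreal (bernoulli_kl q (a / (a + b)) + (q / a + (1 - q) / b))"
proof -
  \<comment> \<open>The entropy of \<open>q\<close>. Adding it turns the divergence into a
    nonnegative combination of \<open>- ln v\<close> and \<open>- ln (1 - v)\<close>, and its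
    subtraction is deferred to real numbers.\<close>
  define c where "c = - (q * ln q + (1 - q) * ln (1 - q))"
  have c: "c \<ge> 0"
  proof -
    have *: "r * ln r \<le> 0" if "0 \<le> r" "r \<le> 1" for r :: real
      using that by (cases "r = 0") (auto intro: mult_nonneg_nonpos)
    show ?thesis using *[of q] *[of "1 - q"] q by (simp add: c_def)
  qed
  have kl: "bernoulli_kl q v + c = q * (- ln v) + (1 - q) * (- ln (1 - v))" if "0 < v" "v < 1" for v
  proof -
    have *: "r * ln (r / w) = r * ln r + r * (- ln w)" if "0 \<le> r" "0 < w" for r w :: real
      using that by (cases "r = 0") (auto simp: ln_div algebra_simps)
    show ?thesis using *[of q v] *[of "1 - q" "1 - v"] that q by (simp add: bernoulli_kl_def c_def)
  qed
  have "(\<integral>\<^sup>+v. ennreal (bernoulli_kl q v) \<partial>beta_measure a b) + ennreal c =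
      (\<integral>\<^sup>+v. ennreal (bernoulli_kl q v) + ennreal c \<partial>beta_measure a b)"
    using prob_space.emeasure_space_1[OF prob_space_beta_measure[OF ab]]
    by (subst nn_integral_add) (auto simp: bernoulli_kl_def[abs_def])
  also have "\<dots> = (\<integral>\<^sup>+v. ennreal q * ennreal (- ln v) + ennreal (1 - q) * ennreal (- ln (1 - v)) \<partial>beta_measure a b)"
    using AE_beta_measure
  proof (intro nn_integral_cong_AE, eventually_elim)
    case (elim v)
    then have "0 \<le> bernoulli_kl q v" using q by (intro bernoulli_kl_nonneg) auto
    then have "ennreal (bernoulli_kl q v) + ennreal c = ennreal (q * (- ln v) + (1 - q) * (- ln (1 - v)))"
      using c elim by (subst kl[symmetric]) (auto simp: ennreal_plus)
    also have "\<dots> = ennreal q * ennreal (- ln v) + ennreal (1 - q) * ennreal (- ln (1 - v))"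
      using elim q by (subst ennreal_plus) (auto simp: ennreal_mult[symmetric] intro!: mult_nonneg_nonpos)
    finally show ?case .
  qed
  also have "\<dots> = ennreal q * (\<integral>\<^sup>+v. ennreal (- ln v) \<partial>beta_measure a b) +
      ennreal (1 - q) * (\<integral>\<^sup>+v. ennreal (- ln v) \<partial>beta_measure b a)"
    using nn_integral_beta_reflect[of "\<lambda>v. ennreal (- ln v)" a b]
    by (subst nn_integral_add) (auto simp: nn_integral_cmult)
  also have "\<dots> \<le> ennreal q * ennreal (ln ((a + b) / a) + 1 / a) + ennreal (1 - q) * ennreal (ln ((b + a) / b) + 1 / b)"
    using ab by (intro add_mono mult_left_mono nn_integral_beta_ln) auto
  also have "\<dots> = ennreal (q * (ln ((a + b) / a) + 1 / a) + (1 - q) * (ln ((b + a) / b) + 1 / b))"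
    using q ab by (subst ennreal_plus) (auto simp: ennreal_mult intro!: mult_nonneg_nonneg add_nonneg_nonneg)
  finally have "(\<integral>\<^sup>+v. ennreal (bernoulli_kl q v) \<partial>beta_measure a b) \<le>
      ennreal (q * (ln ((a + b) / a) + 1 / a) + (1 - q) * (ln ((b + a) / b) + 1 / b) - c)"
    using c by (rule ennreal_add_le_imp_le_diff)
  also have "q * (ln ((a + b) / a) + 1 / a) + (1 - q) * (ln ((b + a) / b) + 1 / b) - c =
      bernoulli_kl q (a / (a + b)) + (q / a + (1 - q) / b)"
  proof -
    have "1 - a / (a + b) = b / (a + b)" using ab by (simp add: field_simps)
    then have "bernoulli_kl q (a / (a + b)) + c = q * ln ((a + b) / a) + (1 - q) * ln ((b + a) / b)"
      using kl[of "a / (a + b)"] ab by (simp add: ln_div add.commute)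
    then show ?thesis by (simp add: algebra_simps)
  qed
  finally show ?thesis .
qed

text \<open>Reflection at \<open>1 / 2\<close> exchanges the two half-lines, and together they cover
  the whole mass.\<close>

lemma emeasure_beta_symmetric:
  assumes a: "0 < a"
  shows "1 / 2 \<le> measure (beta_measure a a) {..1/2}" "1 / 2 \<le> measure (beta_measure a a) {1/2..}"
proof -
  interpret prob_space "beta_measure a a" by (rule prob_space_beta_measure[OF a a])
  have "emeasure (beta_measure a a) {..1/2} = (\<integral>\<^sup>+x. indicator {..1/2} x \<partial>beta_measure a a)"
    by simp
  also have "\<dots> = (\<integral>\<^sup>+x. indicator {..1/2} (1 - x) \<partial>beta_measure a a)"
    by (rule nn_integral_beta_reflect[symmetric]) simp
  also have "\<dots> = (\<integral>\<^sup>+x. indicator {1/2..} x \<partial>beta_measure a a)"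
    by (rule nn_integral_cong) (auto simp: indicator_def)
  also have "\<dots> = emeasure (beta_measure a a) {1/2..}" by simp
  finally have eq: "measure (beta_measure a a) {..1/2} = measure (beta_measure a a) {1/2..}"
    by (simp add: measure_def)
  have "1 = measure (beta_measure a a) ({..1/2} \<union> {1/2..})"
  proof -
    have "{..1/2} \<union> {1/2..} = (UNIV :: real set)" by auto
    then show ?thesis using prob_space by simp
  qed
  also have "\<dots> \<le> measure (beta_measure a a) {..1/2} + measure (beta_measure a a) {1/2..}"
    by (rule measure_Un_le) auto
  finally show "1 / 2 \<le> measure (beta_measure a a) {..1/2}" "1 / 2 \<le> measure (beta_measure a a) {1/2..}"
    using eq by auto
qed

section \<open>Binary partitions and their martingales\<close>

abbreviation level :: "nat \<Rightarrow> bool list set" where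
  "level l \<equiv> {e. length e = l}"

lemma finite_level [simp]: "finite (level l)"
  using finite_lists_length_eq[of "UNIV :: bool set" l] by simp

lemma level_0 [simp]: "level 0 = {[]}"
  by auto

lemma card_level: "card (level l) = 2 ^ l"
  using card_lists_length_eq[of "UNIV :: bool set" l] by (simp add: card_UNIV_bool)

lemma sum_level_Suc:
  fixes g :: "bool list \<Rightarrow> 'b::comm_monoid_add"
  shows "(\<Sum>e\<in>level (Suc l). g e) = (\<Sum>e\<in>level l. g (e @ [False]) + g (e @ [True]))"
proof -
  have *: "level (Suc l) = (\<lambda>e. e @ [False]) ` level l \<union> (\<lambda>e. e @ [True]) ` level l"
  proof (intro set_eqI iffI)
    fix e :: "bool list" assume "e \<in> level (Suc l)"
    then obtain xs x where "e = xs @ [x]" "length xs = l"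
      by (cases e rule: rev_cases) auto
    then show "e \<in> (\<lambda>e. e @ [False]) ` level l \<union> (\<lambda>e. e @ [True]) ` level l"
      by (cases x) auto
  qed auto
  have "(\<Sum>e\<in>level (Suc l). g e) = (\<Sum>e\<in>(\<lambda>e. e @ [False]) ` level l. g e) + (\<Sum>e\<in>(\<lambda>e. e @ [True]) ` level l. g e)"
    unfolding * by (rule sum.union_disjoint) auto
  also have "\<dots> = (\<Sum>e\<in>level l. g (e @ [False])) + (\<Sum>e\<in>level l. g (e @ [True]))"
    by (subst (1 2) sum.reindex) (auto simp: inj_on_def)
  finally show ?thesis by (simp add: sum.distrib)
qed

definition additive :: "(bool list \<Rightarrow> real) \<Rightarrow> bool" where
  "additive p \<longleftrightarrow> (\<forall>e. p (e @ [False]) + p (e @ [True]) = p e)"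

text \<open>The factor \<psi> is constant on the descendants of a node, so additivity sums out the
  lower levels one at a time: the tower property of conditional expectations in discrete
  form.\<close>

lemma sum_level_take:
  fixes p \<psi> :: "bool list \<Rightarrow> real"
  assumes p: "additive p" and "l \<le> m"
  shows "(\<Sum>e\<in>level m. p e * \<psi> (take l e)) = (\<Sum>e\<in>level l. p e * \<psi> e)"
  using \<open>l \<le> m\<close>
proof (induction m rule: dec_induct)
  case base
  then show ?case by (auto intro: sum.cong)
next
  case (step m)
  have "(\<Sum>e\<in>level (Suc m). p e * \<psi> (take l e)) = (\<Sum>e\<in>level m. p e * \<psi> (take l e))"
    using p step.hyps unfolding sum_level_Suc additive_def
    by (intro sum.cong) (auto simp: distrib_right[symmetric])
  with step.IH show ?case by simp
qed

lemma additive_sum: "additive p \<Longrightarrow> (\<Sum>e\<in>level l. p e) = p []"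
  using sum_level_take[of p 0 l "\<lambda>_. 1"] by simp

text \<open>The address of the set of level \<open>l\<close> that contains \<open>x\<close>. Only
  the child with the digit 1 is tested, so an address exists for every \<open>x\<close>; in a
  partition tree a point outside the domain gets only zeros.\<close>

primrec tree_node :: "(bool list \<Rightarrow> 'a set) \<Rightarrow> nat \<Rightarrow> 'a \<Rightarrow> bool list" where
  "tree_node B 0 x = []"
| "tree_node B (Suc l) x = tree_node B l x @ [x \<in> B (tree_node B l x @ [True])]"

lemma length_tree_node [simp]: "length (tree_node B l x) = l"
  by (induction l) auto

lemma take_tree_node: "k \<le> l \<Longrightarrow> take k (tree_node B l x) = tree_node B k x"
  by (induction l) (auto simp: le_Suc_eq)

section \<open>Integration of step functions on the levels of a partition tree\<close>

locale binary_tree =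
  fixes \<X> :: "'a::euclidean_space set" and B :: "bool list \<Rightarrow> 'a set"
  assumes tree: "partition_tree \<X> B"
    and lebesgue: "\<And>e. emeasure lborel (B e) = ennreal ((1 / 2) ^ length e)"
begin

abbreviation node :: "nat \<Rightarrow> 'a \<Rightarrow> bool list" where "node \<equiv> tree_node B"

lemma B_root: "B [] = \<X>" and B_borel [measurable]: "B e \<in> sets borel"
  and B_split: "B (e @ [False]) \<union> B (e @ [True]) = B e"
  and B_disj: "B (e @ [False]) \<inter> B (e @ [True]) = {}"
  and B_gen: "sigma_sets \<X> (range B) = sets (restrict_space borel \<X>)"
  using tree by (auto simp: partition_tree_def)

lemma X_borel [measurable]: "\<X> \<in> sets borel"
  using B_borel[of "[]"] by (simp only: B_root)

lemma B_sub: "B e \<subseteq> \<X>"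
proof (induction e rule: rev_induct)
  case (snoc b e)
  then show ?case using B_split[of e] by (cases b) auto
qed (simp add: B_root)

lemma sets_leb [measurable_cong]: "sets (leb_on \<X>) = sets (restrict_space borel \<X>)"
  by (rule sets_restrict_space_cong) simp

lemma space_leb [simp]: "space (leb_on \<X>) = \<X>"
  by (simp add: space_restrict_space)

lemma B_sets [measurable]: "B e \<in> sets (leb_on \<X>)" "B e \<in> sets (restrict_space borel \<X>)"
  using B_sub by (auto simp: sets_restrict_space_iff)

lemma emeasure_B: "emeasure (leb_on \<X>) (B e) = ennreal ((1 / 2) ^ length e)"
  using B_sub by (subst emeasure_restrict_space) (auto simp: lebesgue)

lemma measure_B: "measure (leb_on \<X>) (B e) = (1 / 2) ^ length e"
  by (simp add: measure_def emeasure_B)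

sublocale leb: prob_space "leb_on \<X>"
  using emeasure_B[of "[]"] by (intro prob_spaceI) (simp add: B_root)

lemma node_mem: "x \<in> \<X> \<Longrightarrow> x \<in> B (node l x)"
proof (induction l)
  case (Suc l)
  then show ?case using B_split[of "node l x"] by (cases "x \<in> B (node l x @ [True])") auto
qed (simp add: B_root)

lemma node_eq: "x \<in> B e \<Longrightarrow> node (length e) x = e"
proof (induction e rule: rev_induct)
  case (snoc b e)
  have "x \<in> B e" using snoc.prems B_split[of e] by (cases b) auto
  with snoc.IH have "node (length e) x = e" by simp
  then show ?case using snoc.prems B_disj[of e] by (cases b) auto
qed simp

lemma mem_B_iff: "x \<in> \<X> \<Longrightarrow> x \<in> B e \<longleftrightarrow> node (length e) x = e"
  using node_eq node_mem by metis

lemma B_prefix: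
  assumes "length e \<le> length e'"
  shows "B e \<inter> B e' = (if take (length e) e' = e then B e' else {})"
proof -
  have *: "node (length e) x = take (length e) e'" if "x \<in> B e'" for x
    using node_eq[OF that] take_tree_node[OF assms, of B x] by simp
  show ?thesis
  proof (cases "take (length e) e' = e")
    case True
    then have "B e' \<subseteq> B e" using * B_sub mem_B_iff by (metis subset_iff)
    with True show ?thesis by auto
  next
    case False
    then show ?thesis using * node_eq by force
  qed
qed

lemma Int_stable_B: "Int_stable (insert {} (range B))"
proof (rule Int_stableI)
  fix a b assume "a \<in> insert {} (range B)" "b \<in> insert {} (range B)"
  moreover have "B e \<inter> B e' \<in> insert {} (range B)" for e e'
    using B_prefix[of e e'] B_prefix[of e' e] by (cases "length e \<le> length e'") (auto simp: Int_commute)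
  ultimately show "a \<inter> b \<in> insert {} (range B)" by auto
qed

lemma sigma_sets_B: "sigma_sets \<X> (insert {} (range B)) = sets (restrict_space borel \<X>)"
proof -
  have "sigma_sets \<X> (insert {} (range B)) = sigma_sets \<X> (range B)"
    by (intro sigma_sets_eqI) (auto intro: sigma_sets.Empty)
  then show ?thesis by (simp add: B_gen)
qed

lemma measure_eq_on_tree:
  assumes "sets P = sets (restrict_space borel \<X>)" "sets Q = sets (restrict_space borel \<X>)"
    and "\<And>e. emeasure P (B e) = emeasure Q (B e)" and "emeasure P \<X> \<noteq> \<infinity>"
  shows "P = Q"
proof (rule measure_eqI_generator_eq[where E="insert {} (range B)" and \<Omega>=\<X> and A="\<lambda>_. \<X>"])
  show "range (\<lambda>_. \<X>) \<subseteq> insert {} (range B)" using B_root by (metis image_subset_iff insertI2 rangeI)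
  show "insert {} (range B) \<subseteq> Pow \<X>" using B_sub by blast
qed (use assms Int_stable_B sigma_sets_B in auto)

text \<open>At a point of the domain exactly one indicator of the level is nonzero. The semiring
  covers both \<open>real\<close> and \<open>ennreal\<close>, for the two kinds of integral.\<close>

lemma node_expand:
  fixes g :: "bool list \<Rightarrow> 'b::semiring_1"
  assumes "x \<in> \<X>"
  shows "g (node l x) = (\<Sum>e\<in>level l. g e * indicator (B e) x)"
proof -
  have "(\<Sum>e\<in>level l. g e * indicator (B e) x) = (\<Sum>e\<in>level l. if e = node l x then g e else 0)"
    using mem_B_iff[OF assms] by (intro sum.cong) (auto simp: indicator_def)
  then show ?thesis by (simp add: sum.delta)
qed

lemma node_measurable [measurable]: "(\<lambda>x. (g (node l x) :: real)) \<in> borel_measurable (leb_on \<X>)"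
proof -
  have "(\<lambda>x. \<Sum>e\<in>level l. g e * indicator (B e) x) \<in> borel_measurable (leb_on \<X>)"
    by measurable
  then show ?thesis
    by (rule measurable_cong[THEN iffD2, rotated]) (simp add: node_expand)
qed

lemma node_integrable [simp]: "integrable (leb_on \<X>) (\<lambda>x. (g (node l x) :: real))"
proof (rule leb.integrable_const_bound)
  show "AE x in leb_on \<X>. norm (g (node l x)) \<le> (\<Sum>e\<in>level l. \<bar>g e\<bar>)"
    by (intro AE_I2) (auto intro: member_le_sum[of _ _ "\<lambda>e. \<bar>g e\<bar>"])
qed measurable

lemma integral_node_mult:
  fixes h :: "'a \<Rightarrow> real"
  assumes h: "integrable (leb_on \<X>) h"
  shows "(\<integral>x. g (node l x) * h x \<partial>leb_on \<X>) = (\<Sum>e\<in>level l. g e * (\<integral>x. indicator (B e) x * h x \<partial>leb_on \<X>))"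
proof -
  have "(\<integral>x. g (node l x) * h x \<partial>leb_on \<X>) = (\<integral>x. (\<Sum>e\<in>level l. g e * (indicator (B e) x * h x)) \<partial>leb_on \<X>)"
    by (intro Bochner_Integration.integral_cong) (simp_all only: space_leb node_expand[of _ g] sum_distrib_right mult.assoc)
  also have "\<dots> = (\<Sum>e\<in>level l. g e * (\<integral>x. indicator (B e) x * h x \<partial>leb_on \<X>))"
  proof (subst Bochner_Integration.integral_sum)
    show "integrable (leb_on \<X>) (\<lambda>x. g e * (indicator (B e) x * h x))" for e
      using integrable_mult_indicator[OF B_sets(1)[of e] h] by simp
  qed simp
  finally show ?thesis .
qed

lemma integral_node:
  fixes g :: "bool list \<Rightarrow> real"
  shows "(\<integral>x. g (node l x) \<partial>leb_on \<X>) = (\<Sum>e\<in>level l. g e * (1 / 2) ^ l)"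
  using integral_node_mult[of "\<lambda>_. 1" g l] measure_B by (auto simp: Int_absorb2 B_sub measure_B intro!: sum.cong)

lemma nn_integral_node: "(\<integral>\<^sup>+x. g (node l x) \<partial>leb_on \<X>) = (\<Sum>e\<in>level l. g e * ennreal ((1 / 2) ^ l))"
proof -
  have "(\<integral>\<^sup>+x. g (node l x) \<partial>leb_on \<X>) = (\<integral>\<^sup>+x. (\<Sum>e\<in>level l. g e * indicator (B e) x) \<partial>leb_on \<X>)"
    by (intro nn_integral_cong) (auto simp: node_expand[of _ g])
  also have "\<dots> = (\<Sum>e\<in>level l. g e * ennreal ((1 / 2) ^ l))"
    by (subst nn_integral_sum) (auto simp: nn_integral_cmult emeasure_B)
  finally show ?thesis .
qed

definition mass :: "('a \<Rightarrow> real) \<Rightarrow> bool list \<Rightarrow> real" where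
  "mass f e = (\<integral>x. indicator (B e) x * f x \<partial>leb_on \<X>)"

lemma mass_integrable: "integrable (leb_on \<X>) f \<Longrightarrow> integrable (leb_on \<X>) (\<lambda>x. indicator (B e) x * f x)"
  for f :: "'a \<Rightarrow> real"
  using integrable_mult_indicator[OF B_sets(1)[of e], of f] by simp

lemma mass_additive:
  assumes "integrable (leb_on \<X>) f"
  shows "additive (mass f)"
  unfolding additive_def
proof
  fix e
  have *: "indicator (B e) x * f x = indicator (B (e @ [False])) x * f x + indicator (B (e @ [True])) x * f x" for x
    using B_split[of e] B_disj[of e] by (auto simp: indicator_def)
  show "mass f (e @ [False]) + mass f (e @ [True]) = mass f e"
    unfolding mass_def * using assms
    by (intro Bochner_Integration.integral_add[symmetric] mass_integrable)
qed

lemma mass_nonneg: "(\<And>x. x \<in> \<X> \<Longrightarrow> 0 \<le> f x) \<Longrightarrow> 0 \<le> mass f e"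
  unfolding mass_def by (intro integral_nonneg_AE AE_I2) (auto simp: indicator_def)

lemma mass_root: "mass f [] = (\<integral>x. f x \<partial>leb_on \<X>)"
  unfolding mass_def by (intro Bochner_Integration.integral_cong) (auto simp: B_root)

lemma emeasure_density_B:
  assumes f: "integrable (leb_on \<X>) f" "\<And>x. x \<in> \<X> \<Longrightarrow> 0 \<le> f x"
  shows "emeasure (density (leb_on \<X>) (\<lambda>x. ennreal (f x))) (B e) = ennreal (mass f e)"
proof -
  have "emeasure (density (leb_on \<X>) (\<lambda>x. ennreal (f x))) (B e) = (\<integral>\<^sup>+x. ennreal (indicator (B e) x * f x) \<partial>leb_on \<X>)"
    using borel_measurable_integrable[OF f(1)] f(2)
    by (subst emeasure_density) (auto intro!: nn_integral_cong simp: indicator_def)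
  also have "\<dots> = ennreal (mass f e)"
    unfolding mass_def using f by (intro nn_integral_eq_integral mass_integrable AE_I2) (auto simp: indicator_def)
  finally show ?thesis .
qed

section \<open>The martingale of step densities and its energy\<close>

definition energy :: "(bool list \<Rightarrow> real) \<Rightarrow> nat \<Rightarrow> real" where
  "energy p l = 2 ^ l * (\<Sum>e\<in>level l. (p e)\<^sup>2)"

text \<open>The conditional expectation, given level \<open>l\<close>, of a density with masses
  \<open>p\<close>. For additive \<open>p\<close> these functions form a martingale over the levels,
  and \<open>energy p l\<close> is the squared L2 norm of the one at level \<open>l\<close>.\<close>

definition step_density :: "(bool list \<Rightarrow> real) \<Rightarrow> nat \<Rightarrow> 'a \<Rightarrow> real" where
  "step_density p l x = 2 ^ l * p (node l x)"

lemma step_density_integrable [simp]: "integrable (leb_on \<X>) (step_density p l)"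
  unfolding step_density_def[abs_def] by simp

lemma step_density_measurable [measurable]: "step_density p l \<in> borel_measurable (leb_on \<X>)"
  by (rule borel_measurable_integrable) simp

lemma additive_half: "additive (\<lambda>e. (1 / 2) ^ length e)"
  by (simp add: additive_def)

text \<open>Pythagoras for martingale increments: the mixed term collapses to level \<open>l\<close>
  by \<open>sum_level_take\<close> for \<open>p\<close>, and the square of the coarse function by
  the same rule for the Lebesgue masses.\<close>

lemma step_density_L2:
  assumes p: "additive p" and lm: "l \<le> m"
  shows "(\<integral>x. (step_density p m x - step_density p l x)\<^sup>2 \<partial>leb_on \<X>) = energy p m - energy p l"
proof -
  have "(\<integral>x. (step_density p m x - step_density p l x)\<^sup>2 \<partial>leb_on \<X>) =
    (\<integral>x. (\<lambda>e. (2 ^ m * p e - 2 ^ l * p (take l e))\<^sup>2) (node m x) \<partial>leb_on \<X>)"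
    using lm by (simp add: step_density_def take_tree_node)
  also have "\<dots> = (\<Sum>e\<in>level m. (2 ^ m * p e - 2 ^ l * p (take l e))\<^sup>2 * (1 / 2) ^ m)"
    by (rule integral_node)
  also have "\<dots> = (\<Sum>e\<in>level m. 2 ^ m * (p e)\<^sup>2 - 2 * 2 ^ l * (p e * p (take l e)) + (1 / 2) ^ m * (2 ^ l * p (take l e))\<^sup>2)"
    by (intro sum.cong) (auto simp: power2_eq_square power_one_over field_simps)
  also have "\<dots> = energy p m - 2 * 2 ^ l * (\<Sum>e\<in>level m. p e * p (take l e)) +
      (\<Sum>e\<in>level m. (1 / 2) ^ length e * (2 ^ l * p (take l e))\<^sup>2)"
    by (simp add: sum.distrib sum_subtractf sum_distrib_left energy_def)
  also have "(\<Sum>e\<in>level m. p e * p (take l e)) = (\<Sum>e\<in>level l. (p e)\<^sup>2)"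
    using sum_level_take[OF p lm, of p] by (simp add: power2_eq_square)
  also have "(\<Sum>e\<in>level m. (1 / 2) ^ length e * (2 ^ l * p (take l e))\<^sup>2) = (\<Sum>e\<in>level l. (1 / 2) ^ length e * (2 ^ l * p e)\<^sup>2)"
    by (rule sum_level_take[OF additive_half lm])
  also have "\<dots> = energy p l"
    unfolding energy_def sum_distrib_left by (intro sum.cong) (auto simp: power2_eq_square power_one_over field_simps)
  finally show ?thesis by (simp add: energy_def)
qed

lemma energy_mono: "additive p \<Longrightarrow> l \<le> m \<Longrightarrow> energy p l \<le> energy p m"
  using step_density_L2[of p l m] integral_nonneg_AE[of "\<lambda>x. (step_density p m x - step_density p l x)\<^sup>2" "leb_on \<X>"]
  by auto

text \<open>The Cauchy-Schwarz inequality on a probability space, read as nonnegativity of a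
  variance. The absolute value in the bound lets the two levels come in either order.\<close>

lemma step_density_L1:
  assumes p: "additive p"
  shows "(\<integral>x. \<bar>step_density p m x - step_density p l x\<bar> \<partial>leb_on \<X>) \<le> sqrt \<bar>energy p m - energy p l\<bar>"
proof -
  have *: "(\<integral>x. \<bar>step_density p m x - step_density p l x\<bar> \<partial>leb_on \<X>) \<le> sqrt \<bar>energy p m - energy p l\<bar>"
    if "l \<le> m" for l m
  proof -
    define f where "f = (\<lambda>x. \<bar>step_density p m x - step_density p l x\<bar>)"
    have f_node: "f = (\<lambda>x. (\<lambda>e. \<bar>2 ^ m * p e - 2 ^ l * p (take l e)\<bar>) (node m x))"
      using that by (simp add: f_def step_density_def take_tree_node fun_eq_iff)
    have "integrable (leb_on \<X>) f" "integrable (leb_on \<X>) (\<lambda>x. (f x)\<^sup>2)"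
      unfolding f_node by (rule node_integrable)+
    then have "0 \<le> (\<integral>x. (f x)\<^sup>2 \<partial>leb_on \<X>) - (\<integral>x. f x \<partial>leb_on \<X>)\<^sup>2"
      by (subst leb.variance_eq[symmetric]) (auto intro: leb.variance_positive)
    also have "(\<integral>x. (f x)\<^sup>2 \<partial>leb_on \<X>) = energy p m - energy p l"
      using step_density_L2[OF p that] by (simp add: f_def)
    finally show ?thesis using energy_mono[OF p that] by (intro real_le_rsqrt) (simp add: f_def)
  qed
  show ?thesis
  proof (cases "l \<le> m")
    case False
    then show ?thesis using *[of m l] by (simp add: abs_minus_commute)
  qed (rule *)
qed

lemma integral_step_density_B:
  assumes p: "additive p" and "length e \<le> l"
  shows "(\<integral>x. indicator (B e) x * step_density p l x \<partial>leb_on \<X>) = p e"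
proof -
  have "(\<integral>x. indicator (B e) x * step_density p l x \<partial>leb_on \<X>) =
    (\<integral>x. (\<lambda>e'. 2 ^ l * (p e' * (if take (length e) e' = e then 1 else 0))) (node l x) \<partial>leb_on \<X>)"
    using assms(2) by (intro Bochner_Integration.integral_cong)
      (auto simp: step_density_def take_tree_node mem_B_iff indicator_def)
  also have "\<dots> = (\<Sum>e'\<in>level l. p e' * (if take (length e) e' = e then 1 else 0))"
    by (subst integral_node[of "\<lambda>e'. 2 ^ l * (p e' * (if take (length e) e' = e then 1 else 0))" l])
      (auto intro!: sum.cong simp: power_one_over)
  also have "\<dots> = (\<Sum>e'\<in>level (length e). p e' * (if e' = e then 1 else 0))"
    by (rule sum_level_take[OF p assms(2)])
  also have "\<dots> = (\<Sum>e'\<in>level (length e). if e' = e then p e' else 0)"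
    by (intro sum.cong) auto
  also have "\<dots> = p e" by (simp add: sum.delta)
  finally show ?thesis .
qed

end

lemma AE_summable_of_summable_integral:
  fixes f :: "nat \<Rightarrow> 'a \<Rightarrow> real"
  assumes f: "\<And>i. integrable M (f i)" and s: "summable (\<lambda>i. \<integral>x. \<bar>f i x\<bar> \<partial>M)"
  shows "AE x in M. summable (\<lambda>i. \<bar>f i x\<bar>)"
proof -
  have [measurable]: "f i \<in> borel_measurable M" for i using f by auto
  have "(\<integral>\<^sup>+x. (\<Sum>i. ennreal \<bar>f i x\<bar>) \<partial>M) = (\<Sum>i. \<integral>\<^sup>+x. ennreal \<bar>f i x\<bar> \<partial>M)"
    by (rule nn_integral_suminf) measurable
  also have "\<dots> = (\<Sum>i. ennreal (\<integral>x. \<bar>f i x\<bar> \<partial>M))"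
    by (intro suminf_cong nn_integral_eq_integral) (auto intro: f)
  also have "\<dots> = ennreal (\<Sum>i. \<integral>x. \<bar>f i x\<bar> \<partial>M)"
    by (intro suminf_ennreal_eq summable_sums s) (auto intro!: integral_nonneg_AE)
  finally have "AE x in M. (\<Sum>i. ennreal \<bar>f i x\<bar>) \<noteq> \<infinity>"
    by (intro nn_integral_PInf_AE) auto
  then show ?thesis
    by eventually_elim (auto intro: summable_suminf_not_top)
qed

context binary_tree
begin

text \<open>Convergence of a martingale bounded in L2, by a telescoping series: along levels
  \<open>r k\<close> with fast converging energies the increments are absolutely summable in L1, so
  that their sum defines the limit almost everywhere and the masses pass to it term by term.\<close>

lemma density_of_bounded_energy:
  assumes p: "additive p" and nn: "\<And>e. 0 \<le> p e" and C: "\<And>l. energy p l \<le> C"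
  obtains \<theta> where "integrable (leb_on \<X>) \<theta>" "\<And>x. 0 \<le> \<theta> x" "\<And>e. mass \<theta> e = p e"
    "(\<lambda>l. \<integral>x. \<bar>step_density p l x - \<theta> x\<bar> \<partial>leb_on \<X>) \<longlonglongrightarrow> 0"
proof -
  let ?d = "step_density p"
  have inc: "incseq (energy p)" using energy_mono[OF p] by (simp add: incseq_def)
  obtain s where s: "energy p \<longlonglongrightarrow> s" "\<And>l. energy p l \<le> s"
    using incseq_convergent[OF inc, of C] C by blast
  have "\<exists>N\<ge>k. s - energy p N \<le> (1 / 4) ^ k" for k
  proof -
    have "\<forall>\<^sub>F n in sequentially. energy p n > s - (1 / 4) ^ k"
      using s(1) by (rule order_tendstoD) simp
    then obtain N where "\<And>n. n \<ge> N \<Longrightarrow> energy p n > s - (1 / 4) ^ k"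
      by (auto simp: eventually_sequentially)
    then show ?thesis by (intro exI[of _ "max N k"]) (auto intro: less_imp_le simp: algebra_simps)
  qed
  \<comment> \<open>An energy gap of \<open>(1 / 4) ^ k\<close> makes the L1 norm of an increment at
    most \<open>(1 / 2) ^ k\<close>. The levels \<open>r k\<close> are not chosen increasing; the
    absolute value in \<open>step_density_L1\<close> takes care of that.\<close>
  then obtain r where r: "\<And>k. r k \<ge> k" "\<And>k. s - energy p (r k) \<le> (1 / 4) ^ k" by metis
  define D where "D k x = ?d (r (Suc k)) x - ?d (r k) x" for k x
  have D_int [simp]: "integrable (leb_on \<X>) (D k)" for k unfolding D_def by simp
  have D_L1: "(\<integral>x. \<bar>D k x\<bar> \<partial>leb_on \<X>) \<le> (1 / 2) ^ k" for k
  proof -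
    have "\<bar>energy p (r (Suc k)) - energy p (r k)\<bar> \<le> (1 / 4) ^ k"
      using r(2)[of k] r(2)[of "Suc k"] s(2)[of "r k"] s(2)[of "r (Suc k)"]
        power_decreasing[of k "Suc k" "1 / 4 :: real"] by auto
    then have "sqrt \<bar>energy p (r (Suc k)) - energy p (r k)\<bar> \<le> sqrt ((1 / 4) ^ k)" by simp
    also have "\<dots> = (1 / 2) ^ k" by (simp add: real_sqrt_power real_sqrt_divide)
    finally show ?thesis using step_density_L1[OF p, of "r (Suc k)" "r k"] by (simp add: D_def)
  qed
  have sum_L1: "summable (\<lambda>k. \<integral>x. \<bar>D k x\<bar> \<partial>leb_on \<X>)"
    by (rule summable_comparison_test'[of "\<lambda>k. (1 / 2) ^ k"]) (use D_L1 in \<open>auto simp: integral_nonneg_AE\<close>)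
  have AE_sum: "AE x in leb_on \<X>. summable (\<lambda>k. \<bar>D k x\<bar>)"
    by (rule AE_summable_of_summable_integral[OF D_int sum_L1])
  define \<theta>0 where "\<theta>0 x = ?d (r 0) x + (\<Sum>k. D k x)" for x
  have int_sum: "integrable (leb_on \<X>) (\<lambda>x. \<Sum>k. D k x)"
    by (rule integrable_suminf) (use AE_sum sum_L1 in auto)
  then have int0: "integrable (leb_on \<X>) \<theta>0" unfolding \<theta>0_def by simp
  have lim: "AE x in leb_on \<X>. (\<lambda>n. ?d (r n) x) \<longlonglongrightarrow> \<theta>0 x"
    using AE_sum
  proof eventually_elim
    case (elim x)
    have "(\<lambda>n. ?d (r 0) x + (\<Sum>k<n. D k x)) \<longlonglongrightarrow> \<theta>0 x"
      unfolding \<theta>0_def by (intro tendsto_add tendsto_const summable_LIMSEQ) (rule summable_rabs_cancel[OF elim])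
    moreover have "(\<Sum>k<n. D k x) = ?d (r n) x - ?d (r 0) x" for n
      unfolding D_def by (rule sum_lessThan_telescope)
    ultimately show ?case by simp
  qed
  have mass0: "mass \<theta>0 e = p e" for e
  proof -
    define f where "f k x = indicator (B e) x * D k x" for k x
    have f_int: "integrable (leb_on \<X>) (f k)" for k unfolding f_def by (rule mass_integrable) simp
    have f_sum: "summable (\<lambda>k. \<integral>x. \<bar>f k x\<bar> \<partial>leb_on \<X>)"
    proof (rule summable_comparison_test'[OF sum_L1])
      fix k show "norm (\<integral>x. \<bar>f k x\<bar> \<partial>leb_on \<X>) \<le> (\<integral>x. \<bar>D k x\<bar> \<partial>leb_on \<X>)"
        using f_int by (auto simp: f_def[abs_def] integral_nonneg_AE indicator_def intro!: integral_mono)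
    qed
    have "(\<lambda>k. \<integral>x. f k x \<partial>leb_on \<X>) sums (\<integral>x. (\<Sum>k. f k x) \<partial>leb_on \<X>)"
      by (rule sums_integral) (use f_int f_sum AE_summable_of_summable_integral[OF f_int f_sum] in auto)
    also have "(\<integral>x. (\<Sum>k. f k x) \<partial>leb_on \<X>) = (\<integral>x. indicator (B e) x * (\<Sum>k. D k x) \<partial>leb_on \<X>)"
    proof (rule integral_cong_AE)
      have [measurable]: "D k \<in> borel_measurable (leb_on \<X>)" for k using D_int by blast
      show "(\<lambda>x. \<Sum>k. f k x) \<in> borel_measurable (leb_on \<X>)" unfolding f_def by measurable
      show "(\<lambda>x. indicator (B e) x * (\<Sum>k. D k x)) \<in> borel_measurable (leb_on \<X>)" by measurable
      show "AE x in leb_on \<X>. (\<Sum>k. f k x) = indicator (B e) x * (\<Sum>k. D k x)"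
        using AE_sum by eventually_elim (auto simp: f_def intro!: suminf_mult summable_rabs_cancel)
    qed
    also have "\<dots> = mass \<theta>0 e - (\<integral>x. indicator (B e) x * ?d (r 0) x \<partial>leb_on \<X>)"
      unfolding mass_def \<theta>0_def distrib_left using mass_integrable[OF int_sum, of e] mass_integrable[OF step_density_integrable, of e p "r 0"]
      by simp
    finally have 1: "(\<lambda>k. \<integral>x. f k x \<partial>leb_on \<X>) sums (mass \<theta>0 e - (\<integral>x. indicator (B e) x * ?d (r 0) x \<partial>leb_on \<X>))" .
    define I where "I k = (\<integral>x. indicator (B e) x * ?d (r k) x \<partial>leb_on \<X>)" for k
    have fI: "(\<integral>x. f k x \<partial>leb_on \<X>) = I (Suc k) - I k" for k
      unfolding f_def D_def I_def right_diff_distrib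
      by (intro Bochner_Integration.integral_diff mass_integrable) simp_all
    have "I \<longlonglongrightarrow> p e"
    proof (rule tendsto_eventually)
      show "\<forall>\<^sub>F k in sequentially. I k = p e"
        using eventually_ge_at_top[of "length e"]
      proof eventually_elim
        case (elim k)
        with r(1)[of k] show ?case unfolding I_def by (intro integral_step_density_B p) auto
      qed
    qed
    then have "(\<lambda>k. I (Suc k) - I k) sums (p e - I 0)" by (rule telescope_sums)
    with 1 show ?thesis by (simp add: fI I_def sums_iff)
  qed
  \<comment> \<open>The limit is nonnegative only almost everywhere; the truncation makes it so at
    every point without changing the masses.\<close>
  define \<theta> where "\<theta> x = max 0 (\<theta>0 x)" for x
  have ae: "AE x in leb_on \<X>. \<theta>0 x = \<theta> x"
    using lim
  proof eventually_elim
    case (elim x)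
    have "0 \<le> \<theta>0 x" by (rule LIMSEQ_le_const[OF elim]) (auto simp: step_density_def nn)
    then show ?case by (simp add: \<theta>_def)
  qed
  have int: "integrable (leb_on \<X>) \<theta>" unfolding \<theta>_def using int0 by simp
  have "mass \<theta> e = mass \<theta>0 e" for e
    unfolding mass_def using borel_measurable_integrable[OF int] borel_measurable_integrable[OF int0] ae
    by (intro integral_cong_AE) (auto elim!: eventually_mono)
  moreover have "(\<lambda>l. \<integral>x. \<bar>?d l x - \<theta> x\<bar> \<partial>leb_on \<X>) \<longlonglongrightarrow> 0"
  proof (rule tendsto_sandwich[of "\<lambda>_. 0" _ _ "\<lambda>l. sqrt (s - energy p l)"])
    show "\<forall>\<^sub>F l in sequentially. (\<integral>x. \<bar>?d l x - \<theta> x\<bar> \<partial>leb_on \<X>) \<le> sqrt (s - energy p l)"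
    proof (rule eventuallyI)
      fix l
      have [measurable]: "\<theta> \<in> borel_measurable (leb_on \<X>)" using int by auto
      \<comment> \<open>Fatou's lemma along \<open>r n\<close> carries the L1 bound between two
        levels over to the limit, which gives convergence of the full sequence of levels.\<close>
      have "(\<integral>\<^sup>+x. ennreal \<bar>?d l x - \<theta> x\<bar> \<partial>leb_on \<X>) \<le> (\<integral>\<^sup>+x. liminf (\<lambda>n. ennreal \<bar>?d l x - ?d (r n) x\<bar>) \<partial>leb_on \<X>)"
      proof (rule nn_integral_mono_AE)
        show "AE x in leb_on \<X>. ennreal \<bar>?d l x - \<theta> x\<bar> \<le> liminf (\<lambda>n. ennreal \<bar>?d l x - ?d (r n) x\<bar>)"
          using lim ae
        proof eventually_elim
          case (elim x)
          then have "(\<lambda>n. ennreal \<bar>?d l x - ?d (r n) x\<bar>) \<longlonglongrightarrow> ennreal \<bar>?d l x - \<theta> x\<bar>"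
            by (intro tendsto_ennrealI tendsto_intros) simp
          from lim_imp_Liminf[OF trivial_limit_sequentially this] show ?case by simp
        qed
      qed
      also have "\<dots> \<le> liminf (\<lambda>n. \<integral>\<^sup>+x. ennreal \<bar>?d l x - ?d (r n) x\<bar> \<partial>leb_on \<X>)"
        by (rule nn_integral_liminf) measurable
      also have "\<dots> \<le> liminf (\<lambda>n. ennreal (sqrt (s - energy p l)))"
      proof (rule Liminf_mono, use eventually_ge_at_top[of l] in eventually_elim)
        case (elim n)
        then have "l \<le> r n" using r(1)[of n] by linarith
        have "(\<integral>\<^sup>+x. ennreal \<bar>?d l x - ?d (r n) x\<bar> \<partial>leb_on \<X>) = ennreal (\<integral>x. \<bar>?d l x - ?d (r n) x\<bar> \<partial>leb_on \<X>)"
          by (rule nn_integral_eq_integral) auto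
        also have "\<dots> \<le> ennreal (sqrt \<bar>energy p l - energy p (r n)\<bar>)"
          by (intro ennreal_leI step_density_L1 p)
        also have "\<dots> \<le> ennreal (sqrt (s - energy p l))"
          using energy_mono[OF p \<open>l \<le> r n\<close>] s(2)[of "r n"] by (intro ennreal_leI) simp
        finally show ?case .
      qed
      also have "\<dots> = ennreal (sqrt (s - energy p l))" by (simp add: Liminf_const)
      finally have "ennreal (\<integral>x. \<bar>?d l x - \<theta> x\<bar> \<partial>leb_on \<X>) \<le> ennreal (sqrt (s - energy p l))"
        using int by (subst (asm) nn_integral_eq_integral) auto
      then show "(\<integral>x. \<bar>?d l x - \<theta> x\<bar> \<partial>leb_on \<X>) \<le> sqrt (s - energy p l)"
        using s(2)[of l] by (subst (asm) ennreal_le_iff) auto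
    qed
    have "(\<lambda>l. sqrt (s - energy p l)) \<longlonglongrightarrow> sqrt (s - s)" by (intro tendsto_intros s)
    then show "(\<lambda>l. sqrt (s - energy p l)) \<longlonglongrightarrow> 0" by simp
  qed (auto simp: integral_nonneg_AE)
  ultimately show ?thesis using int mass0 by (intro that[of \<theta>]) (auto simp: \<theta>_def)
qed

section \<open>Convergence in L1 to a given density\<close>

lemma AE_eq_of_mass_eq:
  assumes f: "integrable (leb_on \<X>) f" "\<And>x. x \<in> \<X> \<Longrightarrow> 0 \<le> f x"
    and g: "integrable (leb_on \<X>) g" "\<And>x. x \<in> \<X> \<Longrightarrow> 0 \<le> g x"
    and eq: "\<And>e. mass f e = mass g e"
  shows "AE x in leb_on \<X>. f x = g x"
proof -
  let ?D = "\<lambda>f. density (leb_on \<X>) (\<lambda>x. ennreal (f x))"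
  have "?D f = ?D g"
  proof (rule measure_eq_on_tree)
    show "emeasure (?D f) \<X> \<noteq> \<infinity>"
      using emeasure_density_B[OF f, of "[]"] by (simp add: B_root)
  qed (simp_all add: sets_leb emeasure_density_B[OF f] emeasure_density_B[OF g] eq)
  then have "AE x in leb_on \<X>. ennreal (f x) = ennreal (g x)"
    using f g by (intro leb.density_unique) auto
  then show ?thesis
    using AE_space by eventually_elim (use f(2) g(2) in auto)
qed

text \<open>A density bounded by \<open>K\<close> has energies at most \<open>K\<^sup>2\<close>, so
  its step densities converge; the limit has the same masses and hence equals \<open>f\<close>
  almost everywhere.\<close>

lemma step_density_bounded_tendsto:
  assumes f: "integrable (leb_on \<X>) f" "\<And>x. x \<in> \<X> \<Longrightarrow> 0 \<le> f x" "\<And>x. x \<in> \<X> \<Longrightarrow> f x \<le> K"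
  shows "(\<lambda>l. \<integral>x. \<bar>step_density (mass f) l x - f x\<bar> \<partial>leb_on \<X>) \<longlonglongrightarrow> 0"
proof -
  have le: "mass f e \<le> K * (1 / 2) ^ length e" for e
  proof -
    have "mass f e \<le> (\<integral>x. indicator (B e) x * K \<partial>leb_on \<X>)"
      unfolding mass_def using f by (intro integral_mono mass_integrable) (auto simp: indicator_def)
    also have "\<dots> = K * (1 / 2) ^ length e" using measure_B[of e] by (simp add: Int_absorb2 B_sub)
    finally show ?thesis .
  qed
  have nn: "0 \<le> mass f e" for e by (rule mass_nonneg) (rule f)
  have en: "energy (mass f) l \<le> K\<^sup>2" for l
  proof -
    have "energy (mass f) l \<le> 2 ^ l * (\<Sum>e\<in>level l. (K * (1 / 2) ^ l)\<^sup>2)"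
      unfolding energy_def using le nn by (intro mult_left_mono sum_mono power_mono) auto
    also have "\<dots> = K\<^sup>2"
      by (simp add: card_level power_mult_distrib power_one_over power2_eq_square)
    finally show ?thesis .
  qed
  obtain \<theta> where \<theta>: "integrable (leb_on \<X>) \<theta>" "\<And>x. 0 \<le> \<theta> x" "\<And>e. mass \<theta> e = mass f e"
    "(\<lambda>l. \<integral>x. \<bar>step_density (mass f) l x - \<theta> x\<bar> \<partial>leb_on \<X>) \<longlonglongrightarrow> 0"
    by (rule density_of_bounded_energy[OF mass_additive[OF f(1)] nn en]) (rule that)
  have "AE x in leb_on \<X>. \<theta> x = f x"
    by (rule AE_eq_of_mass_eq) (use \<theta> f in auto)
  then have "(\<integral>x. \<bar>step_density (mass f) l x - \<theta> x\<bar> \<partial>leb_on \<X>) = (\<integral>x. \<bar>step_density (mass f) l x - f x\<bar> \<partial>leb_on \<X>)" for l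
    using borel_measurable_integrable[OF \<theta>(1)] borel_measurable_integrable[OF f(1)]
    by (intro integral_cong_AE) (auto elim!: eventually_mono)
  with \<theta>(4) show ?thesis by simp
qed

text \<open>Truncation at height \<open>K\<close>: passing to step densities does not increase the
  L1 norm, so the part cut off contributes at most twice its integral, at every level.\<close>

lemma step_density_tendsto:
  assumes f: "integrable (leb_on \<X>) f" "\<And>x. x \<in> \<X> \<Longrightarrow> 0 \<le> f x"
  shows "(\<lambda>l. \<integral>x. \<bar>step_density (mass f) l x - f x\<bar> \<partial>leb_on \<X>) \<longlonglongrightarrow> 0"
proof -
  define g where "g K x = min (f x) (real K)" for K :: nat and x
  define h where "h K x = f x - g K x" for K :: nat and x
  have [measurable]: "f \<in> borel_measurable (leb_on \<X>)" using f by auto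
  have g_int: "integrable (leb_on \<X>) (g K)" for K
    by (rule Bochner_Integration.integrable_bound[OF f(1)]) (auto simp: g_def[abs_def] f(2))
  have h_int: "integrable (leb_on \<X>) (h K)" for K unfolding h_def using f g_int by simp
  have "(\<lambda>K. \<integral>x. h K x \<partial>leb_on \<X>) \<longlonglongrightarrow> (\<integral>x. 0 \<partial>leb_on \<X>)"
  proof (rule integral_dominated_convergence[where w=f])
    show "AE x in leb_on \<X>. (\<lambda>K. h K x) \<longlonglongrightarrow> 0"
    proof (intro AE_I2 tendsto_eventually)
      fix x
      obtain N where "f x \<le> real N" using real_arch_simple by blast
      then have "h K x = 0" if "N \<le> K" for K
        using that by (simp add: h_def g_def)
      then show "\<forall>\<^sub>F K in sequentially. h K x = 0"
        by (auto simp: eventually_sequentially)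
    qed
  qed (auto simp: h_def[abs_def] g_def[abs_def] f)
  then have hlim: "(\<lambda>K. \<integral>x. h K x \<partial>leb_on \<X>) \<longlonglongrightarrow> 0" by simp
  have bound: "(\<integral>x. \<bar>step_density (mass f) l x - f x\<bar> \<partial>leb_on \<X>) \<le>
      (\<integral>x. \<bar>step_density (mass (g K)) l x - g K x\<bar> \<partial>leb_on \<X>) + 2 * (\<integral>x. h K x \<partial>leb_on \<X>)" for l K
  proof -
    have hn: "0 \<le> h K x" for x by (simp add: h_def g_def)
    have m: "mass (h K) e = mass f e - mass (g K) e" for e
      unfolding mass_def h_def right_diff_distrib
      by (intro Bochner_Integration.integral_diff mass_integrable f g_int)
    have d: "step_density (mass f) l x = step_density (mass (g K)) l x + step_density (mass (h K)) l x" for x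
      by (simp add: step_density_def m right_diff_distrib)
    have dn: "0 \<le> step_density (mass (h K)) l x" for x
      using mass_nonneg[of "h K"] hn by (simp add: step_density_def)
    have "(\<integral>x. \<bar>step_density (mass f) l x - f x\<bar> \<partial>leb_on \<X>) \<le>
      (\<integral>x. \<bar>step_density (mass (g K)) l x - g K x\<bar> + (step_density (mass (h K)) l x + h K x) \<partial>leb_on \<X>)"
    proof (intro integral_mono)
      show "\<bar>step_density (mass f) l x - f x\<bar> \<le> \<bar>step_density (mass (g K)) l x - g K x\<bar> + (step_density (mass (h K)) l x + h K x)" for x
        using hn[of x] dn[of x] by (simp add: d h_def)
    qed (use f g_int h_int in auto)
    also have "\<dots> = (\<integral>x. \<bar>step_density (mass (g K)) l x - g K x\<bar> \<partial>leb_on \<X>) +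
        ((\<integral>x. step_density (mass (h K)) l x \<partial>leb_on \<X>) + (\<integral>x. h K x \<partial>leb_on \<X>))"
      using g_int h_int by simp
    also have "(\<integral>x. step_density (mass (h K)) l x \<partial>leb_on \<X>) = mass (step_density (mass (h K)) l) []"
      by (rule mass_root[symmetric])
    also have "\<dots> = mass (h K) []"
      unfolding mass_def[of "step_density (mass (h K)) l"]
      by (rule integral_step_density_B[OF mass_additive[OF h_int]]) simp
    also have "mass (h K) [] = (\<integral>x. h K x \<partial>leb_on \<X>)" by (rule mass_root)
    finally show ?thesis by simp
  qed
  show ?thesis
  proof (rule LIMSEQ_I)
    fix \<epsilon> :: real assume "0 < \<epsilon>"
    then have "\<forall>\<^sub>F K in sequentially. (\<integral>x. h K x \<partial>leb_on \<X>) < \<epsilon> / 4"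
      by (intro order_tendstoD[OF hlim]) simp
    then obtain K where K: "(\<integral>x. h K x \<partial>leb_on \<X>) < \<epsilon> / 4" by (auto simp: eventually_sequentially)
    have "(\<lambda>l. \<integral>x. \<bar>step_density (mass (g K)) l x - g K x\<bar> \<partial>leb_on \<X>) \<longlonglongrightarrow> 0"
      by (rule step_density_bounded_tendsto[where K=K]) (use g_int f in \<open>auto simp: g_def\<close>)
    then have "\<forall>\<^sub>F l in sequentially. (\<integral>x. \<bar>step_density (mass (g K)) l x - g K x\<bar> \<partial>leb_on \<X>) < \<epsilon> / 2"
      using \<open>0 < \<epsilon>\<close> by (intro order_tendstoD) auto
    then obtain N where N: "\<And>l. l \<ge> N \<Longrightarrow> (\<integral>x. \<bar>step_density (mass (g K)) l x - g K x\<bar> \<partial>leb_on \<X>) < \<epsilon> / 2"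
      by (auto simp: eventually_sequentially)
    show "\<exists>no. \<forall>l\<ge>no. norm ((\<integral>x. \<bar>step_density (mass f) l x - f x\<bar> \<partial>leb_on \<X>) - 0) < \<epsilon>"
    proof (intro exI allI impI)
      fix l assume "l \<ge> N"
      have "0 \<le> (\<integral>x. \<bar>step_density (mass f) l x - f x\<bar> \<partial>leb_on \<X>)" by (simp add: integral_nonneg_AE)
      then show "norm ((\<integral>x. \<bar>step_density (mass f) l x - f x\<bar> \<partial>leb_on \<X>) - 0) < \<epsilon>"
        using bound[of l K] N[OF \<open>l \<ge> N\<close>] K by simp
    qed
  qed
qed

end

section \<open>Relative entropy along the tree\<close>

text \<open>
  The integrand of the divergence, made nonnegative by adding \<open>b - a\<close>, which has integral zero
  for probability densities.
\<close>

definition kl_kernel :: "real \<Rightarrow> real \<Rightarrow> ennreal" where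
  "kl_kernel a b = (if b = 0 then (if a = 0 then 0 else \<top>) else ennreal (a * ln (a / b) - a + b))"

lemma kl_kernel_measurable [measurable]:
  assumes [measurable]: "f \<in> borel_measurable M" "g \<in> borel_measurable M"
  shows "(\<lambda>x. kl_kernel (f x) (g x)) \<in> borel_measurable M"
  unfolding kl_kernel_def by measurable

text \<open>Young's inequality for the conjugate pair behind relative entropy; for fixed
  \<open>t\<close> the expression under \<open>ennreal\<close> is linear in
  \<open>(a, b)\<close>.\<close>

lemma kl_kernel_ge_affine:
  assumes "0 \<le> a" "0 \<le> b"
  shows "ennreal (a * t + b * (1 - exp t)) \<le> kl_kernel a b"
proof (cases "b = 0")
  case False
  then have b: "b > 0" using assms by simp
  have "a * t + b * (1 - exp t) \<le> a * ln (a / b) - a + b"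
  proof (cases "a = 0")
    case False
    with assms have a: "a > 0" by simp
    have "a * ln (a / (b * exp t)) \<ge> a - b * exp t" using a b by (intro ln_ratio_le_diff) auto
    moreover have "ln (a / (b * exp t)) = ln (a / b) - t"
      using a b by (simp add: ln_div ln_mult)
    ultimately have "a - b * exp t \<le> a * (ln (a / b) - t)" by simp
    then show ?thesis by (simp add: algebra_simps)
  qed (use b in simp)
  then show ?thesis using b by (simp add: kl_kernel_def ennreal_leI)
qed (use assms in \<open>auto simp: kl_kernel_def\<close>)

text \<open>The dual form of the kernel, with maximiser \<open>t = ln (a / b)\<close> in the
  interior. Jensen's inequality and lower semicontinuity both follow from it, with the degenerate
  cases \<open>a = 0\<close> and \<open>b = 0\<close> settled here once.\<close>

lemma kl_kernel_eq_SUP: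
  assumes "0 \<le> a" "0 \<le> b"
  shows "kl_kernel a b = (SUP t. ennreal (a * t + b * (1 - exp t)))"
proof (rule antisym)
  show "(SUP t. ennreal (a * t + b * (1 - exp t))) \<le> kl_kernel a b"
    by (intro SUP_least kl_kernel_ge_affine assms)
  let ?S = "SUP t. ennreal (a * t + b * (1 - exp t))"
  have upper: "ennreal (a * t + b * (1 - exp t)) \<le> ?S" for t by (rule SUP_upper) simp
  consider "a = 0" "b = 0" | "a > 0" "b = 0" | "a = 0" "b > 0" | "a > 0" "b > 0"
    using assms by fastforce
  then show "kl_kernel a b \<le> ?S"
  proof cases
    case 2
    have "?S = \<top>"
    proof (rule ennreal_SUP_eq_top)
      fix n :: nat
      show "\<exists>t\<in>UNIV. of_nat n \<le> ennreal (a * t + b * (1 - exp t))"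
        using 2 by (intro bexI[of _ "real n / a"]) (auto simp: ennreal_of_nat_eq_real_of_nat)
    qed
    then show ?thesis by (simp only: top_greatest)
  next
    case 3
    \<comment> \<open>Here the supremum is not attained but approached as \<open>t\<close> tends to
      minus infinity.\<close>
    have "(\<lambda>n. ennreal (b * (1 - exp (- real n)))) \<longlonglongrightarrow> ennreal (b * (1 - 0))"
      by (intro tendsto_ennrealI tendsto_mult tendsto_diff tendsto_const)
        (auto intro!: filterlim_compose[OF exp_at_bot] filterlim_uminus_at_bot_at_top[THEN filterlim_compose] filterlim_real_sequentially)
    moreover have "ennreal (b * (1 - exp (- real n))) \<le> ?S" for n
      using upper[of "- real n"] 3 by simp
    ultimately have "ennreal b \<le> ?S" by (intro LIMSEQ_le_const2) auto
    then show ?thesis using 3 by (simp add: kl_kernel_def)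
  next
    case 4
    then show ?thesis using upper[of "ln (a / b)"]
      by (simp add: kl_kernel_def algebra_simps)
  qed (simp add: kl_kernel_def)
qed

lemma kl_kernel_scale:
  assumes "0 < c"
  shows "kl_kernel (c * a) (c * b) = ennreal c * kl_kernel a b"
proof (cases "b = 0")
  case False
  have "c * a * ln (c * a / (c * b)) - c * a + c * b = c * (a * ln (a / b) - a + b)"
    using assms by (simp add: algebra_simps)
  then show ?thesis using False assms by (simp add: kl_kernel_def ennreal_mult')
qed (use assms in \<open>auto simp: kl_kernel_def ennreal_mult_top\<close>)

lemma kl_kernel_lsc:
  assumes lim: "a \<longlonglongrightarrow> a'" "b \<longlonglongrightarrow> b'" and nn: "\<And>k. 0 \<le> a k" "\<And>k. 0 \<le> b k"
  shows "kl_kernel a' b' \<le> liminf (\<lambda>k. kl_kernel (a k) (b k))"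
proof -
  have "0 \<le> a'" "0 \<le> b'" using LIMSEQ_le_const[OF lim(1)] LIMSEQ_le_const[OF lim(2)] nn by blast+
  then show ?thesis
    unfolding kl_kernel_eq_SUP[OF \<open>0 \<le> a'\<close> \<open>0 \<le> b'\<close>]
  proof (intro SUP_least)
    fix t
    have "(\<lambda>k. ennreal (a k * t + b k * (1 - exp t))) \<longlonglongrightarrow> ennreal (a' * t + b' * (1 - exp t))"
      by (intro tendsto_ennrealI tendsto_add tendsto_mult lim tendsto_const)
    then have "ennreal (a' * t + b' * (1 - exp t)) = liminf (\<lambda>k. ennreal (a k * t + b k * (1 - exp t)))"
      by (rule lim_imp_Liminf[OF trivial_limit_sequentially, symmetric])
    also have "\<dots> \<le> liminf (\<lambda>k. kl_kernel (a k) (b k))"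
      by (intro Liminf_mono always_eventually allI kl_kernel_ge_affine nn)
    finally show "ennreal (a' * t + b' * (1 - exp t)) \<le> liminf (\<lambda>k. kl_kernel (a k) (b k))" .
  qed
qed

lemma kl_kernel_nonneg_arg:
  fixes a b :: real
  assumes "0 \<le> a" "0 < b"
  shows "0 \<le> a * ln (a / b) - a + b"
  using ln_ratio_le_diff[OF assms] by simp

text \<open>The chain rule of relative entropy for one split, in which \<open>P\<close> is divided
  in the ratio \<open>v\<close> to \<open>1 - v\<close>. The extra terms \<open>b - a\<close> of the
  kernel add up because both pairs of masses do.\<close>

lemma kl_kernel_chain:
  assumes F: "0 \<le> F0" "0 \<le> F1" and P: "0 < P" and v: "0 < v" "v < 1"
  shows "kl_kernel F0 (P * v) + kl_kernel F1 (P * (1 - v)) =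
    kl_kernel (F0 + F1) P + ennreal ((F0 + F1) * bernoulli_kl (F0 / (F0 + F1)) v)"
\<comment> \<open>If the sum vanishes, the ratio \<open>F0 / (F0 + F1)\<close> is a convention, but
  it is multiplied by 0, and both sides equal \<open>P\<close>.\<close>
proof (cases "F0 + F1 = 0")
  case True
  then have "F0 = 0" "F1 = 0" using F by auto
  then show ?thesis
    using P v by (simp add: kl_kernel_def ennreal_plus[symmetric] algebra_simps del: ennreal_plus)
next
  case False
  then have S: "F0 + F1 > 0" using F by simp
  define q where "q = F0 / (F0 + F1)"
  have q: "0 \<le> q" "q \<le> 1" "F0 = (F0 + F1) * q" "F1 = (F0 + F1) * (1 - q)"
    using F S by (auto simp: q_def field_simps)
  have ratio: "r * ln (S * r / (P * w)) = r * ln (S / P) + r * ln (r / w)"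
    if "0 \<le> r" "0 < w" "S > 0" for r w S :: real
    using that P by (cases "r = 0") (auto simp: ln_div ln_mult algebra_simps)
  have "F0 * ln (F0 / (P * v)) + F1 * ln (F1 / (P * (1 - v))) =
      (F0 + F1) * (q * ln ((F0 + F1) * q / (P * v)) + (1 - q) * ln ((F0 + F1) * (1 - q) / (P * (1 - v))))"
    using q(3,4) by (metis (no_types, lifting) distrib_left mult.assoc)
  also have "\<dots> = (F0 + F1) * (q * ln ((F0 + F1) / P) + q * ln (q / v) + ((1 - q) * ln ((F0 + F1) / P) + (1 - q) * ln ((1 - q) / (1 - v))))"
    using ratio[of q v "F0 + F1"] ratio[of "1 - q" "1 - v" "F0 + F1"] q v S by simp
  also have "\<dots> = (F0 + F1) * ln ((F0 + F1) / P) + (F0 + F1) * bernoulli_kl q v"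
    by (simp add: bernoulli_kl_def algebra_simps)
  finally have eq: "F0 * ln (F0 / (P * v)) + F1 * ln (F1 / (P * (1 - v))) =
    (F0 + F1) * ln ((F0 + F1) / P) + (F0 + F1) * bernoulli_kl q v" .
  have "0 \<le> bernoulli_kl q v" using q v by (intro bernoulli_kl_nonneg) auto
  then have nn: "0 \<le> (F0 + F1) * bernoulli_kl q v" using S by simp
  have "kl_kernel F0 (P * v) + kl_kernel F1 (P * (1 - v)) =
     ennreal ((F0 * ln (F0 / (P * v)) - F0 + P * v) + (F1 * ln (F1 / (P * (1 - v))) - F1 + P * (1 - v)))"
    using F P v kl_kernel_nonneg_arg[of F0 "P * v"] kl_kernel_nonneg_arg[of F1 "P * (1 - v)"]
    by (subst ennreal_plus) (auto simp: kl_kernel_def)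
  also have "(F0 * ln (F0 / (P * v)) - F0 + P * v) + (F1 * ln (F1 / (P * (1 - v))) - F1 + P * (1 - v)) =
     ((F0 + F1) * ln ((F0 + F1) / P) - (F0 + F1) + P) + (F0 + F1) * bernoulli_kl q v"
    using eq by (simp add: right_diff_distrib)
  also have "ennreal \<dots> = kl_kernel (F0 + F1) P + ennreal ((F0 + F1) * bernoulli_kl q v)"
    using P S nn kl_kernel_nonneg_arg[of "F0 + F1" P] by (subst ennreal_plus) (auto simp: kl_kernel_def)
  finally show ?thesis by (simp add: q_def)
qed

context binary_tree
begin

text \<open>For each \<open>t\<close> the dual expression is linear and commutes with the integral
  over \<open>B e\<close>. Its positive part is dominated by the kernel, and the supremum over
  \<open>t\<close> is taken only at the end.\<close>

lemma kl_kernel_Jensen: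
  assumes f: "integrable (leb_on \<X>) f" "\<And>x. x \<in> \<X> \<Longrightarrow> 0 \<le> f x"
    and g: "integrable (leb_on \<X>) g" "\<And>x. x \<in> \<X> \<Longrightarrow> 0 \<le> g x"
  shows "kl_kernel (mass f e) (mass g e) \<le> (\<integral>\<^sup>+x. kl_kernel (f x) (g x) * indicator (B e) x \<partial>leb_on \<X>)"
proof -
  have "ennreal (mass f e * t + mass g e * (1 - exp t)) \<le> (\<integral>\<^sup>+x. kl_kernel (f x) (g x) * indicator (B e) x \<partial>leb_on \<X>)" for t
  proof -
  let ?k = "\<lambda>x. f x * t + g x * (1 - exp t)"
  have int: "integrable (leb_on \<X>) (\<lambda>x. indicator (B e) x * ?k x)"
    using f g by (intro mass_integrable) auto
  have "mass f e * t + mass g e * (1 - exp t) = (\<integral>x. indicator (B e) x * f x * t + indicator (B e) x * g x * (1 - exp t) \<partial>leb_on \<X>)"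
    using mass_integrable[OF f(1), of e] mass_integrable[OF g(1), of e]
    by (subst Bochner_Integration.integral_add) (auto simp: mass_def)
  also have "\<dots> = (\<integral>x. indicator (B e) x * ?k x \<partial>leb_on \<X>)"
    by (simp add: algebra_simps)
  also have "\<dots> \<le> (\<integral>x. max 0 (indicator (B e) x * ?k x) \<partial>leb_on \<X>)"
    using int by (intro integral_mono) auto
  finally have "ennreal (mass f e * t + mass g e * (1 - exp t)) \<le> ennreal (\<integral>x. max 0 (indicator (B e) x * ?k x) \<partial>leb_on \<X>)"
    by (rule ennreal_leI)
  also have "\<dots> = (\<integral>\<^sup>+x. ennreal (max 0 (indicator (B e) x * ?k x)) \<partial>leb_on \<X>)"
    using int by (intro nn_integral_eq_integral[symmetric]) auto
  also have "\<dots> \<le> (\<integral>\<^sup>+x. kl_kernel (f x) (g x) * indicator (B e) x \<partial>leb_on \<X>)"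
  proof (rule nn_integral_mono)
    fix x assume "x \<in> space (leb_on \<X>)"
    then show "ennreal (max 0 (indicator (B e) x * ?k x)) \<le> kl_kernel (f x) (g x) * indicator (B e) x"
      using kl_kernel_ge_affine[of "f x" "g x" t] f(2) g(2) by (auto simp: indicator_def max_def)
  qed
  finally show ?thesis .
  qed
  then show ?thesis
    by (subst kl_kernel_eq_SUP) (auto intro!: mass_nonneg SUP_least f g)
qed

text \<open>The level sums lie below the integral by Jensen's inequality. Conversely, the step
  densities converge almost everywhere along a subsequence, and lower semicontinuity with Fatou's
  lemma bounds the integral by the level sums.\<close>

lemma kl_kernel_integral_eq_SUP:
  assumes f: "integrable (leb_on \<X>) f" "\<And>x. x \<in> \<X> \<Longrightarrow> 0 \<le> f x"
    and g: "integrable (leb_on \<X>) g" "\<And>x. x \<in> \<X> \<Longrightarrow> 0 \<le> g x"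
  shows "(\<integral>\<^sup>+x. kl_kernel (f x) (g x) \<partial>leb_on \<X>) = (SUP l. \<Sum>e\<in>level l. kl_kernel (mass f e) (mass g e))"
    (is "?I = (SUP l. ?S l)")
proof (rule antisym)
  have [measurable]: "f \<in> borel_measurable (leb_on \<X>)" "g \<in> borel_measurable (leb_on \<X>)" using f g by auto
  show "(SUP l. ?S l) \<le> ?I"
  proof (rule SUP_least)
    fix l
    have "?S l \<le> (\<Sum>e\<in>level l. \<integral>\<^sup>+x. kl_kernel (f x) (g x) * indicator (B e) x \<partial>leb_on \<X>)"
      by (intro sum_mono kl_kernel_Jensen f g)
    also have "\<dots> = (\<integral>\<^sup>+x. (\<Sum>e\<in>level l. kl_kernel (f x) (g x) * indicator (B e) x) \<partial>leb_on \<X>)"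
      by (rule nn_integral_sum[symmetric]) measurable
    also have "\<dots> = ?I"
    proof (rule nn_integral_cong)
      fix x assume "x \<in> space (leb_on \<X>)"
      then have "x \<in> \<X>" by simp
      from node_expand[OF this, of "\<lambda>_. kl_kernel (f x) (g x)" l]
      show "(\<Sum>e\<in>level l. kl_kernel (f x) (g x) * indicator (B e) x) = kl_kernel (f x) (g x)" by simp
    qed
    finally show "?S l \<le> ?I" .
  qed
  let ?a = "step_density (mass f)" and ?b = "step_density (mass g)"
  have "(\<lambda>l. (\<integral>x. \<bar>?a l x - f x\<bar> \<partial>leb_on \<X>) + (\<integral>x. \<bar>?b l x - g x\<bar> \<partial>leb_on \<X>)) \<longlonglongrightarrow> 0 + 0"
    by (intro tendsto_add step_density_tendsto f g)
  also have "(\<lambda>l. (\<integral>x. \<bar>?a l x - f x\<bar> \<partial>leb_on \<X>) + (\<integral>x. \<bar>?b l x - g x\<bar> \<partial>leb_on \<X>)) =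
    (\<lambda>l. \<integral>x. norm ((\<bar>?a l x - f x\<bar> + \<bar>?b l x - g x\<bar>)) \<partial>leb_on \<X>)"
    using f g by (intro ext) simp
  finally have L1: "(\<lambda>l. \<integral>x. norm (\<bar>?a l x - f x\<bar> + \<bar>?b l x - g x\<bar>) \<partial>leb_on \<X>) \<longlonglongrightarrow> 0" by simp
  obtain r where r: "strict_mono r" "AE x in leb_on \<X>. (\<lambda>n. \<bar>?a (r n) x - f x\<bar> + \<bar>?b (r n) x - g x\<bar>) \<longlonglongrightarrow> 0"
    using tendsto_L1_AE_subseq[where u="\<lambda>l x. \<bar>?a l x - f x\<bar> + \<bar>?b l x - g x\<bar>", OF _ L1] f g by auto
  have "?I \<le> (\<integral>\<^sup>+x. liminf (\<lambda>n. kl_kernel (?a (r n) x) (?b (r n) x)) \<partial>leb_on \<X>)"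
  proof (rule nn_integral_mono_AE, use r(2) AE_space in eventually_elim)
    case (elim x)
    have "(\<lambda>n. ?a (r n) x - f x) \<longlonglongrightarrow> 0" "(\<lambda>n. ?b (r n) x - g x) \<longlonglongrightarrow> 0"
      by (rule tendsto_rabs_zero_cancel, rule tendsto_sandwich[OF _ _ tendsto_const elim(1)]; auto)+
    then have "(\<lambda>n. ?a (r n) x) \<longlonglongrightarrow> f x" "(\<lambda>n. ?b (r n) x) \<longlonglongrightarrow> g x"
      by (simp_all add: LIM_zero_iff)
    then show ?case
      by (rule kl_kernel_lsc) (auto simp: step_density_def intro!: mult_nonneg_nonneg mass_nonneg f g)
  qed
  also have "\<dots> \<le> liminf (\<lambda>n. \<integral>\<^sup>+x. kl_kernel (?a (r n) x) (?b (r n) x) \<partial>leb_on \<X>)"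
    by (rule nn_integral_liminf) measurable
  also have "(\<lambda>n. \<integral>\<^sup>+x. kl_kernel (?a (r n) x) (?b (r n) x) \<partial>leb_on \<X>) = (\<lambda>n. ?S (r n))"
  proof
    fix n
    have "(\<integral>\<^sup>+x. kl_kernel (?a (r n) x) (?b (r n) x) \<partial>leb_on \<X>) =
      (\<Sum>e\<in>level (r n). kl_kernel (2 ^ r n * mass f e) (2 ^ r n * mass g e) * ennreal ((1 / 2) ^ r n))"
      unfolding step_density_def by (rule nn_integral_node[of "\<lambda>e. kl_kernel (2 ^ r n * mass f e) (2 ^ r n * mass g e)"])
    also have "\<dots> = ?S (r n)"
    proof (rule sum.cong)
      fix e
      \<comment> \<open>By homogeneity of the kernel the factor \<open>2 ^ r n\<close> cancels
        against the Lebesgue mass of the node.\<close>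
      have "kl_kernel (2 ^ r n * mass f e) (2 ^ r n * mass g e) * ennreal ((1 / 2) ^ r n) =
        (ennreal ((1 / 2) ^ r n) * ennreal (2 ^ r n)) * kl_kernel (mass f e) (mass g e)"
        by (subst kl_kernel_scale) (auto simp: mult_ac)
      also have "ennreal ((1 / 2) ^ r n) * ennreal (2 ^ r n) = 1"
        by (simp add: ennreal_mult[symmetric] power_mult_distrib[symmetric])
      finally show "kl_kernel (2 ^ r n * mass f e) (2 ^ r n * mass g e) * ennreal ((1 / 2) ^ r n) = kl_kernel (mass f e) (mass g e)"
        by simp
    qed simp
    finally show "(\<integral>\<^sup>+x. kl_kernel (?a (r n) x) (?b (r n) x) \<partial>leb_on \<X>) = ?S (r n)" .
  qed
  also have "liminf (\<lambda>n. ?S (r n)) \<le> (SUP l. ?S l)"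
  proof -
    have "liminf (\<lambda>n. ?S (r n)) \<le> liminf (\<lambda>n. (SUP l. ?S l))"
      by (intro Liminf_mono always_eventually allI SUP_upper) simp
    then show ?thesis by (simp add: Liminf_const)
  qed
  finally show "?I \<le> (SUP l. ?S l)" .
qed

text \<open>Pointwise, positive part plus \<open>g\<close> equals kernel plus \<open>f\<close> plus
  negative part, all terms being nonnegative. Both densities have integral 1 and cancel; the
  negative part is at most \<open>g\<close>, hence of finite integral, so that the truncated
  subtraction is exact.\<close>

lemma KL_eq_kl_kernel:
  assumes f: "integrable (leb_on \<X>) f" "\<And>x. x \<in> \<X> \<Longrightarrow> 0 \<le> f x" "(\<integral>x. f x \<partial>leb_on \<X>) = 1"
    and g: "integrable (leb_on \<X>) g" "\<And>x. x \<in> \<X> \<Longrightarrow> 0 \<le> g x" "(\<integral>x. g x \<partial>leb_on \<X>) = 1"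
  shows "KL \<X> f g = (\<integral>\<^sup>+x. kl_kernel (f x) (g x) \<partial>leb_on \<X>)"
proof -
  have [measurable]: "f \<in> borel_measurable (leb_on \<X>)" "g \<in> borel_measurable (leb_on \<X>)" using f g by auto
  let ?p = "\<lambda>x. e2ennreal (KL_integrand (f x) (g x))"
  let ?n = "\<lambda>x. e2ennreal (- KL_integrand (f x) (g x))"
  have [measurable]: "?p \<in> borel_measurable (leb_on \<X>)" "?n \<in> borel_measurable (leb_on \<X>)"
    unfolding KL_integrand_def by measurable
  have f1: "(\<integral>\<^sup>+x. ennreal (f x) \<partial>leb_on \<X>) = 1"
    using f by (subst nn_integral_eq_integral) auto
  have g1: "(\<integral>\<^sup>+x. ennreal (g x) \<partial>leb_on \<X>) = 1"
    using g by (subst nn_integral_eq_integral) auto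
  have pw: "?n x \<le> ennreal (g x)" "?p x + ennreal (g x) = kl_kernel (f x) (g x) + ennreal (f x) + ?n x" if "x \<in> \<X>" for x
  proof -
    have fg: "0 \<le> f x" "0 \<le> g x" using that f(2) g(2) by auto
    have *: "?n x \<le> ennreal (g x) \<and> ?p x + ennreal (g x) = kl_kernel (f x) (g x) + ennreal (f x) + ?n x"
    proof -
      consider "f x = 0" "g x = 0" | "f x = 0" "g x > 0" | "f x > 0" "g x = 0" | "f x > 0" "g x > 0"
        using fg by fastforce
      then show ?thesis
      proof cases
        case 4
        define u where "u = f x * ln (f x / g x)"
        have u: "u \<ge> f x - g x" unfolding u_def using 4 by (intro ln_ratio_le_diff) auto
        have k: "kl_kernel (f x) (g x) = ennreal (u - f x + g x)" "KL_integrand (f x) (g x) = ereal u"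
          using 4 by (auto simp: kl_kernel_def KL_integrand_def u_def)
        show ?thesis
        proof (cases "0 \<le> u")
          case True
          then have "?n x = 0" "?p x = ennreal u" by (auto simp: k e2ennreal_neg zero_ereal_def[symmetric] e2ennreal_ereal ennreal_neg)
          then show ?thesis using True u fg by (simp add: k ennreal_plus[symmetric] del: ennreal_plus)
        next
          case False
          then have "?n x = ennreal (- u)" "?p x = 0" by (auto simp: k e2ennreal_neg zero_ereal_def[symmetric] e2ennreal_ereal ennreal_neg)
          then show ?thesis using False u fg 4 by (auto simp: k ennreal_plus[symmetric] simp del: ennreal_plus intro!: ennreal_leI)
        qed
      qed (auto simp: KL_integrand_def kl_kernel_def e2ennreal_neg)
    qed
    then show "?n x \<le> ennreal (g x)" "?p x + ennreal (g x) = kl_kernel (f x) (g x) + ennreal (f x) + ?n x" by auto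
  qed
  have "(\<integral>\<^sup>+x. ?n x \<partial>leb_on \<X>) \<le> (\<integral>\<^sup>+x. ennreal (g x) \<partial>leb_on \<X>)"
    by (rule nn_integral_mono) (use pw in auto)
  then have fin: "(\<integral>\<^sup>+x. ?n x \<partial>leb_on \<X>) \<noteq> \<top>" using g1 by (auto simp: top_unique)
  have "(\<integral>\<^sup>+x. ?p x \<partial>leb_on \<X>) + 1 = (\<integral>\<^sup>+x. ?p x + ennreal (g x) \<partial>leb_on \<X>)"
    by (subst nn_integral_add) (auto simp: g1)
  also have "\<dots> = (\<integral>\<^sup>+x. kl_kernel (f x) (g x) + ennreal (f x) + ?n x \<partial>leb_on \<X>)"
    by (rule nn_integral_cong) (use pw in auto)
  also have "\<dots> = (\<integral>\<^sup>+x. kl_kernel (f x) (g x) \<partial>leb_on \<X>) + 1 + (\<integral>\<^sup>+x. ?n x \<partial>leb_on \<X>)"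
    by (simp add: nn_integral_add f1)
  finally have "(\<integral>\<^sup>+x. ?p x \<partial>leb_on \<X>) + 1 = ((\<integral>\<^sup>+x. kl_kernel (f x) (g x) \<partial>leb_on \<X>) + (\<integral>\<^sup>+x. ?n x \<partial>leb_on \<X>)) + 1"
    by (simp add: ac_simps)
  then have "(\<integral>\<^sup>+x. ?p x \<partial>leb_on \<X>) = (\<integral>\<^sup>+x. kl_kernel (f x) (g x) \<partial>leb_on \<X>) + (\<integral>\<^sup>+x. ?n x \<partial>leb_on \<X>)"
    by (metis ennreal_add_diff_cancel_right ennreal_one_neq_top)
  then show ?thesis unfolding KL_def using fin by (simp add: ennreal_add_diff_cancel_right)
qed

end

section \<open>Existence and uniqueness of Polya trees\<close>

definition split_mass :: "(bool list \<Rightarrow> real) \<Rightarrow> bool list \<Rightarrow> real" where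
  "split_mass v e = (\<Prod>i<length e. if e ! i then 1 - v (take i e) else v (take i e))"

lemma split_mass_Nil [simp]: "split_mass v [] = 1"
  by (simp add: split_mass_def)

lemma split_mass_snoc: "split_mass v (e @ [b]) = split_mass v e * (if b then 1 - v e else v e)"
proof -
  have "(\<Prod>i<length e. if (e @ [b]) ! i then 1 - v (take i (e @ [b])) else v (take i (e @ [b]))) = split_mass v e"
    unfolding split_mass_def by (intro prod.cong) (auto simp: nth_append)
  then show ?thesis
    by (simp only: split_mass_def[of v "e @ [b]"] length_append_singleton prod.lessThan_Suc nth_append_length) simp
qed

lemma split_mass_additive: "additive (split_mass v)"
  by (simp add: additive_def split_mass_snoc algebra_simps)

lemma split_mass_pos: "(\<And>e. 0 < v e \<and> v e < 1) \<Longrightarrow> 0 < split_mass v e"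
  by (induction e rule: rev_induct) (auto simp: split_mass_snoc)

lemma split_mass_measurable [measurable]:
  assumes [measurable]: "\<And>e. (\<lambda>\<omega>. V \<omega> e) \<in> borel_measurable M"
  shows "(\<lambda>\<omega>. split_mass (V \<omega>) e) \<in> borel_measurable M"
proof -
  have "(\<lambda>\<omega>. if e ! i then 1 - V \<omega> (take i e) else V \<omega> (take i e)) \<in> borel_measurable M" for i
    by (cases "e ! i") auto
  then show ?thesis unfolding split_mass_def by (intro borel_measurable_prod)
qed

context binary_tree
begin

text \<open>The squares of the two shares of a split add up to
  \<open>(1 + (2 * v - 1)\<^sup>2) / 2\<close>, and the half is absorbed by the power of 2 of the
  next level.\<close>

lemma energy_split_Suc:
  "energy (split_mass v) (Suc l) = (\<Sum>e\<in>level l. 2 ^ l * ((split_mass v e)\<^sup>2 * (1 + (2 * v e - 1)\<^sup>2)))"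
  unfolding energy_def sum_level_Suc sum_distrib_left
  by (intro sum.cong) (auto simp: split_mass_snoc power2_eq_square algebra_simps)

end

text \<open>General enough to include every posterior, whose parameters are not constant on levels.
  By \<open>spread\<close>, the second moment of \<open>2 * v - 1\<close> under the law of a split
  is at most \<open>c\<close> of its level, which keeps the energies bounded.\<close>

locale polya_parameters = binary_tree \<X> B
  for \<X> :: "'a::euclidean_space set" and B +
  fixes b :: "bool list \<Rightarrow> real" and c :: "nat \<Rightarrow> real"
  assumes b_pos: "\<And>e. 0 < b e"
    and c_nonneg: "\<And>l. 0 \<le> c l" and c_summable: "summable c"
    and spread: "\<And>e. ((b (e @ [False]) - b (e @ [True]))\<^sup>2 + (b (e @ [False]) + b (e @ [True]))) /
        ((b (e @ [False]) + b (e @ [True])) * (b (e @ [False]) + b (e @ [True]) + 1)) \<le> c (length e)"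
begin

section \<open>Energy of a tree of independent Beta splits\<close>

abbreviation split_law :: "bool list \<Rightarrow> real measure" where
  "split_law e \<equiv> beta_measure (b (e @ [False])) (b (e @ [True]))"

lemma prob_space_split_law: "prob_space (split_law e)"
  by (intro prob_space_beta_measure b_pos)

lemma split_law_second_moment:
  "(\<integral>\<^sup>+x. ennreal (1 + (2 * x - 1)\<^sup>2) \<partial>split_law e) \<le> ennreal (1 + c (length e))"
proof -
  have "(\<integral>\<^sup>+x. ennreal (1 + (2 * x - 1)\<^sup>2) \<partial>split_law e) = 1 + (\<integral>\<^sup>+x. ennreal ((2 * x - 1)\<^sup>2) \<partial>split_law e)"
    using prob_space.emeasure_space_1[OF prob_space_split_law]
    by (simp add: ennreal_plus nn_integral_add)
  also have "\<dots> \<le> 1 + ennreal (c (length e))"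
    by (intro add_mono order_refl order_trans[OF nn_integral_beta_centred_sq] ennreal_leI spread b_pos)
  finally show ?thesis using c_nonneg by (simp add: ennreal_plus)
qed

text \<open>Stated on an arbitrary probability space because it is used for two: the product space
  from which a tree is built, and the space of measures under a given tree law, where the splits are
  conditional probabilities.\<close>

definition splitting_rvs :: "'w measure \<Rightarrow> (bool list \<Rightarrow> 'w \<Rightarrow> real) \<Rightarrow> bool" where
  "splitting_rvs M V \<longleftrightarrow> prob_space M \<and> prob_space.indep_vars M (\<lambda>_. borel) V UNIV \<and>
     (\<forall>e. distr M borel (V e) = split_law e)"

lemma splitting_rvs_measurable:
  "splitting_rvs M V \<Longrightarrow> V e \<in> borel_measurable M"
  unfolding splitting_rvs_def by (auto simp: prob_space.indep_vars_def2)

lemma splitting_rvs_nn_integral: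
  assumes S: "splitting_rvs M V" and [measurable]: "f \<in> borel_measurable borel"
  shows "(\<integral>\<^sup>+\<omega>. f (V e \<omega>) \<partial>M) = (\<integral>\<^sup>+x. f x \<partial>split_law e)"
proof -
  have [measurable]: "V e \<in> borel_measurable M" by (rule splitting_rvs_measurable[OF S])
  have "(\<integral>\<^sup>+x. f x \<partial>distr M borel (V e)) = (\<integral>\<^sup>+\<omega>. f (V e \<omega>) \<partial>M)"
    by (rule nn_integral_distr) measurable
  then show ?thesis using S by (simp add: splitting_rvs_def)
qed

lemma splitting_rvs_interior:
  assumes S: "splitting_rvs M V"
  shows "AE \<omega> in M. \<forall>e. 0 < V e \<omega> \<and> V e \<omega> < 1"
  unfolding AE_all_countable
proof
  fix e
  have [measurable]: "V e \<in> borel_measurable M" by (rule splitting_rvs_measurable[OF S])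
  have law: "distr M borel (V e) = split_law e" using S by (simp add: splitting_rvs_def)
  have "AE x in distr M borel (V e). 0 < x \<and> x < 1"
    unfolding law by (rule AE_beta_measure)
  then show "AE \<omega> in M. 0 < V e \<omega> \<and> V e \<omega> < 1"
    by (subst (asm) AE_distr_iff) auto
qed

text \<open>The mass of a node depends only on the splits at its proper ancestors and is independent
  of its own split, so one more level multiplies the mean energy by at most
  \<open>1 + c l\<close>.\<close>

lemma splitting_rvs_energy:
  assumes S: "splitting_rvs M V"
  shows "(\<integral>\<^sup>+\<omega>. ennreal (energy (split_mass (\<lambda>e. V e \<omega>)) l) \<partial>M) \<le> ennreal (\<Prod>k<l. 1 + c k)"
proof (induction l)
  case 0
  interpret prob_space M using S by (simp add: splitting_rvs_def)
  show ?case using emeasure_space_1 by (simp add: energy_def)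
next
  case (Suc l)
  interpret prob_space M using S by (simp add: splitting_rvs_def)
  have [measurable]: "V e \<in> borel_measurable M" for e by (rule splitting_rvs_measurable[OF S])
  let ?p = "\<lambda>\<omega>. split_mass (\<lambda>e. V e \<omega>)"
  have step: "(\<integral>\<^sup>+\<omega>. ennreal ((?p \<omega> e)\<^sup>2 * (1 + (2 * V e \<omega> - 1)\<^sup>2)) \<partial>M) \<le>
      (\<integral>\<^sup>+\<omega>. ennreal ((?p \<omega> e)\<^sup>2) \<partial>M) * ennreal (1 + c (length e))" for e
  proof -
    \<comment> \<open>One family for the whole path: squared shares at the ancestors and the new
      factor at \<open>e\<close> itself. Independence is then used for a single product over
      distinct nodes.\<close>
    define \<phi> where "\<phi> k x = ennreal (if k = e then 1 + (2 * x - 1)\<^sup>2 else if e ! length k then (1 - x)\<^sup>2 else x\<^sup>2)"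
      for k and x :: real
    have [measurable]: "\<phi> k \<in> borel_measurable borel" for k
      unfolding \<phi>_def[abs_def] by (cases "k = e"; cases "e ! length k") auto
    let ?K = "(\<lambda>i. take i e) ` {..<length e}"
    have inj: "inj_on (\<lambda>i. take i e) {..<length e}"
      by (auto simp: inj_on_def dest: arg_cong[where f=length])
    have notin: "e \<notin> ?K"
    proof
      assume "e \<in> ?K"
      then obtain i where "i < length e" "e = take i e" by auto
      then show False by (metis length_take less_irrefl min.strict_order_iff min.commute)
    qed
    have prod: "ennreal ((?p \<omega> e)\<^sup>2) = (\<Prod>k\<in>?K. \<phi> k (V k \<omega>))" for \<omega>
    proof -
      have "(?p \<omega> e)\<^sup>2 = (\<Prod>i<length e. (if e ! i then 1 - V (take i e) \<omega> else V (take i e) \<omega>)\<^sup>2)"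
        by (simp add: split_mass_def prod_power_distrib)
      then have "ennreal ((?p \<omega> e)\<^sup>2) = (\<Prod>i<length e. ennreal ((if e ! i then 1 - V (take i e) \<omega> else V (take i e) \<omega>)\<^sup>2))"
        by (simp add: prod_ennreal)
      also have "\<dots> = (\<Prod>i<length e. \<phi> (take i e) (V (take i e) \<omega>))"
      proof (intro prod.cong refl)
        fix i assume "i \<in> {..<length e}"
        then have i: "length (take i e) = i" "i < length e" by simp_all
        then have "take i e \<noteq> e" by (metis less_irrefl)
        with i show "ennreal ((if e ! i then 1 - V (take i e) \<omega> else V (take i e) \<omega>)\<^sup>2) = \<phi> (take i e) (V (take i e) \<omega>)"
          by (simp add: \<phi>_def)
      qed
      also have "\<dots> = (\<Prod>k\<in>?K. \<phi> k (V k \<omega>))" by (subst prod.reindex[OF inj]) simp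
      finally show ?thesis .
    qed
    have ind: "indep_vars (\<lambda>_. borel) (\<lambda>k \<omega>. \<phi> k (V k \<omega>)) J" for J
      using S by (intro indep_vars_subset[OF indep_vars_compose2[of "\<lambda>_. borel" V UNIV \<phi> "\<lambda>_. borel"]])
        (auto simp: splitting_rvs_def)
    have "(\<integral>\<^sup>+\<omega>. ennreal ((?p \<omega> e)\<^sup>2 * (1 + (2 * V e \<omega> - 1)\<^sup>2)) \<partial>M) = (\<integral>\<^sup>+\<omega>. (\<Prod>k\<in>insert e ?K. \<phi> k (V k \<omega>)) \<partial>M)"
      using notin by (intro nn_integral_cong) (simp add: ennreal_mult prod \<phi>_def[of e] mult.commute)
    also have "\<dots> = (\<Prod>k\<in>insert e ?K. \<integral>\<^sup>+\<omega>. \<phi> k (V k \<omega>) \<partial>M)"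
      by (intro indep_vars_nn_integral ind) auto
    also have "\<dots> = (\<integral>\<^sup>+\<omega>. \<phi> e (V e \<omega>) \<partial>M) * (\<Prod>k\<in>?K. \<integral>\<^sup>+\<omega>. \<phi> k (V k \<omega>) \<partial>M)"
      using notin by simp
    also have "(\<Prod>k\<in>?K. \<integral>\<^sup>+\<omega>. \<phi> k (V k \<omega>) \<partial>M) = (\<integral>\<^sup>+\<omega>. (\<Prod>k\<in>?K. \<phi> k (V k \<omega>)) \<partial>M)"
      by (intro indep_vars_nn_integral[symmetric] ind) auto
    also have "\<dots> = (\<integral>\<^sup>+\<omega>. ennreal ((?p \<omega> e)\<^sup>2) \<partial>M)" by (simp add: prod)
    finally have "(\<integral>\<^sup>+\<omega>. ennreal ((?p \<omega> e)\<^sup>2 * (1 + (2 * V e \<omega> - 1)\<^sup>2)) \<partial>M) =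
      (\<integral>\<^sup>+\<omega>. ennreal ((?p \<omega> e)\<^sup>2) \<partial>M) * (\<integral>\<^sup>+\<omega>. \<phi> e (V e \<omega>) \<partial>M)"
      by (simp only: mult.commute)
    moreover have "(\<integral>\<^sup>+\<omega>. \<phi> e (V e \<omega>) \<partial>M) = (\<integral>\<^sup>+x. ennreal (1 + (2 * x - 1)\<^sup>2) \<partial>split_law e)"
      by (subst splitting_rvs_nn_integral[OF S]) (auto simp: \<phi>_def intro!: nn_integral_cong)
    ultimately show ?thesis
      using split_law_second_moment[of e] by (simp only:) (rule mult_left_mono; simp)
  qed
  have "(\<integral>\<^sup>+\<omega>. ennreal (energy (?p \<omega>) (Suc l)) \<partial>M) =
      (\<Sum>e\<in>level l. 2 ^ l * (\<integral>\<^sup>+\<omega>. ennreal ((?p \<omega> e)\<^sup>2 * (1 + (2 * V e \<omega> - 1)\<^sup>2)) \<partial>M))"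
    unfolding energy_split_Suc
    by (subst sum_ennreal[symmetric], simp)
      (simp add: nn_integral_sum ennreal_mult nn_integral_cmult ennreal_power[symmetric])
  also have "\<dots> \<le> (\<Sum>e\<in>level l. 2 ^ l * ((\<integral>\<^sup>+\<omega>. ennreal ((?p \<omega> e)\<^sup>2) \<partial>M) * ennreal (1 + c (length e))))"
    by (intro sum_mono mult_left_mono step) auto
  also have "\<dots> = (\<Sum>e\<in>level l. 2 ^ l * (\<integral>\<^sup>+\<omega>. ennreal ((?p \<omega> e)\<^sup>2) \<partial>M)) * ennreal (1 + c l)"
    by (simp add: sum_distrib_right mult.assoc)
  also have "(\<Sum>e\<in>level l. 2 ^ l * (\<integral>\<^sup>+\<omega>. ennreal ((?p \<omega> e)\<^sup>2) \<partial>M)) = (\<integral>\<^sup>+\<omega>. ennreal (energy (?p \<omega>) l) \<partial>M)"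
    unfolding energy_def sum_distrib_left
    by (subst sum_ennreal[symmetric], simp)
      (simp add: nn_integral_sum ennreal_mult nn_integral_cmult ennreal_power[symmetric])
  also have "\<dots> * ennreal (1 + c l) \<le> ennreal (\<Prod>k<l. 1 + c k) * ennreal (1 + c l)"
    by (intro mult_right_mono Suc.IH) auto
  also have "\<dots> = ennreal (\<Prod>k<Suc l. 1 + c k)"
    by (subst ennreal_mult[symmetric]) (auto intro!: prod_nonneg add_nonneg_nonneg c_nonneg)
  finally show ?case .
qed

text \<open>Energies increase with the level, so monotone convergence bounds the mean of their
  supremum by the supremum of the products, which is at most \<open>exp (suminf c)\<close>.\<close>

lemma splitting_rvs_bounded_energy:
  assumes S: "splitting_rvs M V"
  shows "AE \<omega> in M. \<exists>C::nat. \<forall>l. energy (split_mass (\<lambda>e. V e \<omega>)) l \<le> real C"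
proof -
  have [measurable]: "V e \<in> borel_measurable M" for e by (rule splitting_rvs_measurable[OF S])
  let ?E = "\<lambda>l \<omega>. energy (split_mass (\<lambda>e. V e \<omega>)) l"
  have [measurable]: "?E l \<in> borel_measurable M" for l unfolding energy_def by measurable
  have "(\<integral>\<^sup>+\<omega>. (SUP l. ennreal (?E l \<omega>)) \<partial>M) = (SUP l. \<integral>\<^sup>+\<omega>. ennreal (?E l \<omega>) \<partial>M)"
    by (rule nn_integral_monotone_convergence_SUP)
      (auto simp: incseq_def le_fun_def intro!: ennreal_leI energy_mono split_mass_additive)
  also have "\<dots> \<le> ennreal (exp (suminf c))"
  proof (rule SUP_least)
    fix l
    have "(\<Prod>k<l. 1 + c k) \<le> (\<Prod>k<l. exp (c k))"
      using c_nonneg by (intro prod_mono) auto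
    also have "\<dots> = exp (\<Sum>k<l. c k)" by (simp add: exp_sum)
    also have "\<dots> \<le> exp (suminf c)"
      using sum_le_suminf[OF c_summable, of "{..<l}"] c_nonneg by simp
    finally show "(\<integral>\<^sup>+\<omega>. ennreal (?E l \<omega>) \<partial>M) \<le> ennreal (exp (suminf c))"
      by (intro order_trans[OF splitting_rvs_energy[OF S]] ennreal_leI)
  qed
  finally have "(\<integral>\<^sup>+\<omega>. (SUP l. ennreal (?E l \<omega>)) \<partial>M) \<noteq> \<infinity>" by (auto simp: top_unique)
  then have "AE \<omega> in M. (SUP l. ennreal (?E l \<omega>)) \<noteq> \<infinity>"
    by (intro nn_integral_PInf_AE) measurable
  then show ?thesis
  proof eventually_elim
    case (elim \<omega>)
    then obtain r where r: "(SUP l. ennreal (?E l \<omega>)) = ennreal r" "0 \<le> r"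
      by (cases "SUP l. ennreal (?E l \<omega>)") auto
    have "?E l \<omega> \<le> r" for l
    proof -
      have "ennreal (?E l \<omega>) \<le> ennreal r" unfolding r(1)[symmetric] by (rule SUP_upper) simp
      then show ?thesis using r(2) by (simp add: ennreal_le_iff)
    qed
    moreover obtain C where "r \<le> real C" using real_arch_simple by blast
    ultimately show ?case by (meson order_trans)
  qed
qed

text \<open>The bound ranges over natural numbers, so that the condition is a countable combination
  of measurable ones.\<close>

definition regular :: "(bool list \<Rightarrow> real) \<Rightarrow> bool" where
  "regular v \<longleftrightarrow> (\<forall>e. 0 < v e \<and> v e < 1) \<and> (\<exists>C::nat. \<forall>l. energy (split_mass v) l \<le> real C)"

lemma splitting_rvs_regular:
  assumes "splitting_rvs M V"
  shows "AE \<omega> in M. regular (\<lambda>e. V e \<omega>)"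
  using splitting_rvs_interior[OF assms] splitting_rvs_bounded_energy[OF assms]
  by eventually_elim (auto simp: regular_def)

lemma regular_density:
  assumes "regular v"
  shows "\<exists>\<theta>. integrable (leb_on \<X>) \<theta> \<and> (\<forall>x. 0 \<le> \<theta> x) \<and> (\<forall>e. mass \<theta> e = split_mass v e)"
proof -
  obtain C :: nat where C: "\<And>l. energy (split_mass v) l \<le> real C" using assms by (auto simp: regular_def)
  have "0 \<le> split_mass v e" for e
    using split_mass_pos[of v e] assms by (auto simp: regular_def)
  then show ?thesis
    by (rule density_of_bounded_energy[OF split_mass_additive _ C]) blast
qed

text \<open>
  Off the null set of irregular splits any probability measure would do as the value of \<open>polya_map\<close>.
\<close>

definition polya_density :: "(bool list \<Rightarrow> real) \<Rightarrow> 'a \<Rightarrow> real" where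
  "polya_density v = (SOME \<theta>. integrable (leb_on \<X>) \<theta> \<and> (\<forall>x. 0 \<le> \<theta> x) \<and> (\<forall>e. mass \<theta> e = split_mass v e))"

definition polya_map :: "(bool list \<Rightarrow> real) \<Rightarrow> 'a measure" where
  "polya_map v = (if regular v then density (leb_on \<X>) (\<lambda>x. ennreal (polya_density v x)) else leb_on \<X>)"

lemma polya_density:
  assumes "regular v"
  shows "integrable (leb_on \<X>) (polya_density v)" "\<And>x. 0 \<le> polya_density v x"
    "\<And>e. mass (polya_density v) e = split_mass v e"
proof -
  have *: "integrable (leb_on \<X>) (polya_density v) \<and> (\<forall>x. 0 \<le> polya_density v x) \<and> (\<forall>e. mass (polya_density v) e = split_mass v e)"
    unfolding polya_density_def by (rule someI_ex[OF regular_density[OF assms]])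
  show "integrable (leb_on \<X>) (polya_density v)" by (rule conjunct1[OF *])
  show "0 \<le> polya_density v x" for x by (rule conjunct1[OF conjunct2[OF *], rule_format])
  show "mass (polya_density v) e = split_mass v e" for e by (rule conjunct2[OF conjunct2[OF *], rule_format])
qed

lemma sets_polya_map: "sets (polya_map v) = sets (restrict_space borel \<X>)"
  by (simp add: polya_map_def sets_leb)

lemma emeasure_polya_map:
  "emeasure (polya_map v) (B e) = (if regular v then ennreal (split_mass v e) else ennreal ((1 / 2) ^ length e))"
  using polya_density[of v] by (simp add: polya_map_def emeasure_density_B emeasure_B)

lemma prob_space_polya_map: "prob_space (polya_map v)"
proof (rule prob_spaceI)
  have "space (polya_map v) = B []" by (simp add: polya_map_def B_root)
  then show "emeasure (polya_map v) (space (polya_map v)) = 1"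
    using emeasure_polya_map[of v "[]"] by simp
qed

section \<open>The product law of the splits and its image under the tree map\<close>

definition split_space :: "(bool list \<Rightarrow> real) measure" where
  "split_space = (\<Pi>\<^sub>M e\<in>UNIV. split_law e)"

lemma sets_split_space [measurable_cong]: "sets split_space = sets (\<Pi>\<^sub>M e\<in>UNIV. borel)"
  unfolding split_space_def by (intro sets_PiM_cong) auto

lemma prob_space_split_space: "prob_space split_space"
  unfolding split_space_def by (intro prob_space_PiM prob_space_split_law)

lemma component_measurable [measurable]: "(\<lambda>v. v e) \<in> borel_measurable split_space"
  by measurable

lemma splitting_rvs_split_space: "splitting_rvs split_space (\<lambda>e v. v e)"
  unfolding splitting_rvs_def
proof (intro conjI allI)
  interpret prob_space split_space by (rule prob_space_split_space)
  have component: "distr split_space borel (\<lambda>v. v e) = split_law e" for e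
  proof -
    have "distr split_space borel (\<lambda>v. v e) = distr split_space (split_law e) (\<lambda>v. v e)"
      by (rule distr_cong) auto
    also have "\<dots> = split_law e"
      unfolding split_space_def by (rule distr_PiM_component) (auto intro: prob_space_split_law)
    finally show ?thesis .
  qed
  then show "distr split_space borel (\<lambda>v. v e) = split_law e" for e .
  have "distr split_space (\<Pi>\<^sub>M e\<in>UNIV. borel) (\<lambda>v. \<lambda>e\<in>UNIV. v e) = distr split_space split_space (\<lambda>v. v)"
    by (rule distr_cong) (auto simp: sets_split_space)
  also have "\<dots> = (\<Pi>\<^sub>M e\<in>UNIV. distr split_space borel (\<lambda>v. v e))"
    by (simp only: distr_id component) (simp add: split_space_def)
  finally show "indep_vars (\<lambda>_. borel) (\<lambda>e v. v e) UNIV"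
    by (subst indep_vars_iff_distr_eq_PiM') auto
qed (rule prob_space_split_space)

lemma regular_measurable [measurable]: "{v \<in> space split_space. regular v} \<in> sets split_space"
  unfolding regular_def energy_def by measurable

text \<open>The density is picked by choice and need not depend measurably on the splits.
  Measurability into the space of measures is tested only on the generating sets \<open>B e\<close>,
  whose masses are explicit.\<close>

lemma polya_map_measurable: "polya_map \<in> measurable split_space (prob_algebra (restrict_space borel \<X>))"
proof (rule measurable_prob_algebra_generated[OF sigma_sets_B[symmetric] Int_stable_B])
  show "insert {} (range B) \<subseteq> Pow \<X>" using B_sub by auto
  fix A assume "A \<in> insert {} (range B)"
  then consider "A = {}" | e where "A = B e" by auto
  then show "(\<lambda>v. emeasure (polya_map v) A) \<in> borel_measurable split_space"
  proof cases
    case (2 e)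
    have [measurable]: "Measurable.pred split_space regular"
      unfolding pred_def by (rule regular_measurable)
    show ?thesis unfolding 2 emeasure_polya_map by measurable
  qed simp
qed (auto simp: prob_space_polya_map sets_polya_map)

abbreviation cond_split :: "bool list \<Rightarrow> 'a measure \<Rightarrow> real" where
  "cond_split \<equiv> \<lambda>e P. \<P>(x in P. x \<in> B (e @ [False]) \<bar> x \<in> B e)"

lemma cond_split_eq:
  assumes "sets P = sets (restrict_space borel \<X>)"
  shows "cond_split e P = measure P (B (e @ [False])) / measure P (B e)"
proof -
  have "space P = \<X>" using sets_eq_imp_space_eq[OF assms] by (simp add: space_restrict_space)
  then have "{x \<in> space P. x \<in> B (e @ [False]) \<and> x \<in> B e} = B (e @ [False])"
    "{x \<in> space P. x \<in> B e} = B e"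
    using B_sub B_split[of e] by auto
  then show ?thesis by (simp add: cond_prob_def)
qed

lemma split_mass_cond_split:
  assumes P: "P \<in> space (prob_algebra (restrict_space borel \<X>))"
  shows "split_mass (\<lambda>e. cond_split e P) e = measure P (B e)"
proof -
  have sets: "sets P = sets (restrict_space borel \<X>)" and prob: "prob_space P"
    using P by (auto simp: space_prob_algebra)
  interpret prob_space P by (rule prob)
  have [measurable]: "B e \<in> sets P" for e using sets B_sets by simp
  show ?thesis
  proof (induction e rule: rev_induct)
    case Nil
    have "space P = B []" using sets_eq_imp_space_eq[OF sets] by (simp add: B_root space_restrict_space)
    then show ?case using prob_space by simp
  next
    case (snoc d e)
    have "measure P (B (e @ [False])) + measure P (B (e @ [True])) = measure P (B e)"
      using B_split[of e] B_disj[of e] finite_measure_Union[of "B (e @ [False])" "B (e @ [True])"] by simp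
    moreover have "measure P (B e) * cond_split e P = measure P (B (e @ [False]))"
    \<comment> \<open>On a null node the conditional probability is 0 by convention, and the child
      has mass 0 as well.\<close>
    proof (cases "measure P (B e) = 0")
      case True
      moreover have "measure P (B (e @ [False])) \<le> measure P (B e)"
        using B_split[of e] by (intro finite_measure_mono) auto
      ultimately show ?thesis by (simp add: measure_le_0_iff)
    qed (simp add: cond_split_eq[OF sets])
    ultimately show ?case using snoc by (cases d) (auto simp: split_mass_snoc algebra_simps)
  qed
qed

lemma polya_map_cond_split:
  assumes P: "P \<in> space (prob_algebra (restrict_space borel \<X>))" and "regular (\<lambda>e. cond_split e P)"
  shows "polya_map (\<lambda>e. cond_split e P) = P"
proof (rule measure_eq_on_tree)
  interpret prob_space P using P by (simp add: space_prob_algebra)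
  show "emeasure (polya_map (\<lambda>e. cond_split e P)) (B e) = emeasure P (B e)" for e
    by (simp only: emeasure_polya_map assms if_True split_mass_cond_split[OF P] emeasure_eq_measure)
  have "emeasure (polya_map (\<lambda>e. cond_split e P)) \<X> \<le> 1"
    by (rule prob_space.emeasure_le_1[OF prob_space_polya_map])
  then show "emeasure (polya_map (\<lambda>e. cond_split e P)) \<X> \<noteq> \<infinity>"
    by (metis ennreal_one_neq_top infinity_ennreal_def top.extremum_uniqueI)
qed (use P in \<open>auto simp: sets_polya_map space_prob_algebra\<close>)

lemma cond_split_measurable [measurable]:
  "cond_split e \<in> borel_measurable (prob_algebra (restrict_space borel \<X>))"
proof -
  have "(\<lambda>P. measure P (B (e @ [False])) / measure P (B e)) \<in> borel_measurable (prob_algebra (restrict_space borel \<X>))"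
    unfolding prob_algebra_def by (intro measurable_restrict_space1) measurable
  then show ?thesis
    by (rule measurable_cong[THEN iffD2, rotated]) (auto simp: space_prob_algebra cond_split_eq)
qed

lemma splitting_rvs_cond_split:
  "is_polya_tree \<X> B b \<Phi> \<longleftrightarrow>
    sets \<Phi> = sets (prob_algebra (restrict_space borel \<X>)) \<and> splitting_rvs \<Phi> cond_split"
proof -
  have *: "distributed \<Phi> lborel (cond_split e) (\<lambda>x. ennreal (beta_density (b (e @ [False])) (b (e @ [True])) x)) \<longleftrightarrow>
      distr \<Phi> borel (cond_split e) = split_law e"
    if "sets \<Phi> = sets (prob_algebra (restrict_space borel \<X>))" for e
  proof -
    have "cond_split e \<in> borel_measurable \<Phi>"
      using cond_split_measurable measurable_cong_sets[OF that refl] by blast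
    moreover have "distr \<Phi> lborel (cond_split e) = distr \<Phi> borel (cond_split e)"
      by (rule distr_cong) auto
    ultimately show ?thesis by (auto simp: distributed_def beta_measure_def)
  qed
  show ?thesis unfolding is_polya_tree_def splitting_rvs_def using * by blast
qed

text \<open>
  Almost surely \<open>polya_map\<close> and \<open>cond_split\<close> are inverse to each other, which gives existence and uniqueness.
\<close>

theorem is_polya_tree_iff:
  "is_polya_tree \<X> B b \<Phi> \<longleftrightarrow> \<Phi> = distr split_space (prob_algebra (restrict_space borel \<X>)) polya_map"
proof
  assume "is_polya_tree \<X> B b \<Phi>"
  then have sets: "sets \<Phi> = sets (prob_algebra (restrict_space borel \<X>))" and S: "splitting_rvs \<Phi> cond_split"
    by (auto simp: splitting_rvs_cond_split)
  interpret prob_space \<Phi> using S by (simp add: splitting_rvs_def)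
  have space: "space \<Phi> = space (prob_algebra (restrict_space borel \<X>))"
    by (rule sets_eq_imp_space_eq[OF sets])
  have V: "(\<lambda>P. \<lambda>e\<in>UNIV. cond_split e P) \<in> measurable \<Phi> (\<Pi>\<^sub>M e\<in>UNIV. borel)"
    by (intro measurable_restrict splitting_rvs_measurable[OF S])
  have V': "(\<lambda>P e. cond_split e P) \<in> measurable \<Phi> split_space"
    using V measurable_cong_sets[OF refl sets_split_space, of \<Phi>] by (simp add: restrict_def)
  have id: "(\<lambda>P. P) \<in> measurable \<Phi> (prob_algebra (restrict_space borel \<X>))"
    using measurable_ident_sets[OF sets] .
  \<comment> \<open>Independence and the marginal laws determine the joint law of the splits.
    Uniqueness follows because almost every measure is recovered from its splits by
    \<open>polya_map\<close>.\<close>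
  have law: "distr \<Phi> split_space (\<lambda>P e. cond_split e P) = split_space"
  proof -
    have "distr \<Phi> split_space (\<lambda>P e. cond_split e P) = distr \<Phi> (\<Pi>\<^sub>M e\<in>UNIV. borel) (\<lambda>P. \<lambda>e\<in>UNIV. cond_split e P)"
      by (rule distr_cong) (auto simp: sets_split_space)
    also have "\<dots> = (\<Pi>\<^sub>M e\<in>UNIV. distr \<Phi> borel (cond_split e))"
      using S splitting_rvs_measurable[OF S]
      by (intro indep_vars_iff_distr_eq_PiM'[THEN iffD1]) (auto simp: splitting_rvs_def)
    also have "\<dots> = split_space"
      using S by (simp add: split_space_def splitting_rvs_def)
    finally show ?thesis .
  qed
  have "\<Phi> = distr \<Phi> (prob_algebra (restrict_space borel \<X>)) (\<lambda>P. P)"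
    using sets by (metis distr_cong distr_id)
  also have "\<dots> = distr \<Phi> (prob_algebra (restrict_space borel \<X>)) (\<lambda>P. polya_map (\<lambda>e. cond_split e P))"
  proof (rule distr_cong_AE)
    show "AE P in \<Phi>. P = polya_map (\<lambda>e. cond_split e P)"
      using splitting_rvs_regular[OF S] AE_space
      by eventually_elim (simp add: polya_map_cond_split space)
    show "(\<lambda>P. polya_map (\<lambda>e. cond_split e P)) \<in> measurable \<Phi> (prob_algebra (restrict_space borel \<X>))"
      by (rule measurable_compose[OF V' polya_map_measurable])
  qed (use id in auto)
  also have "\<dots> = distr (distr \<Phi> split_space (\<lambda>P e. cond_split e P)) (prob_algebra (restrict_space borel \<X>)) polya_map"
    by (subst distr_distr[OF polya_map_measurable V']) (simp add: comp_def)
  also have "\<dots> = distr split_space (prob_algebra (restrict_space borel \<X>)) polya_map"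
    by (simp only: law)
  finally show "\<Phi> = distr split_space (prob_algebra (restrict_space borel \<X>)) polya_map" .
next
  let ?A = "prob_algebra (restrict_space borel \<X>)"
  assume eq: "\<Phi> = distr split_space ?A polya_map"
  interpret prob_space split_space by (rule prob_space_split_space)
  have prob: "prob_space \<Phi>" unfolding eq by (rule prob_space_distr[OF polya_map_measurable])
  have sets: "sets \<Phi> = sets ?A" by (simp add: eq)
  have [measurable]: "cond_split e \<in> borel_measurable \<Phi>" for e
    using cond_split_measurable measurable_cong_sets[OF sets refl] by blast
  \<comment> \<open>Regular splits lie strictly between 0 and 1, so every node has positive mass and
    its split is recovered by division.\<close>
  have inv: "AE v in split_space. (\<lambda>e. cond_split e (polya_map v)) = v"
    using splitting_rvs_regular[OF splitting_rvs_split_space]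
  proof eventually_elim
    case (elim v)
    have m: "measure (polya_map v) (B e) = split_mass v e" for e
      using emeasure_polya_map[of v e] elim split_mass_pos[of v e] by (simp add: measure_def regular_def)
    show ?case
    proof (rule ext)
      fix e
      have "split_mass v e \<noteq> 0"
        using elim split_mass_pos[of v e] by (simp add: regular_def)
      moreover have "cond_split e (polya_map v) = split_mass v (e @ [False]) / split_mass v e"
        by (simp only: cond_split_eq[OF sets_polya_map] m)
      ultimately show "cond_split e (polya_map v) = v e"
        by (simp only: split_mass_snoc) simp
    qed
  qed
  have law: "distr \<Phi> borel (cond_split e) = split_law e" for e
  proof -
    have "distr \<Phi> borel (cond_split e) = distr split_space borel (\<lambda>v. cond_split e (polya_map v))"
      unfolding eq by (subst distr_distr[OF cond_split_measurable polya_map_measurable]) (simp add: comp_def)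
    also have "\<dots> = distr split_space borel (\<lambda>v. v e)"
    proof (rule distr_cong_AE)
      show "AE v in split_space. cond_split e (polya_map v) = v e"
        using inv by eventually_elim (erule fun_cong)
      show "(\<lambda>v. cond_split e (polya_map v)) \<in> borel_measurable split_space"
        by (rule measurable_compose[OF polya_map_measurable cond_split_measurable])
    qed auto
    also have "\<dots> = split_law e" using splitting_rvs_split_space by (simp add: splitting_rvs_def)
    finally show ?thesis .
  qed
  have V: "(\<lambda>P. \<lambda>e\<in>UNIV. cond_split e P) \<in> measurable ?A (\<Pi>\<^sub>M e\<in>UNIV. borel)"
    by (intro measurable_restrict cond_split_measurable)
  have "distr \<Phi> (\<Pi>\<^sub>M e\<in>UNIV. borel) (\<lambda>P. \<lambda>e\<in>UNIV. cond_split e P) =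
      distr split_space (\<Pi>\<^sub>M e\<in>UNIV. borel) (\<lambda>v. \<lambda>e\<in>UNIV. cond_split e (polya_map v))"
    unfolding eq by (subst distr_distr[OF V polya_map_measurable]) (simp add: comp_def)
  also have "\<dots> = distr split_space (\<Pi>\<^sub>M e\<in>UNIV. borel) (\<lambda>v. v)"
  proof (rule distr_cong_AE)
    show "AE v in split_space. (\<lambda>e\<in>UNIV. cond_split e (polya_map v)) = v"
      using inv by eventually_elim (simp add: restrict_def)
    show "(\<lambda>v. \<lambda>e\<in>UNIV. cond_split e (polya_map v)) \<in> measurable split_space (\<Pi>\<^sub>M e\<in>UNIV. borel)"
      by (rule measurable_compose[OF polya_map_measurable V])
  qed (auto intro: measurable_ident_sets sets_split_space)
  also have "\<dots> = distr split_space split_space (\<lambda>v. v)"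
    by (rule distr_cong) (auto simp: sets_split_space)
  also have "\<dots> = (\<Pi>\<^sub>M e\<in>UNIV. distr \<Phi> borel (cond_split e))"
    by (simp only: distr_id law) (simp add: split_space_def)
  finally have "prob_space.indep_vars \<Phi> (\<lambda>_. borel) cond_split UNIV"
    by (subst prob_space.indep_vars_iff_distr_eq_PiM'[OF prob]) auto
  then show "is_polya_tree \<X> B b \<Phi>"
    using prob sets law by (simp add: splitting_rvs_cond_split splitting_rvs_def)
qed

lemma is_polya_tree_PT: "is_polya_tree \<X> B b (PT \<X> B b)"
  unfolding PT_def is_polya_tree_iff by simp

end

section \<open>The expected divergence, node by node\<close>

lemma prod_mono_ennreal:
  fixes f g :: "'i \<Rightarrow> ennreal"
  assumes "\<And>i. i \<in> I \<Longrightarrow> f i \<le> g i"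
  shows "(\<Prod>i\<in>I. f i) \<le> (\<Prod>i\<in>I. g i)"
  using assms by (induction I rule: infinite_finite_induct) (auto intro: mult_mono)

lemma exp_minus_le_half:
  fixes x :: real
  assumes "0 \<le> x" "x \<le> 1"
  shows "exp (- x) \<le> 1 - x / 2"
proof -
  have "exp (- x) = 1 / exp x" by (simp add: exp_minus field_simps)
  also have "\<dots> \<le> 1 / (1 + x)"
    using assms exp_ge_add_one_self[of x] by (intro divide_left_mono) auto
  also have "\<dots> \<le> 1 - x / 2"
  proof -
    have "x * x \<le> x * 1" using assms by (intro mult_left_mono) auto
    then have "1 \<le> (1 - x / 2) * (1 + x)" by (simp add: algebra_simps)
    then show ?thesis using assms by (simp add: pos_divide_le_eq)
  qed
  finally show ?thesis .
qed

text \<open>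
  By symmetry, \<open>v\<close> lies with probability at least one half on the side of \<open>1 / 2\<close> opposite to \<open>q\<close>, where
  the divergence is at least \<open>(q - 1 / 2)\<^sup>2 / 2\<close>.
\<close>

lemma nn_integral_exp_bernoulli_kl:
  assumes a: "0 < a" and q: "0 \<le> q" "q \<le> 1" and w: "0 \<le> w" "w \<le> 1"
  shows "(\<integral>\<^sup>+v. ennreal (exp (- (w * bernoulli_kl q v))) \<partial>beta_measure a a) \<le>
    ennreal (exp (- (w * (2 * q - 1)\<^sup>2 / 32)))"
proof -
  interpret prob_space "beta_measure a a" by (rule prob_space_beta_measure[OF a a])
  \<comment> \<open>As \<open>d = (2 * q - 1)\<^sup>2 / 8\<close>, one halving by
    \<open>exp_minus_le_half\<close> and another by the probability of \<open>S\<close> lead to the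
    constant 32.\<close>
  define d where "d = (q - 1 / 2)\<^sup>2 / 2"
  have d: "0 \<le> d" "d \<le> 1"
  proof -
    have "\<bar>q - 1 / 2\<bar> \<le> 1" using q by (auto simp: abs_if)
    then have "(q - 1 / 2)\<^sup>2 \<le> 1" by (simp add: abs_square_le_1)
    then show "0 \<le> d" "d \<le> 1" by (auto simp: d_def)
  qed
  have wd: "0 \<le> w * d" "w * d \<le> 1" using w d by (auto intro: mult_le_one)
  define S where "S = (if q \<ge> 1 / 2 then {..1/2} else {1/2..} :: real set)"
  have S [measurable]: "S \<in> sets borel" by (simp add: S_def)
  have PS: "1 / 2 \<le> measure (beta_measure a a) S"
    using emeasure_beta_symmetric[OF a] by (simp add: S_def)
  have "(\<integral>\<^sup>+v. ennreal (exp (- (w * bernoulli_kl q v))) \<partial>beta_measure a a) \<le>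
      (\<integral>\<^sup>+v. ennreal (1 - w * d / 2 * indicator S v) \<partial>beta_measure a a)"
  proof (rule nn_integral_mono_AE, use AE_beta_measure in eventually_elim)
    case (elim v)
    have kl: "(q - v)\<^sup>2 / 2 \<le> bernoulli_kl q v" "0 \<le> bernoulli_kl q v"
      using bernoulli_kl_ge_sq[of q v] bernoulli_kl_nonneg[of q v] elim q by blast+
    show ?case
    proof (cases "v \<in> S")
      case True
      then have "\<bar>q - 1 / 2\<bar> \<le> \<bar>q - v\<bar>" by (auto simp: S_def split: if_splits)
      then have "(q - 1 / 2)\<^sup>2 \<le> (q - v)\<^sup>2" by (simp add: abs_le_square_iff)
      then have "d \<le> bernoulli_kl q v" using kl by (simp add: d_def)
      then have "exp (- (w * bernoulli_kl q v)) \<le> exp (- (w * d))" using w by (simp add: mult_left_mono)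
      also have "\<dots> \<le> 1 - w * d / 2" by (rule exp_minus_le_half[OF wd])
      finally show ?thesis using True by (simp add: ennreal_leI)
    next
      case False
      then show ?thesis using w kl by (simp add: ennreal_leI)
    qed
  qed
  also have "\<dots> = ennreal (\<integral>v. 1 - w * d / 2 * indicator S v \<partial>beta_measure a a)"
  proof (rule nn_integral_eq_integral)
    show "integrable (beta_measure a a) (\<lambda>v. 1 - w * d / 2 * indicator S v)"
      by (intro Bochner_Integration.integrable_diff integrable_mult_right) (auto simp: emeasure_eq_measure)
    show "AE v in beta_measure a a. 0 \<le> 1 - w * d / 2 * indicator S v"
      using wd by (intro AE_I2) (auto simp: indicator_def)
  qed
  also have "(\<integral>v. 1 - w * d / 2 * indicator S v \<partial>beta_measure a a) = 1 - w * d / 2 * measure (beta_measure a a) S"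
    using prob_space by (subst Bochner_Integration.integral_diff) (auto simp: emeasure_eq_measure)
  also have "ennreal \<dots> \<le> ennreal (exp (- (w * d / 4)))"
  proof (rule ennreal_leI)
    have "w * d / 2 * (1 / 2) \<le> w * d / 2 * measure (beta_measure a a) S"
      using PS wd by (intro mult_left_mono) auto
    moreover have "1 - w * d / 4 \<le> exp (- (w * d / 4))"
      using exp_ge_add_one_self[of "- (w * d / 4)"] by simp
    ultimately show "1 - w * d / 2 * measure (beta_measure a a) S \<le> exp (- (w * d / 4))"
      by (simp add: mult_ac)
  qed
  also have "w * d / 4 = w * (2 * q - 1)\<^sup>2 / 32"
    by (simp add: d_def power2_eq_square field_simps)
  finally show ?thesis .
qed

locale polya_kl = polya_parameters \<X> B b c
  for \<X> :: "'a::euclidean_space set" and B and b and c +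
  fixes f0 :: "'a \<Rightarrow> real"
  assumes f0_int: "integrable (leb_on \<X>) f0" and f0_nn: "\<And>x. x \<in> \<X> \<Longrightarrow> 0 \<le> f0 x"
    and f0_one: "(\<integral>x. f0 x \<partial>leb_on \<X>) = 1"
begin

abbreviation F :: "bool list \<Rightarrow> real" where "F \<equiv> mass f0"

text \<open>On a node of mass 0 the value is 0 by convention; in the divergence such a node has the
  weight \<open>F e = 0\<close>.\<close>

definition qq :: "bool list \<Rightarrow> real" where "qq e = F (e @ [False]) / F e"

lemma F_nonneg: "0 \<le> F e"
  by (rule mass_nonneg[OF f0_nn])

lemma F_additive: "F (e @ [False]) + F (e @ [True]) = F e"
  using mass_additive[OF f0_int] by (simp add: additive_def)

lemma F_root: "F [] = 1"
  by (simp add: mass_root f0_one)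

lemma F_sum: "(\<Sum>e\<in>level l. F e) = 1"
  using additive_sum[OF mass_additive[OF f0_int]] by (simp add: F_root)

lemma F_le_1: "F e \<le> 1"
  using member_le_sum[of e "level (length e)" F] F_nonneg by (simp add: F_sum)

lemma qq_bounds: "0 \<le> qq e" "qq e \<le> 1"
proof -
  have "F (e @ [False]) \<le> F e" using F_additive[of e] F_nonneg[of "e @ [True]"] by simp
  then show "0 \<le> qq e" "qq e \<le> 1"
    using F_nonneg[of e] F_nonneg[of "e @ [False]"] by (auto simp: qq_def divide_le_eq_1)
qed

lemma F_qq: "F (e @ [False]) = F e * qq e" "F (e @ [True]) = F e * (1 - qq e)"
proof -
  show "F (e @ [False]) = F e * qq e"
    using F_additive[of e] F_nonneg[of "e @ [True]"] F_nonneg[of "e @ [False]"]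
    by (cases "F e = 0") (auto simp: qq_def)
  with F_additive[of e] show "F (e @ [True]) = F e * (1 - qq e)" by (simp add: algebra_simps)
qed

section \<open>The divergence as a series over the levels\<close>

definition kl_level :: "'a measure \<Rightarrow> nat \<Rightarrow> ennreal" where
  "kl_level P l = (\<Sum>e\<in>level l. ennreal (F e * bernoulli_kl (qq e) (cond_split e P)))"

text \<open>The chain rule at every node of a level; the root contributes nothing because both
  measures have mass 1.\<close>

lemma sum_kl_kernel_eq:
  assumes "regular v"
  shows "(\<Sum>e\<in>level l. kl_kernel (F e) (split_mass v e)) =
    (\<Sum>k<l. \<Sum>e\<in>level k. ennreal (F e * bernoulli_kl (qq e) (v e)))"
proof (induction l)
  case 0
  show ?case by (simp add: F_root kl_kernel_def)
next
  case (Suc l)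
  have v: "0 < v e" "v e < 1" for e using assms by (auto simp: regular_def)
  have "kl_kernel (F (e @ [False])) (split_mass v (e @ [False])) + kl_kernel (F (e @ [True])) (split_mass v (e @ [True])) =
      kl_kernel (F e) (split_mass v e) + ennreal (F e * bernoulli_kl (qq e) (v e))" for e
    using kl_kernel_chain[of "F (e @ [False])" "F (e @ [True])" "split_mass v e" "v e"] F_nonneg v split_mass_pos[of v e]
    by (simp add: split_mass_snoc F_additive qq_def)
  then show ?case
    by (simp add: sum_level_Suc sum.distrib Suc.IH)
qed

text \<open>The density \<open>polya_density\<close> agrees almost everywhere with the Radon-Nikodym
  derivative, and the partial sums of the series are the divergences on the finite partitions, which
  increase to the full one.\<close>

lemma KL_regular:
  assumes P: "P \<in> space (prob_algebra (restrict_space borel \<X>))" and R: "regular (\<lambda>e. cond_split e P)"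
  shows "KL \<X> f0 (leb_density \<X> P) = (\<Sum>l. kl_level P l)"
proof -
  define v where "v = (\<lambda>e. cond_split e P)"
  let ?\<theta> = "polya_density v"
  have R': "regular v" using R by (simp add: v_def)
  have "P = polya_map v" using polya_map_cond_split[OF P R] by (simp add: v_def)
  then have dens: "density (leb_on \<X>) (\<lambda>x. ennreal (?\<theta> x)) = P" using R' by (simp add: polya_map_def)
  have [measurable]: "?\<theta> \<in> borel_measurable (leb_on \<X>)" using polya_density(1)[OF R'] by auto
  have "AE x in leb_on \<X>. ennreal (?\<theta> x) = RN_deriv (leb_on \<X>) P x"
    by (rule leb.RN_deriv_unique[OF _ dens]) measurable
  then have ae: "AE x in leb_on \<X>. leb_density \<X> P x = ?\<theta> x"
    unfolding leb_density_def by eventually_elim (metis enn2real_ennreal polya_density(2)[OF R'])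
  have "KL \<X> f0 (leb_density \<X> P) = KL \<X> f0 ?\<theta>"
    unfolding KL_def using ae
    by (intro arg_cong2[where f="(-)"] nn_integral_cong_AE) (auto elim!: eventually_mono)
  also have "\<dots> = (\<integral>\<^sup>+x. kl_kernel (f0 x) (?\<theta> x) \<partial>leb_on \<X>)"
    using polya_density[OF R'] polya_density(3)[OF R', of "[]"]
    by (intro KL_eq_kl_kernel f0_int f0_nn f0_one) (auto simp: mass_root)
  also have "\<dots> = (SUP l. \<Sum>e\<in>level l. kl_kernel (F e) (mass ?\<theta> e))"
    using polya_density[OF R'] by (intro kl_kernel_integral_eq_SUP f0_int f0_nn) auto
  also have "\<dots> = (SUP l. \<Sum>k<l. kl_level P k)"
    unfolding polya_density(3)[OF R'] sum_kl_kernel_eq[OF R'] kl_level_def by (simp add: v_def)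
  also have "\<dots> = (\<Sum>l. kl_level P l)" by (rule suminf_eq_SUP[symmetric])
  finally show ?thesis .
qed

lemma PT_sets: "sets (PT \<X> B b) = sets (prob_algebra (restrict_space borel \<X>))"
  and PT_splitting: "splitting_rvs (PT \<X> B b) cond_split"
  using is_polya_tree_PT by (auto simp: splitting_rvs_cond_split)

lemma AE_KL: "AE P in PT \<X> B b. KL \<X> f0 (leb_density \<X> P) = (\<Sum>l. kl_level P l)"
  using splitting_rvs_regular[OF PT_splitting] AE_space
  by eventually_elim (simp add: KL_regular sets_eq_imp_space_eq[OF PT_sets])

lemma bernoulli_kl_measurable [measurable]: "bernoulli_kl q \<in> borel_measurable borel"
  unfolding bernoulli_kl_def[abs_def] by measurable

lemma nn_integral_KL:
  "(\<integral>\<^sup>+P. KL \<X> f0 (leb_density \<X> P) \<partial>PT \<X> B b) =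
    (\<Sum>l. \<Sum>e\<in>level l. ennreal (F e) * (\<integral>\<^sup>+v. ennreal (bernoulli_kl (qq e) v) \<partial>split_law e))"
proof -
  have [measurable]: "cond_split e \<in> borel_measurable (PT \<X> B b)" for e
    by (rule splitting_rvs_measurable[OF PT_splitting])
  have [measurable]: "(\<lambda>P. kl_level P l) \<in> borel_measurable (PT \<X> B b)" for l
    unfolding kl_level_def by measurable
  have "(\<integral>\<^sup>+P. KL \<X> f0 (leb_density \<X> P) \<partial>PT \<X> B b) = (\<integral>\<^sup>+P. (\<Sum>l. kl_level P l) \<partial>PT \<X> B b)"
    by (rule nn_integral_cong_AE[OF AE_KL])
  also have "\<dots> = (\<Sum>l. \<integral>\<^sup>+P. kl_level P l \<partial>PT \<X> B b)"
    by (rule nn_integral_suminf) measurable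
  also have "(\<lambda>l. \<integral>\<^sup>+P. kl_level P l \<partial>PT \<X> B b) = (\<lambda>l. \<Sum>e\<in>level l. ennreal (F e) * (\<integral>\<^sup>+v. ennreal (bernoulli_kl (qq e) v) \<partial>split_law e))"
  proof
    fix l
    have "(\<integral>\<^sup>+P. kl_level P l \<partial>PT \<X> B b) = (\<Sum>e\<in>level l. \<integral>\<^sup>+P. ennreal (F e) * ennreal (bernoulli_kl (qq e) (cond_split e P)) \<partial>PT \<X> B b)"
      unfolding kl_level_def by (subst nn_integral_sum) (auto simp: ennreal_mult' F_nonneg)
    also have "\<dots> = (\<Sum>e\<in>level l. ennreal (F e) * (\<integral>\<^sup>+v. ennreal (bernoulli_kl (qq e) v) \<partial>split_law e))"
      using splitting_rvs_nn_integral[OF PT_splitting, of "\<lambda>v. ennreal (bernoulli_kl (qq _) v)"]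
      by (intro sum.cong) (auto simp: nn_integral_cmult)
    finally show "(\<integral>\<^sup>+P. kl_level P l \<partial>PT \<X> B b) = \<dots>" .
  qed
  finally show ?thesis .
qed

text \<open>On an event of probability \<open>p\<close> the first \<open>l\<close> levels contribute
  at most \<epsilon>, so \<open>exp (- \<epsilon>) * p\<close> bounds the Laplace transform of their
  sum from below. Independence factorises this transform over the nodes, and taking logarithms gives
  a bound that does not depend on \<open>l\<close>.\<close>

lemma KL_support_imp_bounded:
  assumes sym: "\<And>e. b (e @ [False]) = b (e @ [True])"
    and p: "\<P>(P in PT \<X> B b. KL \<X> f0 (leb_density \<X> P) \<le> ennreal \<epsilon>) > 0" and \<epsilon>: "0 < \<epsilon>"
  shows "\<exists>C. \<forall>l. (\<Sum>k<l. \<Sum>e\<in>level k. F e * (2 * qq e - 1)\<^sup>2) \<le> C"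
proof -
  let ?\<Phi> = "PT \<X> B b"
  interpret P: prob_space ?\<Phi> using PT_splitting by (simp add: splitting_rvs_def)
  have [measurable]: "cond_split e \<in> borel_measurable ?\<Phi>" for e
    by (rule splitting_rvs_measurable[OF PT_splitting])
  define N where "N = {P \<in> space ?\<Phi>. KL \<X> f0 (leb_density \<X> P) \<le> ennreal \<epsilon>}"
  define p where "p = measure ?\<Phi> N"
  have p0: "p > 0" using p by (simp add: p_def N_def)
  \<comment> \<open>A set outside the sigma-algebra would have measure 0, so the positivity of
    \<open>p\<close> yields measurability.\<close>
  have N [measurable]: "N \<in> sets ?\<Phi>" using p0 measure_notin_sets[of N ?\<Phi>] by (auto simp: p_def)
  have "(\<Sum>k<l. \<Sum>e\<in>level k. F e * (2 * qq e - 1)\<^sup>2) \<le> 32 * (\<epsilon> - ln p)" for l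
  proof -
    let ?I = "\<Union>k<l. level k"
    have fin: "finite ?I" by auto
    have sumI: "(\<Sum>k<l. \<Sum>e\<in>level k. g e) = (\<Sum>e\<in>?I. g e)" for g :: "bool list \<Rightarrow> real"
      by (rule sum.UNION_disjoint[symmetric]) auto
    let ?s = "\<lambda>P. \<Sum>e\<in>?I. F e * bernoulli_kl (qq e) (cond_split e P)"
    have "ennreal (exp (- \<epsilon>)) * ennreal p = (\<integral>\<^sup>+P. ennreal (exp (- \<epsilon>)) * indicator N P \<partial>?\<Phi>)"
      by (simp add: nn_integral_cmult p_def P.emeasure_eq_measure)
    also have "\<dots> \<le> (\<integral>\<^sup>+P. ennreal (exp (- ?s P)) \<partial>?\<Phi>)"
    proof (rule nn_integral_mono_AE, use AE_KL splitting_rvs_interior[OF PT_splitting] in eventually_elim)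
      case (elim P)
      show ?case
      proof (cases "P \<in> N")
        case True
        have nn: "0 \<le> F e * bernoulli_kl (qq e) (cond_split e P)" for e
          using elim(2) qq_bounds F_nonneg by (intro mult_nonneg_nonneg bernoulli_kl_nonneg) auto
        have "ennreal (?s P) = (\<Sum>k<l. kl_level P k)"
          unfolding sumI[symmetric] kl_level_def using nn by (simp add: sum_nonneg)
        also have "\<dots> \<le> (\<Sum>l. kl_level P l)" by (rule sum_le_suminf) auto
        also have "\<dots> \<le> ennreal \<epsilon>" using True elim(1) by (simp add: N_def)
        finally have "?s P \<le> \<epsilon>" using \<epsilon> by (simp add: ennreal_le_iff)
        then show ?thesis using True by (simp add: ennreal_leI)
      qed simp
    qed
    also have "\<dots> = (\<integral>\<^sup>+P. (\<Prod>e\<in>?I. ennreal (exp (- (F e * bernoulli_kl (qq e) (cond_split e P))))) \<partial>?\<Phi>)"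
      using fin by (intro nn_integral_cong) (simp add: prod_ennreal sum_negf[symmetric] exp_sum)
    also have "\<dots> = (\<Prod>e\<in>?I. \<integral>\<^sup>+P. ennreal (exp (- (F e * bernoulli_kl (qq e) (cond_split e P)))) \<partial>?\<Phi>)"
    proof (rule P.indep_vars_nn_integral[OF fin])
      have "P.indep_vars (\<lambda>_. borel) cond_split UNIV" using PT_splitting by (simp add: splitting_rvs_def)
      from P.indep_vars_compose2[OF this, of "\<lambda>e v. ennreal (exp (- (F e * bernoulli_kl (qq e) v)))" "\<lambda>_. borel"]
      have "P.indep_vars (\<lambda>_. borel) (\<lambda>e P. ennreal (exp (- (F e * bernoulli_kl (qq e) (cond_split e P))))) UNIV"
        by measurable
      then show "P.indep_vars (\<lambda>_. borel) (\<lambda>e P. ennreal (exp (- (F e * bernoulli_kl (qq e) (cond_split e P))))) ?I"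
        by (rule P.indep_vars_subset) simp
    qed simp
    also have "\<dots> \<le> (\<Prod>e\<in>?I. ennreal (exp (- (F e * (2 * qq e - 1)\<^sup>2 / 32))))"
    proof (rule prod_mono_ennreal)
      fix e
      have "(\<integral>\<^sup>+P. ennreal (exp (- (F e * bernoulli_kl (qq e) (cond_split e P)))) \<partial>?\<Phi>) =
        (\<integral>\<^sup>+v. ennreal (exp (- (F e * bernoulli_kl (qq e) v))) \<partial>split_law e)"
        by (rule splitting_rvs_nn_integral[OF PT_splitting]) measurable
      also have "\<dots> \<le> ennreal (exp (- (F e * (2 * qq e - 1)\<^sup>2 / 32)))"
        unfolding sym by (intro nn_integral_exp_bernoulli_kl b_pos qq_bounds F_nonneg F_le_1)
      finally show "(\<integral>\<^sup>+P. ennreal (exp (- (F e * bernoulli_kl (qq e) (cond_split e P)))) \<partial>?\<Phi>) \<le> \<dots>" .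
    qed
    also have "\<dots> = ennreal (exp (- ((\<Sum>e\<in>?I. F e * (2 * qq e - 1)\<^sup>2) / 32)))"
      using fin by (simp add: prod_ennreal exp_sum[symmetric] sum_negf sum_divide_distrib)
    finally have "exp (- \<epsilon>) * p \<le> exp (- ((\<Sum>e\<in>?I. F e * (2 * qq e - 1)\<^sup>2) / 32))"
      using p0 by (simp add: ennreal_mult[symmetric])
    then have "ln (exp (- \<epsilon>) * p) \<le> ln (exp (- ((\<Sum>e\<in>?I. F e * (2 * qq e - 1)\<^sup>2) / 32)))"
      using p0 by (subst ln_le_cancel_iff) auto
    then show ?thesis using p0 by (simp add: sumI ln_mult)
  qed
  then show ?thesis by blast
qed

end

section \<open>A maximal inequality for Bernoulli frequencies\<close>

text \<open>The argument of \<open>\<phi>\<close> lists \<open>n\<close> independent terms of law \<open>w\<close>, the latest first.\<close>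

primrec iid_mean :: "('d::finite \<Rightarrow> real) \<Rightarrow> nat \<Rightarrow> ('d list \<Rightarrow> real) \<Rightarrow> real" where
  "iid_mean w 0 \<phi> = \<phi> []"
| "iid_mean w (Suc n) \<phi> = (\<Sum>d\<in>UNIV. w d * iid_mean w n (\<lambda>xs. \<phi> (d # xs)))"

lemma iid_mean_add: "iid_mean w n (\<lambda>xs. \<phi> xs + \<psi> xs) = iid_mean w n \<phi> + iid_mean w n \<psi>"
  by (induction n arbitrary: \<phi> \<psi>) (simp_all add: distrib_left sum.distrib)

lemma iid_mean_cmult: "iid_mean w n (\<lambda>xs. r * \<phi> xs) = r * iid_mean w n \<phi>"
  by (induction n arbitrary: \<phi>) (simp_all add: sum_distrib_left mult.left_commute)

lemma iid_mean_sum: "iid_mean w n (\<lambda>xs. \<Sum>i\<in>I. \<phi> i xs) = (\<Sum>i\<in>I. iid_mean w n (\<phi> i))"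
proof (induction I rule: infinite_finite_induct)
  case empty
  then show ?case using iid_mean_cmult[of w n 0 "\<lambda>_. 0"] by simp
next
  case (infinite I)
  then show ?case using iid_mean_cmult[of w n 0 "\<lambda>_. 0"] by simp
qed (simp add: iid_mean_add)

locale iid_weights =
  fixes w :: "'d::finite \<Rightarrow> real"
  assumes w_nonneg: "\<And>d. 0 \<le> w d" and w_sum: "(\<Sum>d\<in>UNIV. w d) = 1"
begin

lemma iid_mean_const: "iid_mean w n (\<lambda>_. r) = r"
  by (induction n) (simp_all add: sum_distrib_right[symmetric] w_sum)

lemma iid_mean_mono: "(\<And>xs. length xs = n \<Longrightarrow> \<phi> xs \<le> \<psi> xs) \<Longrightarrow> iid_mean w n \<phi> \<le> iid_mean w n \<psi>"
  by (induction n arbitrary: \<phi> \<psi>) (auto intro!: sum_mono mult_left_mono w_nonneg)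

end

lemma sum_UNIV_bool_option:
  fixes f :: "bool option \<Rightarrow> real"
  shows "(\<Sum>d\<in>UNIV. f d) = f None + f (Some \<sigma>) + f (Some (\<not> \<sigma>))"
  by (cases \<sigma>) (simp_all add: UNIV_option_conv UNIV_bool)

text \<open>
  An observation is \<open>None\<close> outside the node under consideration and \<open>Some \<sigma>\<close> in one of its two children.
  \<open>succ_dev\<close> is the centred number of observations in the child \<open>\<sigma>\<close> of conditional probability \<open>q\<close>, and
  \<open>succ_mart\<close> is the martingale with the predictable weights \<open>1 / (a + succ_count)\<close>.
\<close>

primrec succ_count :: "bool \<Rightarrow> bool option list \<Rightarrow> real" where
  "succ_count \<sigma> [] = 0"
| "succ_count \<sigma> (d # xs) = succ_count \<sigma> xs + of_bool (d = Some \<sigma>)"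

definition succ_incr :: "bool \<Rightarrow> real \<Rightarrow> bool option \<Rightarrow> real" where
  "succ_incr \<sigma> q d = (if d = None then 0 else of_bool (d = Some \<sigma>) - q)"

primrec succ_dev :: "bool \<Rightarrow> real \<Rightarrow> bool option list \<Rightarrow> real" where
  "succ_dev \<sigma> q [] = 0"
| "succ_dev \<sigma> q (d # xs) = succ_dev \<sigma> q xs + succ_incr \<sigma> q d"

primrec succ_mart :: "bool \<Rightarrow> real \<Rightarrow> real \<Rightarrow> bool option list \<Rightarrow> real" where
  "succ_mart \<sigma> q a [] = 0"
| "succ_mart \<sigma> q a (d # xs) = succ_mart \<sigma> q a xs + succ_incr \<sigma> q d / (a + succ_count \<sigma> xs)"

primrec succ_mart_max :: "bool \<Rightarrow> real \<Rightarrow> real \<Rightarrow> bool option list \<Rightarrow> real" where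
  "succ_mart_max \<sigma> q a [] = 0"
| "succ_mart_max \<sigma> q a (d # xs) = max (succ_mart_max \<sigma> q a xs) \<bar>succ_mart \<sigma> q a (d # xs)\<bar>"

lemma succ_count_nonneg: "0 \<le> succ_count \<sigma> xs"
  by (induction xs) auto

lemma succ_dev_eq: "succ_dev \<sigma> q xs = succ_count \<sigma> xs - q * (succ_count \<sigma> xs + succ_count (\<not> \<sigma>) xs)"
proof (induction xs)
  case (Cons d xs)
  then show ?case by (cases d) (auto simp: succ_incr_def algebra_simps)
qed simp

lemma succ_mart_max_ge: "0 \<le> succ_mart_max \<sigma> q a xs" "\<bar>succ_mart \<sigma> q a xs\<bar> \<le> succ_mart_max \<sigma> q a xs"
  by (induction xs) auto

text \<open>Summation by parts, the weights \<open>a + succ_count\<close> being nondecreasing.\<close>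

lemma succ_dev_le_max:
  assumes a: "0 < a"
  shows "\<bar>succ_dev \<sigma> q xs\<bar> \<le> 2 * (a + succ_count \<sigma> xs) * succ_mart_max \<sigma> q a xs"
proof -
  let ?m = "succ_mart_max \<sigma> q a" and ?T = "succ_mart \<sigma> q a" and ?N = "succ_count \<sigma>"
  \<comment> \<open>The martingale times its current weight differs from the deviation by the sum of
    its values at the successes, each bounded by the running maximum.\<close>
  have *: "\<bar>(a + ?N xs) * ?T xs - succ_dev \<sigma> q xs\<bar> \<le> ?N xs * ?m xs"
  proof (induction xs)
    case (Cons d xs)
    define c where "c = a + ?N xs"
    define \<delta> where "\<delta> = (of_bool (d = Some \<sigma>) :: real)"
    have c: "c > 0" using a succ_count_nonneg[of \<sigma> xs] by (simp add: c_def)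
    have \<delta>: "\<delta> \<ge> 0" by (simp add: \<delta>_def)
    have T: "?T (d # xs) = ?T xs + succ_incr \<sigma> q d / c" by (simp add: c_def)
    have "(a + ?N (d # xs)) * ?T (d # xs) - succ_dev \<sigma> q (d # xs) =
        (c * ?T xs - succ_dev \<sigma> q xs) + \<delta> * ?T (d # xs)"
    proof -
      have "c * (succ_incr \<sigma> q d / c) = succ_incr \<sigma> q d" using c by simp
      then have "c * ?T (d # xs) = c * ?T xs + succ_incr \<sigma> q d" unfolding T by (simp only: distrib_left)
      moreover have "a + ?N (d # xs) = c + \<delta>" by (simp add: c_def \<delta>_def)
      ultimately show ?thesis by (simp only: distrib_right) simp
    qed
    moreover have "\<bar>\<delta> * ?T (d # xs)\<bar> \<le> \<delta> * ?m (d # xs)"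
      using \<delta> succ_mart_max_ge(2)[where xs="d # xs"] by (simp only: abs_mult) (simp add: mult_left_mono)
    moreover have "\<bar>c * ?T xs - succ_dev \<sigma> q xs\<bar> \<le> ?N xs * ?m (d # xs)"
      using succ_count_nonneg[of \<sigma> xs] unfolding c_def
      by (intro order_trans[OF Cons] mult_left_mono) auto
    moreover have "?N (d # xs) * ?m (d # xs) = ?N xs * ?m (d # xs) + \<delta> * ?m (d # xs)"
      by (simp only: succ_count.simps \<delta>_def distrib_right)
    ultimately show ?case by linarith
  qed simp
  have "\<bar>(a + ?N xs) * ?T xs\<bar> \<le> (a + ?N xs) * ?m xs"
    using a succ_count_nonneg[of \<sigma> xs] succ_mart_max_ge(2)[of \<sigma> q a xs]
    by (auto simp: abs_mult intro!: mult_left_mono)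
  moreover have "?N xs * ?m xs \<le> (a + ?N xs) * ?m xs"
    using a succ_mart_max_ge(1)[of \<sigma> q a xs] by (intro mult_right_mono) auto
  ultimately show ?thesis using * by linarith
qed

text \<open>
  Doob's quadratic maximal inequality in pathwise form: \<open>doob_transform\<close> is a martingale transform of
  \<open>succ_mart\<close>, so that its mean is zero.
\<close>

primrec doob_transform :: "bool \<Rightarrow> real \<Rightarrow> real \<Rightarrow> bool option list \<Rightarrow> real" where
  "doob_transform \<sigma> q a [] = 0"
| "doob_transform \<sigma> q a (d # xs) = doob_transform \<sigma> q a xs +
     succ_mart_max \<sigma> q a xs * sgn (succ_mart \<sigma> q a xs) / (a + succ_count \<sigma> xs) * succ_incr \<sigma> q d"

lemma doob_pathwise: "(succ_mart_max \<sigma> q a xs)\<^sup>2 \<le> 4 * (succ_mart \<sigma> q a xs)\<^sup>2 - 4 * doob_transform \<sigma> q a xs"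
proof -
  let ?m = "succ_mart_max \<sigma> q a" and ?T = "succ_mart \<sigma> q a"
  \<comment> \<open>The increment \<open>sgn T * (T' - T)\<close> is at most that of
    \<open>\<bar>T\<bar>\<close>, and the term \<open>m\<^sup>2 / 2\<close> pays for the growth of
    the maximum.\<close>
  have *: "doob_transform \<sigma> q a xs \<le> ?m xs * \<bar>?T xs\<bar> - (?m xs)\<^sup>2 / 2"
  proof (induction xs)
    case (Cons d xs)
    define T' where "T' = ?T (d # xs)"
    have m0: "0 \<le> ?m xs" by (rule succ_mart_max_ge)
    have "doob_transform \<sigma> q a (d # xs) = doob_transform \<sigma> q a xs + ?m xs * (sgn (?T xs) * (T' - ?T xs))"
      by (simp add: T'_def)
    also have "sgn (?T xs) * (T' - ?T xs) \<le> \<bar>T'\<bar> - \<bar>?T xs\<bar>"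
      by (auto simp: sgn_if abs_if)
    finally have "doob_transform \<sigma> q a (d # xs) \<le> doob_transform \<sigma> q a xs + ?m xs * (\<bar>T'\<bar> - \<bar>?T xs\<bar>)"
      using m0 by (simp add: mult_left_mono)
    with Cons have "doob_transform \<sigma> q a (d # xs) \<le> ?m xs * \<bar>T'\<bar> - (?m xs)\<^sup>2 / 2"
      by (simp add: right_diff_distrib)
    also have "\<dots> \<le> ?m (d # xs) * \<bar>T'\<bar> - (?m (d # xs))\<^sup>2 / 2"
    proof (cases "?m xs \<le> \<bar>T'\<bar>")
      case True
      then have "?m (d # xs) = \<bar>T'\<bar>" by (simp add: T'_def)
      moreover have "?m xs * \<bar>T'\<bar> \<le> ((?m xs)\<^sup>2 + \<bar>T'\<bar>\<^sup>2) / 2"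
        using sum_squares_bound[of "?m xs" "\<bar>T'\<bar>"] by simp
      ultimately show ?thesis by (simp add: power2_eq_square add_divide_distrib)
    next
      case False
      then have "?m (d # xs) = ?m xs" by (simp add: T'_def max_def)
      then show ?thesis by simp
    qed
    finally show ?case by (simp only: T'_def)
  qed simp
  \<comment> \<open>Completing the square absorbs one of the two copies of \<open>m\<^sup>2\<close>
    in four times the inequality above, which leaves the classical constant 4.\<close>
  have "0 \<le> (2 * \<bar>?T xs\<bar> - ?m xs)\<^sup>2" by simp
  then have "4 * (?m xs * \<bar>?T xs\<bar>) \<le> 4 * (?T xs)\<^sup>2 + (?m xs)\<^sup>2"
    by (simp add: power2_diff power_mult_distrib algebra_simps)
  with * show ?thesis by simp
qed

text \<open>Here \<open>p\<close> is the probability of the node and \<open>q\<close> the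
  conditional probability of the child \<sigma>. The child is a parameter so that both children are
  covered, the other one with \<open>1 - q\<close> in place of \<open>q\<close>.\<close>

locale bernoulli_split = iid_weights w
  for w :: "bool option \<Rightarrow> real" +
  fixes \<sigma> :: bool and q p a :: real
  assumes q: "0 \<le> q" "q \<le> 1" and a: "0 < a"
    and w_succ: "w (Some \<sigma>) = p * q" and w_fail: "w (Some (\<not> \<sigma>)) = p * (1 - q)"
begin

lemma mean_incr: "(\<Sum>d\<in>UNIV. w d * (r * succ_incr \<sigma> q d)) = 0"
  by (subst sum_UNIV_bool_option[of _ \<sigma>]) (simp add: succ_incr_def w_succ w_fail algebra_simps)

lemma mean_incr_sq: "(\<Sum>d\<in>UNIV. w d * (r * succ_incr \<sigma> q d)\<^sup>2) = r\<^sup>2 * (w (Some \<sigma>) * (1 - q))"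
  by (subst sum_UNIV_bool_option[of _ \<sigma>])
    (simp add: succ_incr_def w_succ w_fail power2_eq_square algebra_simps)

lemma mean_doob_transform: "iid_mean w n (doob_transform \<sigma> q a) = 0"
proof (induction n)
  case (Suc n)
  let ?r = "\<lambda>xs. succ_mart_max \<sigma> q a xs * sgn (succ_mart \<sigma> q a xs) / (a + succ_count \<sigma> xs)"
  have eq: "iid_mean w (Suc n) (doob_transform \<sigma> q a) =
      (\<Sum>d\<in>UNIV. w d * iid_mean w n (doob_transform \<sigma> q a)) + iid_mean w n (\<lambda>xs. \<Sum>d\<in>UNIV. w d * (?r xs * succ_incr \<sigma> q d))"
    by (simp only: iid_mean.simps doob_transform.simps iid_mean_add distrib_left sum.distrib iid_mean_sum iid_mean_cmult)
  show ?case
    unfolding eq by (simp only: mean_incr Suc.IH iid_mean_const) simp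
qed simp

text \<open>Each step adds the mean of \<open>w (Some \<sigma>) * (1 - q) / (a + N)\<^sup>2\<close>,
  where \<open>N\<close> is the current count. This is at most \<open>1 - q\<close> times the
  expected increase of the bounded potential \<open>f\<close>, so the sum telescopes to a bound free
  of \<open>n\<close> and of the weights.\<close>

lemma mean_succ_mart_sq: "iid_mean w n (\<lambda>xs. (succ_mart \<sigma> q a xs)\<^sup>2) \<le> 1 / a + 1 / a\<^sup>2"
proof -
  \<comment> \<open>The decrements of \<open>1 / (a + k)\<close> are
    \<open>1 / ((a + k) * (a + k + 1))\<close>; the factor \<open>(a + 1) / a\<close> raises them to
    at least \<open>1 / (a + k)\<^sup>2\<close>, while \<open>f\<close> stays below
    \<open>(a + 1) / a\<^sup>2\<close>.\<close>
  define f where "f k = (a + 1) / a * (1 / a - 1 / (a + k))" for k :: real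
  have step: "1 / (a + k)\<^sup>2 \<le> f (k + 1) - f k" if k: "0 \<le> k" for k
  proof -
    have pos: "0 < a + k" "0 < a + k + 1" using a k by auto
    have "f (k + 1) - f k = (a + 1) / a * (1 / (a + k) - 1 / (a + (k + 1)))"
      unfolding f_def by (simp only: right_diff_distrib)
    also have "1 / (a + k) - 1 / (a + (k + 1)) = 1 / ((a + k) * (a + k + 1))"
      using pos by (simp add: field_simps)
    finally have eq: "f (k + 1) - f k = (a + 1) / a * (1 / ((a + k) * (a + k + 1)))" .
    have "(a + k + 1) / (a + k) \<le> (a + 1) / a" using a k by (simp add: field_simps)
    then have "(a + k + 1) / (a + k) * (1 / ((a + k) * (a + k + 1))) \<le> (a + 1) / a * (1 / ((a + k) * (a + k + 1)))"
      using pos by (intro mult_right_mono) auto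
    moreover have "(a + k + 1) / (a + k) * (1 / ((a + k) * (a + k + 1))) = 1 / (a + k)\<^sup>2"
      using pos by (simp add: power2_eq_square)
    ultimately show ?thesis using eq by simp
  qed
  have "iid_mean w n (\<lambda>xs. (succ_mart \<sigma> q a xs)\<^sup>2) \<le> (1 - q) * iid_mean w n (\<lambda>xs. f (succ_count \<sigma> xs))"
  proof (induction n)
    case 0
    show ?case by (simp add: f_def)
  next
    case (Suc n)
    let ?T = "succ_mart \<sigma> q a" and ?c = "\<lambda>xs. 1 / (a + succ_count \<sigma> xs)"
    have "(\<Sum>d\<in>UNIV. w d * (?T (d # xs))\<^sup>2) = (?T xs)\<^sup>2 + (1 - q) * (w (Some \<sigma>) * (?c xs)\<^sup>2)" for xs
    proof -
      have "(?T (d # xs))\<^sup>2 = (?T xs)\<^sup>2 + 2 * ?T xs * ?c xs * succ_incr \<sigma> q d + (?c xs * succ_incr \<sigma> q d)\<^sup>2" for d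
        by (simp add: power2_sum)
      then have "(\<Sum>d\<in>UNIV. w d * (?T (d # xs))\<^sup>2) = (\<Sum>d\<in>UNIV. w d * (?T xs)\<^sup>2) +
        (\<Sum>d\<in>UNIV. w d * ((2 * ?T xs * ?c xs) * succ_incr \<sigma> q d)) + (\<Sum>d\<in>UNIV. w d * (?c xs * succ_incr \<sigma> q d)\<^sup>2)"
        by (simp only: distrib_left sum.distrib)
      then show ?thesis
        by (simp only: mean_incr mean_incr_sq sum_distrib_right[symmetric] w_sum) (simp add: mult_ac)
    qed
    then have "iid_mean w (Suc n) (\<lambda>xs. (?T xs)\<^sup>2) =
        iid_mean w n (\<lambda>xs. (?T xs)\<^sup>2) + (1 - q) * iid_mean w n (\<lambda>xs. w (Some \<sigma>) * (?c xs)\<^sup>2)"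
      by (simp only: iid_mean.simps iid_mean_cmult[symmetric] iid_mean_sum[symmetric] iid_mean_add[symmetric])
    also have "\<dots> \<le> (1 - q) * iid_mean w n (\<lambda>xs. f (succ_count \<sigma> xs)) +
        (1 - q) * iid_mean w n (\<lambda>xs. w (Some \<sigma>) * (f (succ_count \<sigma> xs + 1) - f (succ_count \<sigma> xs)))"
      using q step[OF succ_count_nonneg] w_nonneg
      by (intro add_mono Suc.IH mult_left_mono iid_mean_mono) (auto simp: power_one_over)
    also have "\<dots> = (1 - q) * iid_mean w (Suc n) (\<lambda>xs. f (succ_count \<sigma> xs))"
    proof -
      have w_None: "w None = 1 - w (Some \<sigma>) - w (Some (\<not> \<sigma>))"
        using w_sum by (simp add: sum_UNIV_bool_option[of _ \<sigma>])
      have "(\<Sum>d\<in>UNIV. w d * f (succ_count \<sigma> (d # xs))) =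
        f (succ_count \<sigma> xs) + w (Some \<sigma>) * (f (succ_count \<sigma> xs + 1) - f (succ_count \<sigma> xs))" for xs
        by (simp add: sum_UNIV_bool_option[of _ \<sigma>] w_None algebra_simps)
      then show ?thesis
        by (simp only: iid_mean.simps iid_mean_cmult[symmetric] iid_mean_sum[symmetric] iid_mean_add[symmetric] distrib_left[symmetric])
    qed
    finally show ?case .
  qed
  also have "\<dots> \<le> 1 * (1 / a + 1 / a\<^sup>2)"
  proof (rule mult_mono)
    have "f k \<le> 1 / a + 1 / a\<^sup>2" if "0 \<le> k" for k
    proof -
      have "f k \<le> (a + 1) / a * (1 / a)" unfolding f_def using a that by (intro mult_left_mono) auto
      also have "\<dots> = 1 / a + 1 / a\<^sup>2" using a by (simp add: field_simps power2_eq_square)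
      finally show ?thesis .
    qed
    then have "iid_mean w n (\<lambda>xs. f (succ_count \<sigma> xs)) \<le> iid_mean w n (\<lambda>_. 1 / a + 1 / a\<^sup>2)"
      by (intro iid_mean_mono succ_count_nonneg) (auto simp: succ_count_nonneg)
    then show "iid_mean w n (\<lambda>xs. f (succ_count \<sigma> xs)) \<le> 1 / a + 1 / a\<^sup>2" by (simp only: iid_mean_const)
    have "0 \<le> f k" if "0 \<le> k" for k
      unfolding f_def using a that by (intro mult_nonneg_nonneg) (auto intro!: divide_left_mono)
    then have "iid_mean w n (\<lambda>_. 0) \<le> iid_mean w n (\<lambda>xs. f (succ_count \<sigma> xs))"
      by (intro iid_mean_mono) (auto simp: succ_count_nonneg)
    then show "0 \<le> iid_mean w n (\<lambda>xs. f (succ_count \<sigma> xs))" by (simp only: iid_mean_const)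
  qed (use q in auto)
  finally show ?thesis by simp
qed

lemma mean_succ_mart_max_sq: "iid_mean w n (\<lambda>xs. (succ_mart_max \<sigma> q a xs)\<^sup>2) \<le> 4 * (1 / a + 1 / a\<^sup>2)"
proof -
  have "iid_mean w n (\<lambda>xs. (succ_mart_max \<sigma> q a xs)\<^sup>2) \<le>
      iid_mean w n (\<lambda>xs. 4 * (succ_mart \<sigma> q a xs)\<^sup>2 + (- 4) * doob_transform \<sigma> q a xs)"
    by (rule iid_mean_mono) (use doob_pathwise in simp)
  also have "\<dots> = 4 * iid_mean w n (\<lambda>xs. (succ_mart \<sigma> q a xs)\<^sup>2)"
    by (simp only: iid_mean_add iid_mean_cmult mean_doob_transform mult_zero_right add_0_right)
  finally show ?thesis using mean_succ_mart_sq[of n] by simp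
qed

end

section \<open>Binomial moments\<close>

locale observation_weights = iid_weights w for w :: "bool option \<Rightarrow> real"
begin

lemma mean_Suc_succ_count:
  "iid_mean w (Suc n) (\<lambda>xs. \<phi> (succ_count \<sigma> xs)) =
    w (Some \<sigma>) * iid_mean w n (\<lambda>xs. \<phi> (succ_count \<sigma> xs + 1)) + (1 - w (Some \<sigma>)) * iid_mean w n (\<lambda>xs. \<phi> (succ_count \<sigma> xs))"
proof -
  have eq: "1 - w (Some \<sigma>) = w None + w (Some (\<not> \<sigma>))"
    using w_sum by (simp add: sum_UNIV_bool_option[of _ \<sigma>])
  show ?thesis unfolding eq by (simp add: sum_UNIV_bool_option[of _ \<sigma>] distrib_right)
qed

lemma mean_succ_count: "iid_mean w n (\<lambda>xs. succ_count \<sigma> xs) = n * w (Some \<sigma>)"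
proof (induction n)
  case (Suc n)
  show ?case
    using mean_Suc_succ_count[of n "\<lambda>x. x" \<sigma>] by (simp add: iid_mean_add iid_mean_const Suc.IH algebra_simps)
qed simp

text \<open>Size biasing of the binomial law: \<open>k\<close> times the probability of
  \<open>k\<close> successes in \<open>n + 1\<close> trials is \<open>(n + 1) * p\<close> times that
  of \<open>k - 1\<close> in \<open>n\<close> trials. It yields second and inverse moments without
  binomial coefficients.\<close>

lemma mean_succ_count_size_bias:
  "iid_mean w (Suc n) (\<lambda>xs. succ_count \<sigma> xs * \<phi> (succ_count \<sigma> xs)) =
    (real n + 1) * w (Some \<sigma>) * iid_mean w n (\<lambda>xs. \<phi> (succ_count \<sigma> xs + 1))"
proof (induction n arbitrary: \<phi>)
  case 0
  show ?case by (simp add: sum_UNIV_bool_option[of _ \<sigma>])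
next
  case (Suc n)
  let ?N = "succ_count \<sigma>" and ?p = "w (Some \<sigma>)"
  have "iid_mean w (Suc (Suc n)) (\<lambda>xs. ?N xs * \<phi> (?N xs)) =
      ?p * (iid_mean w (Suc n) (\<lambda>xs. ?N xs * \<phi> (?N xs + 1)) + iid_mean w (Suc n) (\<lambda>xs. \<phi> (?N xs + 1)))
      + (1 - ?p) * iid_mean w (Suc n) (\<lambda>xs. ?N xs * \<phi> (?N xs))"
    by (subst mean_Suc_succ_count[of "Suc n" "\<lambda>k. k * \<phi> k"]) (simp only: distrib_right iid_mean_add mult_1)
  also have "iid_mean w (Suc n) (\<lambda>xs. ?N xs * \<phi> (?N xs + 1)) = (real n + 1) * ?p * iid_mean w n (\<lambda>xs. \<phi> (?N xs + 1 + 1))"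
    by (rule Suc.IH)
  also have "iid_mean w (Suc n) (\<lambda>xs. ?N xs * \<phi> (?N xs)) = (real n + 1) * ?p * iid_mean w n (\<lambda>xs. \<phi> (?N xs + 1))"
    by (rule Suc.IH)
  also have "?p * ((real n + 1) * ?p * iid_mean w n (\<lambda>xs. \<phi> (?N xs + 1 + 1)) + iid_mean w (Suc n) (\<lambda>xs. \<phi> (?N xs + 1))) +
      (1 - ?p) * ((real n + 1) * ?p * iid_mean w n (\<lambda>xs. \<phi> (?N xs + 1))) =
      ?p * iid_mean w (Suc n) (\<lambda>xs. \<phi> (?N xs + 1)) + (real n + 1) * ?p * iid_mean w (Suc n) (\<lambda>xs. \<phi> (?N xs + 1))"
    by (subst (3) mean_Suc_succ_count[of n "\<lambda>k. \<phi> (k + 1)"]) (simp only: distrib_left mult_ac ac_simps)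
  finally show ?case by (simp add: algebra_simps)
qed

text \<open>Size biasing of the reciprocal: \<open>k * (1 / k)\<close> is 1 except at
  \<open>k = 0\<close>, where division by zero makes it 0, so its mean is at most 1.\<close>

lemma mean_inverse_succ_count:
  assumes "0 < w (Some \<sigma>)"
  shows "iid_mean w n (\<lambda>xs. 1 / (succ_count \<sigma> xs + 1)) \<le> 1 / ((real n + 1) * w (Some \<sigma>))"
proof -
  have "(real n + 1) * w (Some \<sigma>) * iid_mean w n (\<lambda>xs. 1 / (succ_count \<sigma> xs + 1)) =
      iid_mean w (Suc n) (\<lambda>xs. succ_count \<sigma> xs * (1 / succ_count \<sigma> xs))"
    by (rule mean_succ_count_size_bias[symmetric])
  also have "\<dots> \<le> iid_mean w (Suc n) (\<lambda>_. 1)"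
    by (rule iid_mean_mono) simp
  also have "\<dots> = 1" by (rule iid_mean_const)
  finally show ?thesis using assms by (subst pos_le_divide_eq) (auto simp: mult_ac)
qed

lemma mean_succ_count_variance:
  "iid_mean w n (\<lambda>xs. (succ_count \<sigma> xs - n * w (Some \<sigma>))\<^sup>2) \<le> n * w (Some \<sigma>)"
proof -
  let ?N = "succ_count \<sigma>" and ?p = "w (Some \<sigma>)"
  have sq: "iid_mean w n (\<lambda>xs. ?N xs * ?N xs) = real n * ?p + real n * (real n - 1) * ?p\<^sup>2"
  proof (cases n)
    case (Suc k)
    have "iid_mean w k (\<lambda>xs. ?N xs + 1) = k * ?p + 1" by (simp add: iid_mean_add iid_mean_const mean_succ_count)
    then show ?thesis using mean_succ_count_size_bias[of k \<sigma> "\<lambda>x. x"]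
      by (simp add: Suc power2_eq_square algebra_simps)
  qed simp
  have "(?N xs - n * ?p)\<^sup>2 = ?N xs * ?N xs + ((- 2 * n * ?p) * ?N xs + (n * ?p)\<^sup>2)" for xs
    by (simp add: power2_eq_square algebra_simps)
  then have "iid_mean w n (\<lambda>xs. (?N xs - n * ?p)\<^sup>2) = real n * ?p - real n * ?p\<^sup>2"
    by (simp only: iid_mean_add iid_mean_cmult iid_mean_const mean_succ_count sq)
      (simp add: power2_eq_square algebra_simps)
  then show ?thesis by simp
qed

text \<open>The count is replaced by its mean at the cost of a factor 2: if the mean is at most
  \<open>a\<close>, the count is dropped; otherwise \<open>a\<close> is lowered to 1 and the inverse
  moment applies.\<close>

lemma mean_inverse_le:
  assumes a: "1 \<le> a" and p: "0 \<le> w (Some \<sigma>)"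
  shows "iid_mean w n (\<lambda>xs. 1 / (a + succ_count \<sigma> xs)) \<le> 2 / (a + n * w (Some \<sigma>))"
proof -
  let ?N = "succ_count \<sigma>" and ?\<mu> = "n * w (Some \<sigma>)"
  have \<mu>: "0 \<le> ?\<mu>" using p by simp
  have pos: "0 < ?N xs + 1" "0 < a + ?N xs" for xs
    using succ_count_nonneg[of \<sigma> xs] a by linarith+
  show ?thesis
  proof (cases "?\<mu> \<le> a")
    case True
    have "iid_mean w n (\<lambda>xs. 1 / (a + ?N xs)) \<le> iid_mean w n (\<lambda>_. 1 / a)"
      using a by (intro iid_mean_mono divide_left_mono) (auto simp: succ_count_nonneg intro!: mult_pos_pos add_pos_nonneg)
    also have "\<dots> = 1 / a" by (rule iid_mean_const)
    also have "\<dots> \<le> 2 / (a + ?\<mu>)" using a True \<mu> by (simp add: field_simps)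
    finally show ?thesis .
  next
    case False
    then have "?\<mu> > 0" using a by linarith
    then have n: "n > 0" "w (Some \<sigma>) > 0" using p by (auto simp: zero_less_mult_iff)
    have "iid_mean w n (\<lambda>xs. 1 / (a + ?N xs)) \<le> iid_mean w n (\<lambda>xs. 1 / (?N xs + 1))"
      using a pos by (intro iid_mean_mono divide_left_mono mult_pos_pos) auto
    also have "\<dots> \<le> 1 / ((real n + 1) * w (Some \<sigma>))" by (rule mean_inverse_succ_count[OF n(2)])
    also have "\<dots> \<le> 1 / ?\<mu>" using n by (intro divide_left_mono) auto
    also have "\<dots> \<le> 2 / (a + ?\<mu>)" using False a n by (simp add: field_simps)
    finally show ?thesis .
  qed
qed

text \<open>The weight compensates the variance, which is at most the mean of the count. After
  lowering \<open>a\<close> to 1, the weight is dropped for means up to 1; otherwise polynomial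
  division by \<open>N + 1\<close> leaves the first moment and the inverse moment.\<close>

lemma mean_weighted_variance_le:
  assumes a: "1 \<le> a" and p: "0 \<le> w (Some \<sigma>)"
  shows "iid_mean w n (\<lambda>xs. (succ_count \<sigma> xs - n * w (Some \<sigma>))\<^sup>2 / (a + succ_count \<sigma> xs)) \<le> 2"
proof -
  let ?N = "succ_count \<sigma>"
  define \<mu> where "\<mu> = n * w (Some \<sigma>)"
  have pos: "0 < ?N xs + 1" "0 < a + ?N xs" for xs
    using succ_count_nonneg[of \<sigma> xs] a by linarith+
  have le1: "iid_mean w n (\<lambda>xs. (?N xs - \<mu>)\<^sup>2 / (a + ?N xs)) \<le> iid_mean w n (\<lambda>xs. (?N xs - \<mu>)\<^sup>2 / (?N xs + 1))"
    using a pos by (intro iid_mean_mono divide_left_mono mult_pos_pos) auto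
  also have "\<dots> \<le> 2"
  proof (cases "\<mu> \<le> 1")
    case True
    have "iid_mean w n (\<lambda>xs. (?N xs - \<mu>)\<^sup>2 / (?N xs + 1)) \<le> iid_mean w n (\<lambda>xs. (?N xs - \<mu>)\<^sup>2)"
    proof (rule iid_mean_mono)
      fix xs
      show "(?N xs - \<mu>)\<^sup>2 / (?N xs + 1) \<le> (?N xs - \<mu>)\<^sup>2"
        using divide_left_mono[of 1 "?N xs + 1" "(?N xs - \<mu>)\<^sup>2"] succ_count_nonneg[of \<sigma> xs] by simp
    qed
    also have "\<dots> \<le> \<mu>" using mean_succ_count_variance[of n \<sigma>] by (simp add: \<mu>_def)
    finally show ?thesis using True by simp
  next
    case False
    then have "\<mu> > 0" by linarith
    then have n: "w (Some \<sigma>) > 0" "n > 0" using p by (auto simp: \<mu>_def zero_less_mult_iff)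
    have eq: "(?N xs - \<mu>)\<^sup>2 / (?N xs + 1) = ?N xs + ((- 2 * \<mu> - 1) + (\<mu> + 1)\<^sup>2 * (1 / (?N xs + 1)))" for xs
    proof -
      have nz: "?N xs + 1 > 0" using succ_count_nonneg[of \<sigma> xs] by simp
      have "(?N xs - \<mu>)\<^sup>2 = (?N xs + (- 2 * \<mu> - 1)) * (?N xs + 1) + (\<mu> + 1)\<^sup>2"
        by (simp add: power2_eq_square algebra_simps)
      then show ?thesis using nz by (simp add: add_divide_distrib)
    qed
    have "iid_mean w n (\<lambda>xs. (?N xs - \<mu>)\<^sup>2 / (?N xs + 1)) = \<mu> + ((- 2 * \<mu> - 1) + (\<mu> + 1)\<^sup>2 * iid_mean w n (\<lambda>xs. 1 / (?N xs + 1)))"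
      unfolding eq by (simp only: iid_mean_add iid_mean_cmult iid_mean_const mean_succ_count) (simp add: \<mu>_def)
    also have "\<dots> \<le> \<mu> + ((- 2 * \<mu> - 1) + (\<mu> + 1)\<^sup>2 * (1 / \<mu>))"
    proof (intro add_left_mono mult_left_mono)
      have "iid_mean w n (\<lambda>xs. 1 / (?N xs + 1)) \<le> 1 / ((real n + 1) * w (Some \<sigma>))" by (rule mean_inverse_succ_count[OF n(1)])
      also have "\<dots> \<le> 1 / \<mu>" unfolding \<mu>_def using n by (intro divide_left_mono) auto
      finally show "iid_mean w n (\<lambda>xs. 1 / (?N xs + 1)) \<le> 1 / \<mu>" .
    qed simp
    also have "\<dots> = 1 + 1 / \<mu>" using False by (simp add: field_simps power2_eq_square)
    also have "\<dots> \<le> 2" using False by simp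
    finally show ?thesis .
  qed
  finally show ?thesis by (simp only: \<mu>_def)
qed

end

section \<open>Independent observations\<close>

context prob_space
begin

definition history :: "(nat \<Rightarrow> 'a \<Rightarrow> 'd) \<Rightarrow> nat \<Rightarrow> 'a \<Rightarrow> 'd list" where
  "history D n \<omega> = map (\<lambda>i. D i \<omega>) (rev [0..<n])"

lemma history_simps [simp]: "history D 0 \<omega> = []" "history D (Suc n) \<omega> = D n \<omega> # history D n \<omega>"
  by (simp_all add: history_def)

lemma length_history [simp]: "length (history D n \<omega>) = n"
  by (simp add: history_def)

lemma PiM_count_space_finite:
  fixes \<phi> :: "(nat \<Rightarrow> 'd::finite) \<Rightarrow> 'b"
  assumes "finite I" "\<And>x. \<phi> x \<in> space N"
  shows "\<phi> \<in> measurable (PiM I (\<lambda>_. count_space (UNIV :: 'd set))) N"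
proof -
  have "PiM I (\<lambda>_. count_space (UNIV :: 'd set)) = count_space (PiE I (\<lambda>_. UNIV))"
    using assms by (intro count_space_PiM_finite) (auto simp: countable_finite)
  then show ?thesis using assms by simp
qed

lemma history_measurable:
  fixes D :: "nat \<Rightarrow> 'a \<Rightarrow> 'd::finite"
  assumes D: "\<And>i. D i \<in> measurable M (count_space UNIV)"
  shows "history D n \<in> measurable M (count_space UNIV)"
proof -
  have "(\<lambda>\<omega>. (\<lambda>f. map f (rev [0..<n])) (\<lambda>i\<in>{..<n}. D i \<omega>)) \<in> measurable M (count_space UNIV)"
    by (rule measurable_compose[OF measurable_restrict[OF D] PiM_count_space_finite]) auto
  moreover have "(\<lambda>f. map f (rev [0..<n])) (\<lambda>i\<in>{..<n}. D i \<omega>) = history D n \<omega>" for \<omega>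
    by (auto simp: history_def)
  ultimately show ?thesis by simp
qed

lemma history_integrable:
  fixes D :: "nat \<Rightarrow> 'a \<Rightarrow> 'd::finite" and \<phi> :: "'d list \<Rightarrow> real"
  assumes D: "\<And>i. D i \<in> measurable M (count_space UNIV)"
  shows "integrable M (\<lambda>\<omega>. \<phi> (history D n \<omega>))"
proof (rule integrable_const_bound)
  have fin: "finite {xs :: 'd list. length xs = n}" using finite_lists_length_eq[of "UNIV :: 'd set" n] by simp
  show "AE \<omega> in M. norm (\<phi> (history D n \<omega>)) \<le> (\<Sum>xs\<in>{xs. length xs = n}. \<bar>\<phi> xs\<bar>)"
    by (intro AE_I2) (auto intro!: member_le_sum[of _ _ "\<lambda>xs. \<bar>\<phi> xs\<bar>"] fin)
  show "(\<lambda>\<omega>. \<phi> (history D n \<omega>)) \<in> borel_measurable M"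
    by (rule measurable_compose[OF history_measurable[OF D]]) simp
qed

text \<open>The newest observation is independent of the earlier ones, so splitting by its value
  reproduces the recursion of \<open>iid_mean\<close>. Moment bounds proved on lists are thus
  transferred to the sample.\<close>

lemma expectation_history:
  fixes D :: "nat \<Rightarrow> 'a \<Rightarrow> 'd::finite" and \<phi> :: "'d list \<Rightarrow> real"
  assumes ind: "indep_vars (\<lambda>_. count_space UNIV) D UNIV"
    and law: "\<And>i d. prob {\<omega> \<in> space M. D i \<omega> = d} = w d"
  shows "expectation (\<lambda>\<omega>. \<phi> (history D n \<omega>)) = iid_mean w n \<phi>"
proof (induction n arbitrary: \<phi>)
  case 0
  show ?case by (simp add: prob_space)
next
  case (Suc n)
  have D: "D i \<in> measurable M (count_space UNIV)" for i using ind by (auto simp: indep_vars_def2)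
  have "expectation (\<lambda>\<omega>. \<phi> (history D (Suc n) \<omega>)) =
    expectation (\<lambda>\<omega>. \<Sum>d\<in>UNIV. \<phi> (d # history D n \<omega>) * of_bool (D n \<omega> = d))"
  proof (rule Bochner_Integration.integral_cong)
    fix \<omega>
    have "(\<Sum>d\<in>UNIV. \<phi> (d # history D n \<omega>) * of_bool (D n \<omega> = d)) = (\<Sum>d\<in>UNIV. if d = D n \<omega> then \<phi> (d # history D n \<omega>) else 0)"
      by (intro sum.cong) auto
    then show "\<phi> (history D (Suc n) \<omega>) = (\<Sum>d\<in>UNIV. \<phi> (d # history D n \<omega>) * of_bool (D n \<omega> = d))"
      by (simp add: sum.delta)
  qed simp
  also have "\<dots> = (\<Sum>d\<in>UNIV. expectation (\<lambda>\<omega>. \<phi> (d # history D n \<omega>) * of_bool (D n \<omega> = d)))"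
  proof (rule Bochner_Integration.integral_sum)
    fix d
    show "integrable M (\<lambda>\<omega>. \<phi> (d # history D n \<omega>) * of_bool (D n \<omega> = d))"
      using history_integrable[where D=D and \<phi>="\<lambda>xs. \<phi> (d # tl xs) * of_bool (hd xs = d)" and n="Suc n", OF D] by simp
  qed
  also have "\<dots> = (\<Sum>d\<in>UNIV. w d * iid_mean w n (\<lambda>xs. \<phi> (d # xs)))"
  proof (rule sum.cong)
    fix d
    have "indep_var (PiM {..<n} (\<lambda>_. count_space UNIV)) (\<lambda>\<omega>. restrict (\<lambda>i. D i \<omega>) {..<n})
      (PiM {n} (\<lambda>_. count_space UNIV)) (\<lambda>\<omega>. restrict (\<lambda>i. D i \<omega>) {n})"
      by (rule indep_var_restrict[OF ind]) auto
    note comp = indep_var_compose[OF this, of "\<lambda>f. \<phi> (d # map f (rev [0..<n]))" borel "\<lambda>f. of_bool (f n = d) :: real" borel]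
    have "indep_var borel ((\<lambda>f. \<phi> (d # map f (rev [0..<n]))) \<circ> (\<lambda>\<omega>. restrict (\<lambda>i. D i \<omega>) {..<n}))
        borel ((\<lambda>f. of_bool (f n = d) :: real) \<circ> (\<lambda>\<omega>. restrict (\<lambda>i. D i \<omega>) {n}))"
      by (rule comp; rule PiM_count_space_finite) simp_all
    moreover have "(\<lambda>f. \<phi> (d # map f (rev [0..<n]))) \<circ> (\<lambda>\<omega>. restrict (\<lambda>i. D i \<omega>) {..<n}) = (\<lambda>\<omega>. \<phi> (d # history D n \<omega>))"
    proof
      fix \<omega>
      have "map (\<lambda>i\<in>{..<n}. D i \<omega>) (rev [0..<n]) = history D n \<omega>"
        unfolding history_def by (intro map_cong) auto
      then show "((\<lambda>f. \<phi> (d # map f (rev [0..<n]))) \<circ> (\<lambda>\<omega>. restrict (\<lambda>i. D i \<omega>) {..<n})) \<omega> = \<phi> (d # history D n \<omega>)"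
        by simp
    qed
    moreover have "(\<lambda>f. of_bool (f n = d) :: real) \<circ> (\<lambda>\<omega>. restrict (\<lambda>i. D i \<omega>) {n}) = (\<lambda>\<omega>. of_bool (D n \<omega> = d))"
      by (auto simp: fun_eq_iff)
    ultimately have iv: "indep_var borel (\<lambda>\<omega>. \<phi> (d # history D n \<omega>)) borel (\<lambda>\<omega>. of_bool (D n \<omega> = d) :: real)"
      by simp
    have ind_eq: "(\<lambda>\<omega>. of_bool (D n \<omega> = d) :: real) = (\<lambda>\<omega>. indicator {\<omega>. D n \<omega> = d} \<omega>)"
      by (auto simp: fun_eq_iff indicator_def)
    have int: "integrable M (\<lambda>\<omega>. of_bool (D n \<omega> = d) :: real)"
      using history_integrable[where D=D and \<phi>="\<lambda>xs. of_bool (hd xs = d)" and n="Suc n", OF D] by simp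
    have set: "{\<omega> \<in> space M. D n \<omega> = d} \<in> sets M"
      using measurable_sets[OF D[of n], of "{d}"] by (simp add: vimage_def Int_def conj_commute)
    have "expectation (\<lambda>\<omega>. of_bool (D n \<omega> = d) :: real) = expectation (\<lambda>\<omega>. indicator {\<omega> \<in> space M. D n \<omega> = d} \<omega>)"
      by (rule Bochner_Integration.integral_cong) auto
    also have "\<dots> = w d" using set law[of n d] by simp
    finally have "expectation (\<lambda>\<omega>. of_bool (D n \<omega> = d) :: real) = w d" .
    moreover have "expectation (\<lambda>\<omega>. \<phi> (d # history D n \<omega>) * of_bool (D n \<omega> = d)) =
        expectation (\<lambda>\<omega>. \<phi> (d # history D n \<omega>)) * expectation (\<lambda>\<omega>. of_bool (D n \<omega> = d))"
      by (rule indep_var_lebesgue_integral[OF iv history_integrable[where D=D and \<phi>="\<lambda>xs. \<phi> (d # xs)", OF D] int])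
    ultimately show "expectation (\<lambda>\<omega>. \<phi> (d # history D n \<omega>) * of_bool (D n \<omega> = d)) = w d * iid_mean w n (\<lambda>xs. \<phi> (d # xs))"
      using Suc.IH[of "\<lambda>xs. \<phi> (d # xs)"] by simp
  qed simp
  finally show ?case by simp
qed

text \<open>Hoeffding's inequality makes the probability of a deviation by \<epsilon> decay
  geometrically in \<open>n\<close>, and the Borel-Cantelli lemma is applied for each
  \<open>\<epsilon> = 1 / Suc k\<close>.\<close>

lemma AE_relative_frequency:
  fixes X :: "nat \<Rightarrow> 'a \<Rightarrow> real"
  assumes ind: "indep_vars (\<lambda>_. borel) X UNIV" and X01: "\<And>i \<omega>. X i \<omega> \<in> {0..1}"
    and mean: "\<And>i. expectation (X i) = p"
  shows "AE \<omega> in M. (\<lambda>n. (\<Sum>i<n. X i \<omega>) / n) \<longlonglongrightarrow> p"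
proof -
  have [measurable]: "X i \<in> borel_measurable M" for i using ind by (auto simp: indep_vars_def2)
  define A where "A \<epsilon> n = {\<omega> \<in> space M. \<bar>(\<Sum>i<n. X i \<omega>) - n * p\<bar> \<ge> \<epsilon> * n}" for \<epsilon> :: real and n :: nat
  have A [measurable]: "A \<epsilon> n \<in> sets M" for \<epsilon> n unfolding A_def by measurable
  have bound: "prob (A \<epsilon> n) \<le> 2 * exp (-2 * \<epsilon>\<^sup>2) ^ n" if "0 < \<epsilon>" for \<epsilon> n
  proof (cases "n = 0")
    case False
    interpret H: indep_interval_bounded_random_variables M "{..<n}" X "\<lambda>_. 0" "\<lambda>_. 1"
      by unfold_locales (use X01 indep_vars_subset[OF ind] in auto)
    interpret H: Hoeffding_ineq M "{..<n}" X "\<lambda>_. 0" "\<lambda>_. 1" "real n * p"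
      by unfold_locales (simp add: mean)
    have "prob {\<omega> \<in> space M. \<bar>(\<Sum>i\<in>{..<n}. X i \<omega>) - n * p\<bar> \<ge> \<epsilon> * n} \<le> 2 * exp (-2 * (\<epsilon> * n)\<^sup>2 / (\<Sum>i\<in>{..<n}. (1 - 0)\<^sup>2))"
      using that False by (intro H.Hoeffding_ineq_abs_ge) auto
    also have "-2 * (\<epsilon> * n)\<^sup>2 / (\<Sum>i\<in>{..<n}. (1 - 0)\<^sup>2) = real n * (-2 * \<epsilon>\<^sup>2)"
      using False by (simp add: power2_eq_square)
    finally show ?thesis unfolding A_def exp_of_nat_mult .
  qed (auto intro: order_trans[OF prob_le_1])
  have "AE \<omega> in M. \<forall>k::nat. \<forall>\<^sub>F n in sequentially. \<omega> \<in> space M - A (1 / Suc k) n"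
    unfolding AE_all_countable
  proof
    fix k :: nat
    show "AE \<omega> in M. \<forall>\<^sub>F n in sequentially. \<omega> \<in> space M - A (1 / Suc k) n"
    proof (rule borel_cantelli_AE1[OF A])
      have "summable (\<lambda>n. 2 * exp (-2 * (1 / Suc k)\<^sup>2) ^ n)"
        by (intro summable_mult summable_geometric) simp
      then show "summable (\<lambda>n. measure M (A (1 / Suc k) n))"
        by (rule summable_comparison_test') (use bound in auto)
    qed (simp add: emeasure_eq_measure)
  qed
  then show ?thesis
  proof eventually_elim
    case (elim \<omega>)
    show ?case
    proof (rule LIMSEQ_I)
      fix r :: real assume "0 < r"
      then obtain k where k: "1 / Suc k < r" using nat_approx_posE by blast
      have "\<forall>\<^sub>F n in sequentially. \<omega> \<in> space M - A (1 / Suc k) n" using elim by blast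
      then have "\<forall>\<^sub>F n in sequentially. norm ((\<Sum>i<n. X i \<omega>) / n - p) < r"
        using eventually_gt_at_top[of 0]
      proof eventually_elim
        case (elim n)
        then have "\<bar>(\<Sum>i<n. X i \<omega>) - n * p\<bar> < (1 / Suc k) * n" by (auto simp: A_def)
        moreover have "(\<Sum>i<n. X i \<omega>) / n - p = ((\<Sum>i<n. X i \<omega>) - n * p) / n" using elim by (simp add: field_simps)
        ultimately have "\<bar>(\<Sum>i<n. X i \<omega>) / n - p\<bar> < 1 / Suc k"
          using elim by (simp add: divide_less_eq)
        then show ?case using k by simp
      qed
      then show "\<exists>no. \<forall>n\<ge>no. norm ((\<Sum>i<n. X i \<omega>) / n - p) < r" by (simp add: eventually_sequentially)
    qed
  qed
qed

end

section \<open>Consistency\<close>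

text \<open>The bound of \<open>nn_integral_beta_bernoulli_kl\<close> for the Beta posterior of a
  split with both prior parameters equal to \<open>a\<close> and with counts \<open>n0\<close>,
  \<open>n1\<close>.\<close>

definition risk_bound :: "real \<Rightarrow> real \<Rightarrow> real \<Rightarrow> real \<Rightarrow> real" where
  "risk_bound q a n0 n1 = bernoulli_kl q ((a + n0) / (2 * a + n0 + n1)) + (q / (a + n0) + (1 - q) / (a + n1))"

text \<open>A child of conditional probability 0 enters with coefficient 0, so its count may stay
  bounded; the other counts grow linearly. Hence the auxiliary limits treat each term together with
  its coefficient.\<close>

lemma risk_bound_tendsto:
  fixes n0 n1 :: "nat \<Rightarrow> real"
  assumes q: "0 \<le> q" "q \<le> 1" and a: "0 < a" and w: "0 < w"
    and nn: "\<And>n. 0 \<le> n0 n" "\<And>n. 0 \<le> n1 n"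
    and lim: "(\<lambda>n. n0 n / n) \<longlonglongrightarrow> w * q" "(\<lambda>n. n1 n / n) \<longlonglongrightarrow> w * (1 - q)"
  shows "(\<lambda>n. risk_bound q a (n0 n) (n1 n)) \<longlonglongrightarrow> 0"
proof -
  have a_lim: "(\<lambda>n. r / real n) \<longlonglongrightarrow> 0" for r :: real
    by (rule lim_const_over_n)
  have inv: "(\<lambda>n. r / (a + m n)) \<longlonglongrightarrow> 0" if r: "0 \<le> r" and m: "(\<lambda>n. m n / n) \<longlonglongrightarrow> w * r" for r and m :: "nat \<Rightarrow> real"
  proof (cases "r = 0")
    case False
    have l: "(\<lambda>n. (r / n) / (a / n + m n / n)) \<longlonglongrightarrow> 0 / (0 + w * r)"
      using False r w by (intro tendsto_divide tendsto_add a_lim m) auto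
    have "\<forall>\<^sub>F n in sequentially. (r / n) / (a / n + m n / n) = r / (a + m n)"
      using eventually_gt_at_top[of 0] by eventually_elim (simp add: add_divide_distrib[symmetric])
    from Lim_transform_eventually[OF l this] show ?thesis by simp
  qed simp
  define v where "v n = (a + n0 n) / (2 * a + n0 n + n1 n)" for n
  have split: "(\<lambda>n. r * ln (r / u n)) \<longlonglongrightarrow> 0" if "0 \<le> r" and u: "u \<longlonglongrightarrow> r" for r :: real and u
  proof (cases "r = 0")
    case False
    then have "(\<lambda>n. r * ln (r / u n)) \<longlonglongrightarrow> r * ln (r / r)"
      by (intro tendsto_intros u) auto
    then show ?thesis using False by simp
  qed simp
  have l: "(\<lambda>n. (a / n + n0 n / n) / (2 * a / n + n0 n / n + n1 n / n)) \<longlonglongrightarrow> (0 + w * q) / (0 + w * q + w * (1 - q))"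
    using w by (intro tendsto_divide tendsto_add a_lim lim) (auto simp: algebra_simps)
  have "\<forall>\<^sub>F n in sequentially. (a / n + n0 n / n) / (2 * a / n + n0 n / n + n1 n / n) = v n"
    using eventually_gt_at_top[of 0] by eventually_elim (simp add: v_def add_divide_distrib[symmetric])
  note Lim_transform_eventually[OF l this]
  moreover have "(0 + w * q) / (0 + w * q + w * (1 - q)) = q"
    using w by (simp add: algebra_simps)
  ultimately have v: "v \<longlonglongrightarrow> q" by (simp only:)
  have "(\<lambda>n. bernoulli_kl q (v n)) \<longlonglongrightarrow> 0 + 0"
    unfolding bernoulli_kl_def using q by (intro tendsto_add split v tendsto_diff tendsto_const) auto
  moreover have "(\<lambda>n. q / (a + n0 n) + (1 - q) / (a + n1 n)) \<longlonglongrightarrow> 0 + 0"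
    using q lim by (intro tendsto_add inv) auto
  ultimately have "(\<lambda>n. bernoulli_kl q (v n) + (q / (a + n0 n) + (1 - q) / (a + n1 n))) \<longlonglongrightarrow> (0 + 0) + (0 + 0)"
    by (rule tendsto_add)
  then show ?thesis by (simp add: risk_bound_def v_def)
qed

text \<open>The deviations of the two children are opposite, so the same \<open>Z\<close> is
  controlled by either martingale, each normalised by the count of its own child. The factor 4 is
  the square of the 2 in \<open>succ_dev_le_max\<close>.\<close>

lemma risk_bound_le_max:
  assumes q: "0 \<le> q" "q \<le> 1" and a: "0 < a"
  shows "risk_bound q a (succ_count False xs) (succ_count True xs) \<le>
    (2 * (2 * q - 1)\<^sup>2 + 1 / a) + 4 * (succ_mart_max False q a xs)\<^sup>2 + 4 * (succ_mart_max True (1 - q) a xs)\<^sup>2"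
proof -
  let ?n0 = "succ_count False xs" and ?n1 = "succ_count True xs"
  define Z where "Z = ?n0 - q * (?n0 + ?n1)"
  have nn: "0 \<le> ?n0" "0 \<le> ?n1" by (rule succ_count_nonneg)+
  have Z0: "Z = succ_dev False q xs" by (simp add: Z_def succ_dev_eq)
  have Z1: "Z = - succ_dev True (1 - q) xs" by (simp add: Z_def succ_dev_eq algebra_simps)
  have sq: "(Z / (a + n))\<^sup>2 \<le> 4 * m\<^sup>2" if "\<bar>Z\<bar> \<le> 2 * (a + n) * m" "0 \<le> n" for n m
  proof -
    have "\<bar>Z / (a + n)\<bar> \<le> 2 * m" using that a by (simp add: abs_divide divide_le_eq mult_ac)
    then have "\<bar>Z / (a + n)\<bar>\<^sup>2 \<le> (2 * m)\<^sup>2" by (intro power_mono) auto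
    then show ?thesis by (simp only: power2_abs power_mult_distrib) simp
  qed
  have "(Z / (a + ?n0))\<^sup>2 \<le> 4 * (succ_mart_max False q a xs)\<^sup>2"
    using succ_dev_le_max[OF a, of False q xs] nn unfolding Z0[symmetric] by (intro sq) auto
  moreover have "(Z / (a + ?n1))\<^sup>2 \<le> 4 * (succ_mart_max True (1 - q) a xs)\<^sup>2"
    using succ_dev_le_max[OF a, of True "1 - q" xs] nn Z1 by (intro sq) auto
  moreover have "q / (a + ?n0) + (1 - q) / (a + ?n1) \<le> q / a + (1 - q) / a"
    using q a nn by (intro add_mono divide_left_mono) auto
  moreover have "q / a + (1 - q) / a = 1 / a" by (simp add: add_divide_distrib[symmetric])
  moreover have "bernoulli_kl q ((a + ?n0) / (2 * a + ?n0 + ?n1)) \<le> 2 * (2 * q - 1)\<^sup>2 + (Z / (a + ?n0))\<^sup>2 + (Z / (a + ?n1))\<^sup>2"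
    unfolding Z_def by (rule bernoulli_kl_le_pathwise[OF q a nn])
  ultimately show ?thesis unfolding risk_bound_def by linarith
qed

context polya_tree_sampling
begin

sublocale binary_tree \<X> B
  by unfold_locales (rule tree, rule lebesgue_tree)

lemma f0_integrable: "integrable (leb_on \<X>) f0" and f0_integral_1: "(\<integral>x. f0 x \<partial>leb_on \<X>) = 1"
proof -
  have ae: "AE x in leb_on \<X>. 0 \<le> f0 x" using f0_nonneg by (intro AE_I2) auto
  show int: "integrable (leb_on \<X>) f0"
    using f0_measurable ae f0_integral by (intro integrableI_nonneg) auto
  have "ennreal (\<integral>x. f0 x \<partial>leb_on \<X>) = ennreal 1"
    using nn_integral_eq_integral[OF int ae] f0_integral by simp
  then show "(\<integral>x. f0 x \<partial>leb_on \<X>) = 1"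
    by (simp add: integral_nonneg_AE[OF ae])
qed

lemma a_pos: "0 < a l"
  using pos[of "replicate l True"] level[of "replicate l True"] by simp

lemma summable_inverse_level: "summable (\<lambda>l. 1 / a (Suc l))"
proof (rule summable_comparison_test')
  show "summable (\<lambda>l. real (Suc l) / a (Suc l))" using summable_level by (subst summable_Suc_iff)
  show "norm (1 / a (Suc l)) \<le> real (Suc l) / a (Suc l)" for l
    using a_pos[of "Suc l"] by (simp add: divide_right_mono)
qed

definition post_param :: "nat \<Rightarrow> (nat \<Rightarrow> 'a) \<Rightarrow> bool list \<Rightarrow> real" where
  "post_param n x e = \<A> e + (\<Sum>i<n. indicator (B e) (x i))"

text \<open>The counts of the two children add up to at most \<open>n\<close>, so their imbalance
  adds at most \<open>n / (2 * a (Suc l))\<close> to the Beta second moment. The constant grows with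
  \<open>n\<close>, but it only serves to construct the posterior of one fixed sample.\<close>

lemma polya_kl_posterior:
  "polya_kl \<X> B (post_param n x) (\<lambda>l. (real n + 1) / (2 * a (Suc l))) f0"
proof unfold_locales
  have cnt: "0 \<le> (\<Sum>i<n. indicator (B e) (x i) :: real)" for e by (simp add: sum_nonneg)
  show "0 < post_param n x e" for e
    using pos[of e] cnt[of e] by (simp add: post_param_def)
  show "0 \<le> (real n + 1) / (2 * a (Suc l))" for l using a_pos[of "Suc l"] by simp
  have "summable (\<lambda>l. (real n + 1) / 2 * (1 / a (Suc l)))" by (intro summable_mult summable_inverse_level)
  then show "summable (\<lambda>l. (real n + 1) / (2 * a (Suc l)))" by simp
  fix e :: "bool list"
  define \<alpha> where "\<alpha> = a (Suc (length e))"
  define n0 n1 where "n0 = (\<Sum>i<n. indicator (B (e @ [False])) (x i) :: real)" and "n1 = (\<Sum>i<n. indicator (B (e @ [True])) (x i) :: real)"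
  have \<alpha>: "0 < \<alpha>" unfolding \<alpha>_def by (rule a_pos)
  have nn: "0 \<le> n0" "0 \<le> n1" unfolding n0_def n1_def by (rule cnt)+
  have "n0 + n1 = (\<Sum>i<n. indicator (B e) (x i))"
    unfolding n0_def n1_def sum.distrib[symmetric] using B_split[of e] B_disj[of e]
    by (intro sum.cong) (auto simp: indicator_def)
  also have "\<dots> \<le> (\<Sum>i<n. 1)" by (intro sum_mono) (simp add: indicator_def)
  finally have n: "n0 + n1 \<le> n" by simp
  define s where "s = 2 * \<alpha> + (n0 + n1)"
  have s: "2 * \<alpha> \<le> s" "n0 + n1 \<le> s" "0 < s" using nn \<alpha> by (auto simp: s_def)
  have post: "post_param n x (e @ [False]) = \<alpha> + n0" "post_param n x (e @ [True]) = \<alpha> + n1"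
    by (auto simp: post_param_def level \<alpha>_def n0_def n1_def)
  have "(n0 - n1)\<^sup>2 \<le> (n0 + n1)\<^sup>2"
    using nn by (simp add: power2_sum power2_diff)
  also have "\<dots> \<le> n * s"
    unfolding power2_eq_square using n s nn by (intro mult_mono) auto
  finally have "(n0 - n1)\<^sup>2 + s \<le> (real n + 1) * s" by (simp add: algebra_simps)
  then have "((n0 - n1)\<^sup>2 + s) / (s * (s + 1)) \<le> ((real n + 1) * s) / (s * (s + 1))"
    using s by (intro divide_right_mono) auto
  also have "\<dots> = (real n + 1) / (s + 1)" using s by simp
  also have "\<dots> \<le> (real n + 1) / (2 * \<alpha>)"
    using s \<alpha> by (intro divide_left_mono) auto
  finally show "((post_param n x (e @ [False]) - post_param n x (e @ [True]))\<^sup>2 + (post_param n x (e @ [False]) + post_param n x (e @ [True]))) /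
      ((post_param n x (e @ [False]) + post_param n x (e @ [True])) * (post_param n x (e @ [False]) + post_param n x (e @ [True]) + 1))
      \<le> (real n + 1) / (2 * a (Suc (length e)))"
    unfolding post by (simp add: s_def \<alpha>_def algebra_simps)
qed (use f0_integrable f0_nonneg f0_integral_1 in auto)

lemma post_param_0: "post_param 0 x = \<A>"
  by (simp add: post_param_def fun_eq_iff)

sublocale prior: polya_kl \<X> B \<A> "\<lambda>l. (real 0 + 1) / (2 * a (Suc l))" f0
  using polya_kl_posterior[of 0] by (simp only: post_param_0)

abbreviation F :: "bool list \<Rightarrow> real" where "F \<equiv> mass f0"
abbreviation q :: "bool list \<Rightarrow> real" where "q \<equiv> prior.qq"
abbreviation child_level :: "bool list \<Rightarrow> real" where "child_level e \<equiv> a (Suc (length e))"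

lemma posterior_KL_eq:
  "posterior_KL \<X> B \<A> f0 n x = (\<Sum>l. \<Sum>e\<in>level l. ennreal (F e) *
    (\<integral>\<^sup>+v. ennreal (bernoulli_kl (q e) v) \<partial>beta_measure (post_param n x (e @ [False])) (post_param n x (e @ [True]))))"
proof -
  interpret post: polya_kl \<X> B "post_param n x" "\<lambda>l. (real n + 1) / (2 * a (Suc l))" f0
    by (rule polya_kl_posterior)
  show ?thesis
    using post.nn_integral_KL unfolding posterior_KL_def posterior_def post_param_def .
qed

lemma bounded_chi: "\<exists>C. \<forall>l. (\<Sum>k<l. \<Sum>e\<in>level k. F e * (2 * q e - 1)\<^sup>2) \<le> C"
proof -
  obtain \<epsilon> where "\<epsilon> > 0" "\<P>(P in PT \<X> B \<A>. KL \<X> f0 (leb_density \<X> P) \<le> ennreal \<epsilon>) > 0"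
    using KL_prior by blast
  then show ?thesis by (intro prior.KL_support_imp_bounded) (auto simp: level)
qed

section \<open>The observations as seen from a node\<close>

definition obs :: "bool list \<Rightarrow> nat \<Rightarrow> 'w \<Rightarrow> bool option" where
  "obs e i \<omega> = (if X i \<omega> \<in> B (e @ [False]) then Some False else if X i \<omega> \<in> B (e @ [True]) then Some True else None)"

abbreviation hist :: "bool list \<Rightarrow> nat \<Rightarrow> 'w \<Rightarrow> bool option list" where
  "hist e \<equiv> history (obs e)"

lemma succ_count_hist: "succ_count \<sigma> (hist e n \<omega>) = (\<Sum>i<n. indicator (B (e @ [\<sigma>])) (X i \<omega>))"
  using B_disj[of e] by (induction n) (cases \<sigma>; auto simp: obs_def indicator_def)+

lemma post_param_hist: "post_param n (\<lambda>i. X i \<omega>) (e @ [\<sigma>]) = child_level e + succ_count \<sigma> (hist e n \<omega>)"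
  by (simp add: post_param_def level succ_count_hist)

definition weight :: "bool list \<Rightarrow> bool option \<Rightarrow> real" where
  "weight e d = (case d of None \<Rightarrow> 1 - F e | Some \<sigma> \<Rightarrow> F (e @ [\<sigma>]))"

lemma weight_Some: "weight e (Some False) = F e * q e" "weight e (Some True) = F e * (1 - q e)"
  by (simp_all add: weight_def prior.F_qq)

lemma weights: "observation_weights (weight e)"
proof unfold_locales
  show "0 \<le> weight e d" for d using prior.F_le_1[of e] prior.F_nonneg by (auto simp: weight_def split: option.split)
  show "(\<Sum>d\<in>UNIV. weight e d) = 1"
    using prior.F_additive[of e] by (simp add: sum_UNIV_bool_option[of _ True] weight_def)
qed

lemma bernoulli_splits:
  "bernoulli_split (weight e) False (q e) (F e) (child_level e)"
  "bernoulli_split (weight e) True (1 - q e) (F e) (child_level e)"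
proof -
  interpret observation_weights "weight e" by (rule weights)
  show "bernoulli_split (weight e) False (q e) (F e) (child_level e)"
    by unfold_locales (auto simp: prior.qq_bounds a_pos weight_Some)
  show "bernoulli_split (weight e) True (1 - q e) (F e) (child_level e)"
    by unfold_locales (auto simp: prior.qq_bounds a_pos weight_Some)
qed

lemma X_measurable [measurable]: "X i \<in> measurable M (leb_on \<X>)"
  using X_distributed[of i] by (simp add: distributed_def)

lemma prob_X_B: "prob {\<omega> \<in> space M. X i \<omega> \<in> B e} = F e"
proof -
  have "emeasure M (X i -` B e \<inter> space M) = (\<integral>\<^sup>+x. ennreal (f0 x) * indicator (B e) x \<partial>leb_on \<X>)"
    by (rule distributed_emeasure[OF X_distributed]) measurable
  also have "\<dots> = emeasure (density (leb_on \<X>) (\<lambda>x. ennreal (f0 x))) (B e)"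
    using f0_measurable by (subst emeasure_density) auto
  also have "\<dots> = ennreal (F e)" by (rule emeasure_density_B[OF f0_integrable f0_nonneg])
  finally have "measure M (X i -` B e \<inter> space M) = F e"
    using prior.F_nonneg[of e] by (simp add: measure_def)
  moreover have "X i -` B e \<inter> space M = {\<omega> \<in> space M. X i \<omega> \<in> B e}" by auto
  ultimately show ?thesis by simp
qed

lemma obs_indep: "indep_vars (\<lambda>_. count_space UNIV) (obs e) UNIV"
proof -
  let ?g = "\<lambda>x. if x \<in> B (e @ [False]) then Some False else if x \<in> B (e @ [True]) then Some True else None"
  have "?g \<in> measurable (restrict_space borel \<X>) (count_space UNIV)" by measurable
  from indep_vars_compose2[OF X_indep this] show ?thesis by (simp add: obs_def[abs_def])
qed

lemma obs_measurable [measurable]: "obs e i \<in> measurable M (count_space UNIV)"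
  using obs_indep[of e] by (auto simp: indep_vars_def2)

lemma prob_obs: "prob {\<omega> \<in> space M. obs e i \<omega> = d} = weight e d"
proof -
  have Some: "prob {\<omega> \<in> space M. obs e i \<omega> = Some \<sigma>} = weight e (Some \<sigma>)" for \<sigma>
  proof -
    have "{\<omega> \<in> space M. obs e i \<omega> = Some \<sigma>} = {\<omega> \<in> space M. X i \<omega> \<in> B (e @ [\<sigma>])}"
      using B_disj[of e] by (cases \<sigma>) (auto simp: obs_def)
    then show ?thesis by (simp add: prob_X_B weight_def)
  qed
  show ?thesis
  proof (cases d)
    case None
    have "{\<omega> \<in> space M. obs e i \<omega> = None} = space M - {\<omega> \<in> space M. X i \<omega> \<in> B e}"
      using B_split[of e] by (auto simp: obs_def split: if_splits)
    moreover have "prob (space M - {\<omega> \<in> space M. X i \<omega> \<in> B e}) = 1 - F e"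
      by (subst prob_compl) (auto simp: prob_X_B)
    ultimately show ?thesis by (simp add: None weight_def)
  qed (use Some in simp)
qed

lemma expectation_hist:
  fixes \<phi> :: "bool option list \<Rightarrow> real"
  shows "expectation (\<lambda>\<omega>. \<phi> (hist e n \<omega>)) = iid_mean (weight e) n \<phi>"
  by (rule expectation_history[OF obs_indep prob_obs])

lemma hist_compose_measurable:
  "(\<lambda>\<omega>. \<phi> (hist e n \<omega>)) \<in> borel_measurable M"
  by (rule measurable_compose[OF history_measurable[OF obs_measurable]]) simp

lemma nn_integral_hist:
  assumes "\<And>xs. 0 \<le> \<phi> xs"
  shows "(\<integral>\<^sup>+\<omega>. ennreal (\<phi> (hist e n \<omega>)) \<partial>M) = ennreal (iid_mean (weight e) n \<phi>)"
  unfolding expectation_hist[symmetric] using assms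
  by (intro nn_integral_eq_integral history_integrable AE_I2) auto

definition risk :: "bool list \<Rightarrow> bool option list \<Rightarrow> ennreal" where
  "risk e xs = (\<integral>\<^sup>+v. ennreal (bernoulli_kl (q e) v)
     \<partial>beta_measure (child_level e + succ_count False xs) (child_level e + succ_count True xs))"

abbreviation node_bound :: "bool list \<Rightarrow> bool option list \<Rightarrow> real" where
  "node_bound e xs \<equiv> risk_bound (q e) (child_level e) (succ_count False xs) (succ_count True xs)"

lemma risk_measurable [measurable]: "(\<lambda>\<omega>. risk e (hist e n \<omega>)) \<in> borel_measurable M"
  and mart_max_measurable [measurable]:
    "(\<lambda>\<omega>. succ_mart_max \<sigma> r s (hist e n \<omega>)) \<in> borel_measurable M"
  by (rule hist_compose_measurable)+

lemma risk_le: "risk e xs \<le> ennreal (node_bound e xs)"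
proof -
  have "0 < child_level e + succ_count \<sigma> xs" for \<sigma>
    using a_pos[of "Suc (length e)"] succ_count_nonneg[of \<sigma> xs] by simp
  from nn_integral_beta_bernoulli_kl[OF this[of False] this[of True] prior.qq_bounds]
  show ?thesis by (simp add: risk_def risk_bound_def algebra_simps)
qed

lemma posterior_KL_hist:
  "posterior_KL \<X> B \<A> f0 n (\<lambda>i. X i \<omega>) = (\<Sum>l. \<Sum>e\<in>level l. ennreal (F e) * risk e (hist e n \<omega>))"
  unfolding posterior_KL_eq post_param_hist risk_def ..

lemma posterior_KL_measurable:
  "(\<lambda>\<omega>. posterior_KL \<X> B \<A> f0 n (\<lambda>i. X i \<omega>)) \<in> borel_measurable M"
  unfolding posterior_KL_hist by measurable

text \<open>The running maxima increase with \<open>n\<close>, so their suprema dominate the risk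
  for all sample sizes at once, and moment bounds pass to them by monotone convergence.\<close>

definition envelope :: "bool list \<Rightarrow> 'w \<Rightarrow> ennreal" where
  "envelope e \<omega> = ennreal (2 * (2 * q e - 1)\<^sup>2 + 1 / child_level e)
     + 4 * (SUP n. ennreal ((succ_mart_max False (q e) (child_level e) (hist e n \<omega>))\<^sup>2))
     + 4 * (SUP n. ennreal ((succ_mart_max True (1 - q e) (child_level e) (hist e n \<omega>))\<^sup>2))"

lemma envelope_measurable [measurable]: "envelope e \<in> borel_measurable M"
  unfolding envelope_def[abs_def] by measurable

lemma risk_le_envelope: "risk e (hist e n \<omega>) \<le> envelope e \<omega>"
proof -
  have "0 \<le> 2 * (2 * q e - 1)\<^sup>2 + 1 / child_level e" using a_pos[of "Suc (length e)"] by simp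
  then have "risk e (hist e n \<omega>) \<le> ennreal (2 * (2 * q e - 1)\<^sup>2 + 1 / child_level e)
      + 4 * ennreal ((succ_mart_max False (q e) (child_level e) (hist e n \<omega>))\<^sup>2)
      + 4 * ennreal ((succ_mart_max True (1 - q e) (child_level e) (hist e n \<omega>))\<^sup>2)"
    using order_trans[OF risk_le ennreal_leI[OF risk_bound_le_max[OF prior.qq_bounds a_pos]], of e "hist e n \<omega>"]
    by (simp add: ennreal_plus ennreal_mult')
  also have "\<dots> \<le> envelope e \<omega>"
    unfolding envelope_def by (intro add_mono mult_left_mono SUP_upper order_refl) auto
  finally show ?thesis .
qed

lemma nn_integral_SUP_mart:
  assumes "bernoulli_split (weight e) \<sigma> r (F e) (child_level e)"
  shows "(\<integral>\<^sup>+\<omega>. (SUP n. ennreal ((succ_mart_max \<sigma> r (child_level e) (hist e n \<omega>))\<^sup>2)) \<partial>M) \<le>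
    ennreal (4 * (1 / child_level e + 1 / (child_level e)\<^sup>2))"
proof -
  interpret bernoulli_split "weight e" \<sigma> r "F e" "child_level e" by fact
  have "(\<integral>\<^sup>+\<omega>. (SUP n. ennreal ((succ_mart_max \<sigma> r (child_level e) (hist e n \<omega>))\<^sup>2)) \<partial>M) =
      (SUP n. \<integral>\<^sup>+\<omega>. ennreal ((succ_mart_max \<sigma> r (child_level e) (hist e n \<omega>))\<^sup>2) \<partial>M)"
    by (intro nn_integral_monotone_convergence_SUP incseq_SucI)
      (auto simp: le_fun_def intro!: ennreal_leI power_mono succ_mart_max_ge)
  also have "\<dots> \<le> ennreal (4 * (1 / child_level e + 1 / (child_level e)\<^sup>2))"
  proof (rule SUP_least)
    fix n
    show "(\<integral>\<^sup>+\<omega>. ennreal ((succ_mart_max \<sigma> r (child_level e) (hist e n \<omega>))\<^sup>2) \<partial>M) \<le> ennreal (4 * (1 / child_level e + 1 / (child_level e)\<^sup>2))"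
      unfolding nn_integral_hist[of "\<lambda>xs. (succ_mart_max \<sigma> r (child_level e) xs)\<^sup>2", OF zero_le_power2]
      by (intro ennreal_leI mean_succ_mart_max_sq)
  qed
  finally show ?thesis .
qed

lemma nn_integral_envelope:
  "(\<integral>\<^sup>+\<omega>. envelope e \<omega> \<partial>M) \<le> ennreal (2 * (2 * q e - 1)\<^sup>2 + 33 / child_level e + 32 / (child_level e)\<^sup>2)"
proof -
  let ?a = "child_level e"
  have a: "0 < ?a" by (rule a_pos)
  have "(\<integral>\<^sup>+\<omega>. envelope e \<omega> \<partial>M) = ennreal (2 * (2 * q e - 1)\<^sup>2 + 1 / ?a)
      + 4 * (\<integral>\<^sup>+\<omega>. (SUP n. ennreal ((succ_mart_max False (q e) ?a (hist e n \<omega>))\<^sup>2)) \<partial>M)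
      + 4 * (\<integral>\<^sup>+\<omega>. (SUP n. ennreal ((succ_mart_max True (1 - q e) ?a (hist e n \<omega>))\<^sup>2)) \<partial>M)"
    unfolding envelope_def by (simp add: nn_integral_add nn_integral_cmult emeasure_space_1)
  also have "\<dots> \<le> ennreal (2 * (2 * q e - 1)\<^sup>2 + 1 / ?a) + 4 * ennreal (4 * (1 / ?a + 1 / ?a\<^sup>2)) + 4 * ennreal (4 * (1 / ?a + 1 / ?a\<^sup>2))"
    by (intro add_mono mult_left_mono nn_integral_SUP_mart bernoulli_splits order_refl) auto
  also have "\<dots> = ennreal (2 * (2 * q e - 1)\<^sup>2 + 1 / ?a + 4 * (4 * (1 / ?a + 1 / ?a\<^sup>2)) + 4 * (4 * (1 / ?a + 1 / ?a\<^sup>2)))"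
  proof -
    have four: "4 * ennreal r = ennreal (4 * r)" for r by (simp add: ennreal_mult')
    show ?thesis unfolding four using a by (subst (1 2) ennreal_plus) auto
  qed
  \<comment> \<open>Each child contributes 16 and the Beta fluctuation 1 to the coefficient of
    \<open>1 / child_level e\<close>.\<close>
  also have "2 * (2 * q e - 1)\<^sup>2 + 1 / ?a + 4 * (4 * (1 / ?a + 1 / ?a\<^sup>2)) + 4 * (4 * (1 / ?a + 1 / ?a\<^sup>2)) =
    2 * (2 * q e - 1)\<^sup>2 + 33 / ?a + 32 / ?a\<^sup>2" by simp
  finally show ?thesis .
qed

lemma summable_chi: "summable (\<lambda>l. \<Sum>e\<in>level l. F e * (2 * q e - 1)\<^sup>2)"
proof -
  obtain C where C: "\<And>l. (\<Sum>k<l. \<Sum>e\<in>level k. F e * (2 * q e - 1)\<^sup>2) \<le> C"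
    using bounded_chi by blast
  show ?thesis
    by (rule summableI_nonneg_bounded[OF _ C]) (auto intro!: sum_nonneg mult_nonneg_nonneg prior.F_nonneg)
qed

lemma summable_inverse_level_sq: "summable (\<lambda>l. 1 / (a (Suc l))\<^sup>2)"
proof -
  have "(\<lambda>l. 1 / a (Suc l)) \<longlonglongrightarrow> 0" by (rule summable_LIMSEQ_zero[OF summable_inverse_level])
  then have "\<forall>\<^sub>F l in sequentially. 1 / a (Suc l) < 1" by (rule order_tendstoD) simp
  then have "\<forall>\<^sub>F l in sequentially. norm (1 / (a (Suc l))\<^sup>2) \<le> 1 / a (Suc l)"
  proof eventually_elim
    case (elim l)
    have "1 / a (Suc l) * (1 / a (Suc l)) \<le> 1 * (1 / a (Suc l))"
      using elim a_pos[of "Suc l"] by (intro mult_right_mono) auto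
    then show ?case by (simp add: power2_eq_square)
  qed
  then show ?thesis by (rule summable_comparison_test_ev[OF _ summable_inverse_level])
qed

text \<open>The weights \<open>F e\<close> of a level add up to 1, so the terms that depend only on
  the level count once per level and are summable; the others form the series bounded by the support
  condition.\<close>

lemma nn_integral_total_envelope:
  "(\<integral>\<^sup>+\<omega>. (\<Sum>l. \<Sum>e\<in>level l. ennreal (F e) * envelope e \<omega>) \<partial>M) < \<infinity>"
proof -
  let ?g = "\<lambda>l. 2 * (\<Sum>e\<in>level l. F e * (2 * q e - 1)\<^sup>2) + (33 * (1 / a (Suc l)) + 32 * (1 / (a (Suc l))\<^sup>2))"
  have g0: "0 \<le> ?g l" for l
    using a_pos[of "Suc l"] by (intro add_nonneg_nonneg mult_nonneg_nonneg sum_nonneg prior.F_nonneg) auto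
  have g: "summable ?g"
    by (intro summable_add summable_mult summable_chi summable_inverse_level summable_inverse_level_sq)
  have "(\<integral>\<^sup>+\<omega>. (\<Sum>l. \<Sum>e\<in>level l. ennreal (F e) * envelope e \<omega>) \<partial>M) =
      (\<Sum>l. \<Sum>e\<in>level l. ennreal (F e) * (\<integral>\<^sup>+\<omega>. envelope e \<omega> \<partial>M))"
    by (subst nn_integral_suminf) (auto simp: nn_integral_sum nn_integral_cmult)
  also have "\<dots> \<le> (\<Sum>l. ennreal (?g l))"
  proof (intro suminf_le)
    fix l
    have "(\<Sum>e\<in>level l. ennreal (F e) * (\<integral>\<^sup>+\<omega>. envelope e \<omega> \<partial>M)) \<le>
      (\<Sum>e\<in>level l. ennreal (F e * (2 * (2 * q e - 1)\<^sup>2 + 33 / child_level e + 32 / (child_level e)\<^sup>2)))"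
      using nn_integral_envelope prior.F_nonneg by (intro sum_mono) (auto simp: ennreal_mult' intro!: mult_left_mono)
    also have "\<dots> = ennreal (\<Sum>e\<in>level l. F e * (2 * (2 * q e - 1)\<^sup>2 + 33 / a (Suc l) + 32 / (a (Suc l))\<^sup>2))"
      using a_pos[of "Suc l"] prior.F_nonneg by (subst sum_ennreal[symmetric]) (auto intro!: sum.cong mult_nonneg_nonneg add_nonneg_nonneg)
    also have "(\<Sum>e\<in>level l. F e * (2 * (2 * q e - 1)\<^sup>2 + 33 / a (Suc l) + 32 / (a (Suc l))\<^sup>2)) = ?g l"
    proof -
      have "F e * (2 * (2 * q e - 1)\<^sup>2 + 33 / a (Suc l) + 32 / (a (Suc l))\<^sup>2) =
        2 * (F e * (2 * q e - 1)\<^sup>2) + F e * (33 * (1 / a (Suc l)) + 32 * (1 / (a (Suc l))\<^sup>2))" for e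
        by (simp add: algebra_simps)
      then show ?thesis by (simp only: sum.distrib sum_distrib_left[symmetric] sum_distrib_right[symmetric] prior.F_sum mult_1)
    qed
    finally show "(\<Sum>e\<in>level l. ennreal (F e) * (\<integral>\<^sup>+\<omega>. envelope e \<omega> \<partial>M)) \<le> ennreal (?g l)" .
  qed auto
  also have "\<dots> = ennreal (\<Sum>l. ?g l)" using g g0 by (intro suminf_ennreal2)
  finally show ?thesis by (rule le_less_trans) simp
qed

section \<open>Law of large numbers at the nodes and dominated convergence\<close>

lemma AE_frequency: "AE \<omega> in M. \<forall>e \<sigma>. (\<lambda>n. succ_count \<sigma> (hist e n \<omega>) / n) \<longlonglongrightarrow> weight e (Some \<sigma>)"
  unfolding AE_all_countable
proof (intro allI)
  fix e \<sigma>
  have "AE \<omega> in M. (\<lambda>n. (\<Sum>i<n. indicator (B (e @ [\<sigma>])) (X i \<omega>)) / n) \<longlonglongrightarrow> F (e @ [\<sigma>])"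
  proof (rule AE_relative_frequency)
    show "indep_vars (\<lambda>_. borel) (\<lambda>i \<omega>. indicator (B (e @ [\<sigma>])) (X i \<omega>)) UNIV"
      by (rule indep_vars_compose2[OF X_indep]) measurable
    fix i
    have "expectation (\<lambda>\<omega>. indicator (B (e @ [\<sigma>])) (X i \<omega>)) = expectation (indicator {\<omega> \<in> space M. X i \<omega> \<in> B (e @ [\<sigma>])})"
      by (rule Bochner_Integration.integral_cong) (auto simp: indicator_def)
    also have "\<dots> = F (e @ [\<sigma>])"
      by (simp add: prob_X_B)
    finally show "expectation (\<lambda>\<omega>. indicator (B (e @ [\<sigma>])) (X i \<omega>)) = F (e @ [\<sigma>])" .
  qed (simp add: indicator_def)
  then show "AE \<omega> in M. (\<lambda>n. succ_count \<sigma> (hist e n \<omega>) / n) \<longlonglongrightarrow> weight e (Some \<sigma>)"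
    by (simp add: succ_count_hist weight_def)
qed

text \<open>A node of mass 0 is set apart, since its frequencies carry no information on
  \<open>q e\<close> and its weight is 0.\<close>

lemma node_risk_tendsto:
  assumes "\<forall>e \<sigma>. (\<lambda>n. succ_count \<sigma> (hist e n \<omega>) / n) \<longlonglongrightarrow> weight e (Some \<sigma>)"
  shows "(\<lambda>n. ennreal (F e) * risk e (hist e n \<omega>)) \<longlonglongrightarrow> 0"
proof (cases "F e = 0")
  case False
  then have F: "0 < F e" using prior.F_nonneg[of e] by simp
  have "(\<lambda>n. node_bound e (hist e n \<omega>)) \<longlonglongrightarrow> 0"
    by (rule risk_bound_tendsto[OF prior.qq_bounds a_pos F succ_count_nonneg succ_count_nonneg])
      (use assms in \<open>simp_all only: weight_Some[symmetric]\<close>)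
  then have "(\<lambda>n. ennreal (F e * node_bound e (hist e n \<omega>))) \<longlonglongrightarrow> ennreal (F e * 0)"
    by (intro tendsto_ennrealI tendsto_mult tendsto_const)
  then have lim: "(\<lambda>n. ennreal (F e * node_bound e (hist e n \<omega>))) \<longlonglongrightarrow> 0" by simp
  show ?thesis
  proof (rule tendsto_sandwich[OF _ _ tendsto_const lim])
    show "\<forall>\<^sub>F n in sequentially. ennreal (F e) * risk e (hist e n \<omega>) \<le> ennreal (F e * node_bound e (hist e n \<omega>))"
      using F by (intro always_eventually allI) (simp add: ennreal_mult' mult_left_mono risk_le)
  qed simp
qed simp

text \<open>The series over the levels is an integral over counting measure, dominated for all
  \<open>n\<close> by the envelope of the path, which is almost surely summable.\<close>

lemma posterior_KL_AE: "AE \<omega> in M. (\<lambda>n. posterior_KL \<X> B \<A> f0 n (\<lambda>i. X i \<omega>)) \<longlonglongrightarrow> 0"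
proof -
  have "AE \<omega> in M. (\<Sum>l. \<Sum>e\<in>level l. ennreal (F e) * envelope e \<omega>) \<noteq> \<infinity>"
    using nn_integral_total_envelope by (intro nn_integral_PInf_AE) auto
  then show ?thesis
    using AE_frequency
  proof eventually_elim
    case (elim \<omega>)
    let ?f = "\<lambda>n l. \<Sum>e\<in>level l. ennreal (F e) * risk e (hist e n \<omega>)"
    have "(\<lambda>n. \<integral>\<^sup>+l. ?f n l \<partial>count_space UNIV) \<longlonglongrightarrow> (\<integral>\<^sup>+l. 0 \<partial>count_space (UNIV :: nat set))"
    proof (rule nn_integral_dominated_convergence[where w="\<lambda>l. \<Sum>e\<in>level l. ennreal (F e) * envelope e \<omega>"])
      show "AE l in count_space UNIV. ?f n l \<le> (\<Sum>e\<in>level l. ennreal (F e) * envelope e \<omega>)" for n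
        by (intro AE_I2 sum_mono mult_left_mono risk_le_envelope) auto
      show "(\<integral>\<^sup>+l. (\<Sum>e\<in>level l. ennreal (F e) * envelope e \<omega>) \<partial>count_space UNIV) < \<infinity>"
        using elim(1) by (simp add: nn_integral_count_space_nat less_top)
      show "AE l in count_space UNIV. (\<lambda>n. ?f n l) \<longlonglongrightarrow> 0"
      proof (intro AE_I2)
        fix l
        have "(\<lambda>n. ?f n l) \<longlonglongrightarrow> (\<Sum>e\<in>level l. 0)"
          by (intro tendsto_sum node_risk_tendsto elim(2))
        then show "(\<lambda>n. ?f n l) \<longlonglongrightarrow> 0" by simp
      qed
    qed auto
    then show ?case by (simp add: nn_integral_count_space_nat posterior_KL_hist)
  qed
qed

text \<open>The total envelope also has finite mean, so dominated convergence applies a second time,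
  now over the sample space.\<close>

lemma posterior_KL_L1: "(\<lambda>n. \<integral>\<^sup>+\<omega>. posterior_KL \<X> B \<A> f0 n (\<lambda>i. X i \<omega>) \<partial>M) \<longlonglongrightarrow> 0"
proof -
  have "(\<lambda>n. \<integral>\<^sup>+\<omega>. posterior_KL \<X> B \<A> f0 n (\<lambda>i. X i \<omega>) \<partial>M) \<longlonglongrightarrow> (\<integral>\<^sup>+\<omega>. 0 \<partial>M)"
  proof (rule nn_integral_dominated_convergence[where w="\<lambda>\<omega>. \<Sum>l. \<Sum>e\<in>level l. ennreal (F e) * envelope e \<omega>"])
    show "AE \<omega> in M. posterior_KL \<X> B \<A> f0 n (\<lambda>i. X i \<omega>) \<le> (\<Sum>l. \<Sum>e\<in>level l. ennreal (F e) * envelope e \<omega>)" for n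
      unfolding posterior_KL_hist by (intro AE_I2 suminf_le sum_mono mult_left_mono risk_le_envelope) auto
  qed (use posterior_KL_measurable posterior_KL_AE nn_integral_total_envelope in auto)
  then show ?thesis by simp
qed

end

section \<open>Rate of convergence\<close>

text \<open>One bound on \<open>u l\<close> increases geometrically and the other decreases. The
  first is summed below the crossing and the second above it, and each sum is a constant multiple of
  the common value there.\<close>

lemma suminf_geometric_crossover:
  fixes \<beta> :: real
  assumes \<beta>: "0 < \<beta>" and n: "1 \<le> n"
    and u: "\<And>l. 0 \<le> u l" "\<And>l. u l \<le> K * 2 powr (- \<beta> * real (Suc l))" "\<And>l. u l \<le> K * (2 ^ Suc l / n)" and K: "0 \<le> K"
  shows "(\<Sum>l. ennreal (u l)) \<le> ennreal (K * (2 + 1 / (1 - 2 powr (- \<beta>))) * n powr (- (\<beta> / (1 + \<beta>))))"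
proof -
  define \<rho> where "\<rho> = 2 powr (- \<beta>)"
  have \<rho>: "0 < \<rho>" "\<rho> < 1" using \<beta> by (auto simp: \<rho>_def powr_less_one)
  have \<rho>_pow: "2 powr (- \<beta> * real k) = \<rho> ^ k" for k
  proof -
    have "2 powr (- \<beta> * real k) = \<rho> powr real k" unfolding \<rho>_def powr_powr ..
    then show ?thesis using \<rho> by (simp only: powr_realpow)
  qed
  \<comment> \<open>The real level at which \<open>2 powr t / n = 2 powr (- \<beta> * t)\<close>;
    its integer part \<open>J\<close> separates head and tail.\<close>
  define t where "t = log 2 n / (1 + \<beta>)"
  have t0: "0 \<le> t" using n \<beta> by (simp add: t_def)
  define J where "J = nat \<lfloor>t\<rfloor>"
  have J: "real J \<le> t" "t \<le> real J + 1" using t0 by (auto simp: J_def of_nat_floor)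
  have nt: "n powr (- (\<beta> / (1 + \<beta>))) = 2 powr (- \<beta> * t)"
  proof -
    have "n = 2 powr (log 2 n)" using n by simp
    then have "n powr (- (\<beta> / (1 + \<beta>))) = 2 powr (log 2 n * (- (\<beta> / (1 + \<beta>))))" by (metis powr_powr)
    then show ?thesis by (simp add: t_def mult.commute)
  qed
  have nt': "2 powr t / n = 2 powr (- \<beta> * t)"
  proof -
    have "t * (1 + \<beta>) = log 2 n" using \<beta> by (simp add: t_def)
    then have "log 2 n = t + \<beta> * t" by (simp add: algebra_simps)
    moreover have "n = 2 powr (log 2 n)" using n by simp
    ultimately have "n = 2 powr (t + \<beta> * t)" by (simp only:)
    then have "2 powr t / n = 2 powr (t - (t + \<beta> * t))" by (simp only: powr_diff)
    then show ?thesis by simp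
  qed
  have head: "(\<Sum>l<J. u l) \<le> K * (2 * 2 powr (- \<beta> * t))"
  proof -
    have "(\<Sum>l<J. u l) \<le> (\<Sum>l<J. K * (2 ^ Suc l / n))" by (intro sum_mono u)
    also have "\<dots> = K * (2 * (\<Sum>l<J. 2 ^ l) / n)" by (simp add: sum_distrib_left sum_divide_distrib)
    also have "(\<Sum>l<J. 2 ^ l) = (2 ^ J - 1 :: real)" using geometric_sum[of "2::real" J] by simp
    also have "K * (2 * (2 ^ J - 1) / n) \<le> K * (2 * 2 powr t / n)"
    proof -
      have "(2::real) ^ J = 2 powr (real J)" by (simp add: powr_realpow)
      also have "\<dots> \<le> 2 powr t" using J by simp
      finally show ?thesis using K n by (intro mult_left_mono divide_right_mono) auto
    qed
    also have "2 * 2 powr t / n = 2 * 2 powr (- \<beta> * t)" unfolding nt'[symmetric] by simp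
    finally show ?thesis .
  qed
  have tail: "(\<Sum>l. ennreal (u (l + J))) \<le> ennreal (K * (2 powr (- \<beta> * t) * (1 / (1 - \<rho>))))"
  proof -
    have le: "u (l + J) \<le> K * 2 powr (- \<beta> * t) * \<rho> ^ l" for l
    proof -
      have "u (l + J) \<le> K * \<rho> ^ Suc (l + J)" using u(2)[of "l + J"] by (simp only: \<rho>_pow)
      also have "\<dots> = K * (\<rho> ^ l * \<rho> ^ Suc J)" by (simp add: power_add mult_ac)
      also have "\<dots> \<le> K * (\<rho> ^ l * 2 powr (- \<beta> * t))"
      proof (intro mult_left_mono)
        \<comment> \<open>The decreasing bound has the exponent \<open>Suc l\<close>, and
          \<open>Suc J\<close> is at least \<open>t\<close>, so rounding down to \<open>J\<close>
          loses nothing in the tail.\<close>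
        have "\<rho> ^ Suc J = 2 powr (- \<beta> * real (Suc J))" by (simp only: \<rho>_pow)
        also have "\<dots> \<le> 2 powr (- \<beta> * t)" using J \<beta> by simp
        finally show "\<rho> ^ Suc J \<le> 2 powr (- \<beta> * t)" .
      qed (use \<rho> K in auto)
      finally show ?thesis by (simp add: mult_ac)
    qed
    have "(\<Sum>l. ennreal (u (l + J))) \<le> (\<Sum>l. ennreal (K * 2 powr (- \<beta> * t) * \<rho> ^ l))"
      by (intro suminf_le ennreal_leI le) auto
    also have "\<dots> = ennreal (K * 2 powr (- \<beta> * t) * (1 / (1 - \<rho>)))"
      using \<rho> K by (intro suminf_ennreal_eq sums_mult geometric_sums) auto
    finally show ?thesis by (simp add: mult.assoc)
  qed
  have "(\<Sum>l. ennreal (u l)) = (\<Sum>l. ennreal (u (l + J))) + (\<Sum>l<J. ennreal (u l))"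
    by (rule suminf_offset) auto
  also have "(\<Sum>l<J. ennreal (u l)) = ennreal (\<Sum>l<J. u l)" by (intro sum_ennreal u)
  also have "(\<Sum>l. ennreal (u (l + J))) + ennreal (\<Sum>l<J. u l) \<le>
      ennreal (K * (2 powr (- \<beta> * t) * (1 / (1 - \<rho>)))) + ennreal (K * (2 * 2 powr (- \<beta> * t)))"
    by (intro add_mono tail ennreal_leI head)
  also have "\<dots> = ennreal (K * (2 + 1 / (1 - \<rho>)) * 2 powr (- \<beta> * t))"
    using K \<rho> by (subst ennreal_plus[symmetric]) (auto simp: algebra_simps intro!: mult_nonneg_nonneg)
  finally show ?thesis by (simp only: nt \<rho>_def)
qed

context polya_tree_sampling
begin

lemma node_bound_nonneg: "0 \<le> node_bound e xs"
proof -
  have pos: "0 < child_level e + succ_count \<sigma> xs" for \<sigma>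
    using a_pos[of "Suc (length e)"] succ_count_nonneg[of \<sigma> xs] by simp
  define y0 y1 where "y0 = child_level e + succ_count False xs" and "y1 = child_level e + succ_count True xs"
  have y: "0 < y0" "0 < y1" unfolding y0_def y1_def by (rule pos)+
  have v: "(child_level e + succ_count False xs) / (2 * child_level e + succ_count False xs + succ_count True xs) = y0 / (y0 + y1)"
    by (simp add: y0_def y1_def algebra_simps)
  have "0 \<le> bernoulli_kl (q e) (y0 / (y0 + y1))"
    using y by (intro bernoulli_kl_nonneg prior.qq_bounds) auto
  then show ?thesis
    unfolding risk_bound_def v unfolding y0_def[symmetric] y1_def[symmetric]
    using y prior.qq_bounds[of e] by (intro add_nonneg_nonneg divide_nonneg_nonneg) auto
qed

text \<open>The linear terms have mean zero because \<open>m \<sigma>\<close> is the mean of the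
  count. For each child the weighted variance and the inverse count both have the numerator 2, which
  makes 4.\<close>

lemma nn_integral_risk_le:
  assumes one: "1 \<le> child_level e"
  shows "(\<integral>\<^sup>+\<omega>. risk e (hist e n \<omega>) \<partial>M) \<le> ennreal ((2 * q e - 1)\<^sup>2 * (child_level e / (child_level e + n * F e))
     + q e * (4 / (child_level e + n * F (e @ [False]))) + (1 - q e) * (4 / (child_level e + n * F (e @ [True]))))"
proof -
  interpret W: observation_weights "weight e" by (rule weights)
  let ?a = "child_level e" and ?q = "q e" and ?w = "weight e"
  let ?N = "\<lambda>\<sigma> xs. succ_count \<sigma> xs"
  define m where "m \<sigma> = n * F (e @ [\<sigma>])" for \<sigma>
  have m_w: "m \<sigma> = n * ?w (Some \<sigma>)" for \<sigma> by (simp add: m_def weight_def)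
  have m_nn: "0 \<le> m \<sigma>" for \<sigma> using prior.F_nonneg by (simp add: m_def)
  have m_sum: "m False + m True = n * F e"
    using prior.F_additive[of e] by (simp add: m_def distrib_left[symmetric])
  have mq: "m False = ?q * (m False + m True)"
    unfolding m_sum by (simp add: m_def prior.F_qq mult_ac)
  have qb: "0 \<le> ?q" "0 \<le> 1 - ?q" using prior.qq_bounds[of e] by auto
  define k0 where "k0 = 1 / (2 * ?a + m False + m True) - ?q / (?a + m False)"
  define k1 where "k1 = 1 / (2 * ?a + m False + m True) - (1 - ?q) / (?a + m True)"
  let ?D = "\<lambda>\<sigma> xs. (?N \<sigma> xs - m \<sigma>)\<^sup>2 / (?a + ?N \<sigma> xs)"
  \<comment> \<open>Written with constant coefficients outside the random factors, so that linearity
    of \<open>iid_mean\<close> alone reduces its mean to known moments.\<close>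
  let ?b = "\<lambda>xs. (2 * ?q - 1)\<^sup>2 * (?a / (?a + n * F e)) + ((k0 * (?N False xs + - m False) + k1 * (?N True xs + - m True))
     + ((?q * (1 / (?a + m False))) * ?D False xs + (((1 - ?q) * (1 / (?a + m True))) * ?D True xs
     + (?q * (1 / (?a + ?N False xs)) + (1 - ?q) * (1 / (?a + ?N True xs))))))"
  have pw: "node_bound e xs \<le> ?b xs" for xs
    using bernoulli_kl_le_centred[OF prior.qq_bounds[of e] a_pos[of "Suc (length e)"] succ_count_nonneg[of False xs] succ_count_nonneg[of True xs]
      m_nn[of False] m_nn[of True] mq]
    unfolding risk_bound_def m_sum by (simp add: k0_def k1_def m_sum[symmetric] mult_ac)
  have "iid_mean ?w n (node_bound e) \<le> iid_mean ?w n ?b"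
    by (rule W.iid_mean_mono) (rule pw)
  also have "\<dots> = (2 * ?q - 1)\<^sup>2 * (?a / (?a + n * F e)) + (0
     + ((?q * (1 / (?a + m False))) * iid_mean ?w n (?D False) + (((1 - ?q) * (1 / (?a + m True))) * iid_mean ?w n (?D True)
     + (?q * iid_mean ?w n (\<lambda>xs. 1 / (?a + ?N False xs)) + (1 - ?q) * iid_mean ?w n (\<lambda>xs. 1 / (?a + ?N True xs))))))"
    by (simp only: iid_mean_add iid_mean_cmult W.iid_mean_const W.mean_succ_count m_w add.right_inverse mult_zero_right add_0_right)
  also have "\<dots> \<le> (2 * ?q - 1)\<^sup>2 * (?a / (?a + n * F e)) + (0
     + ((?q * (1 / (?a + m False))) * 2 + (((1 - ?q) * (1 / (?a + m True))) * 2
     + (?q * (2 / (?a + m False)) + (1 - ?q) * (2 / (?a + m True))))))"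
  proof -
    have D: "iid_mean ?w n (?D \<sigma>) \<le> 2" for \<sigma>
      unfolding m_w by (rule W.mean_weighted_variance_le[OF one W.w_nonneg])
    have I: "iid_mean ?w n (\<lambda>xs. 1 / (?a + ?N \<sigma> xs)) \<le> 2 / (?a + m \<sigma>)" for \<sigma>
      unfolding m_w by (rule W.mean_inverse_le[OF one W.w_nonneg])
    have c: "0 \<le> ?q * (1 / (?a + m False))" "0 \<le> (1 - ?q) * (1 / (?a + m True))"
      using qb one m_nn by (auto intro!: mult_nonneg_nonneg divide_nonneg_nonneg)
    show ?thesis
      by (intro add_left_mono add_mono mult_left_mono D I c qb)
  qed
  also have "\<dots> = (2 * ?q - 1)\<^sup>2 * (?a / (?a + n * F e)) + ?q * (4 / (?a + m False)) + (1 - ?q) * (4 / (?a + m True))"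
    by (simp add: algebra_simps)
  finally have mean: "iid_mean ?w n (node_bound e) \<le> \<dots>" .
  have "(\<integral>\<^sup>+\<omega>. risk e (hist e n \<omega>) \<partial>M) \<le> (\<integral>\<^sup>+\<omega>. ennreal (node_bound e (hist e n \<omega>)) \<partial>M)"
    by (intro nn_integral_mono risk_le)
  also have "\<dots> = ennreal (iid_mean ?w n (node_bound e))"
    by (rule nn_integral_hist[of "node_bound e", OF node_bound_nonneg])
  also have "\<dots> \<le> ennreal ((2 * ?q - 1)\<^sup>2 * (?a / (?a + n * F e)) + ?q * (4 / (?a + m False)) + (1 - ?q) * (4 / (?a + m True)))"
    by (rule ennreal_leI[OF mean])
  finally show ?thesis by (simp only: m_def)
qed

lemma nn_integral_posterior_KL:
  "(\<integral>\<^sup>+\<omega>. posterior_KL \<X> B \<A> f0 n (\<lambda>i. X i \<omega>) \<partial>M) = (\<Sum>l. \<Sum>e\<in>level l. ennreal (F e) * (\<integral>\<^sup>+\<omega>. risk e (hist e n \<omega>) \<partial>M))"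
  unfolding posterior_KL_hist by (subst nn_integral_suminf) (auto simp: nn_integral_sum nn_integral_cmult)

text \<open>The quantity \<open>s l\<close> bounds all denominators of level \<open>l\<close> from
  below. Dropping either of its summands gives one of the two geometric bounds, and the weights of a
  level add up to 1.\<close>

lemma posterior_KL_rate_of_node_bounds:
  fixes m K \<beta> :: real
  assumes \<beta>: "0 < \<beta>" and lev: "\<And>l. a l = 2 powr (\<beta> * real l)" and m: "0 < m"
    and F: "\<And>e. m * (1 / 2) ^ length e \<le> F e"
    and chi: "\<And>e. (2 * q e - 1)\<^sup>2 * child_level e \<le> K"
  shows "\<exists>C. \<forall>\<^sub>F n in sequentially. (\<integral>\<^sup>+\<omega>. posterior_KL \<X> B \<A> f0 n (\<lambda>i. X i \<omega>) \<partial>M) \<le> ennreal (C * real n powr (- (\<beta> / (1 + \<beta>))))"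
proof (rule exI, rule eventually_mono[OF eventually_ge_at_top[of 1]])
  fix n :: nat assume "1 \<le> n"
  then have n: "1 \<le> real n" by simp
  have K: "0 \<le> K" using chi[of "[]"] a_pos[of 1] by (intro order_trans[OF _ chi[of "[]"]]) auto
  define K' where "K' = (K + 4) * max 1 (1 / m)"
  define s where "s l = a (Suc l) + n * (m * (1 / 2) ^ Suc l)" for l
  define u where "u l = (K + 4) / s l" for l
  have s: "a (Suc l) \<le> s l" "n * (m * (1 / 2) ^ Suc l) \<le> s l" "0 < s l" for l
    using a_pos[of "Suc l"] m n by (auto simp: s_def intro!: add_pos_nonneg)
  have node: "ennreal (F e) * (\<integral>\<^sup>+\<omega>. risk e (hist e n \<omega>) \<partial>M) \<le> ennreal (F e * u l)" if e: "e \<in> level l" for e l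
  proof -
    let ?a = "child_level e"
    have aeq: "?a = a (Suc l)" using e by simp
    have "1 \<le> ?a" using \<beta> by (simp add: lev ge_one_powr_ge_zero)
    have sF: "s l \<le> ?a + n * F (e @ [\<sigma>])" for \<sigma>
      using F[of "e @ [\<sigma>]"] e n by (simp add: s_def mult_left_mono)
    have sF': "s l \<le> ?a + n * F e"
      using sF[of False] prior.F_additive[of e] prior.F_nonneg[of "e @ [True]"] n
      by (intro order_trans[OF sF[of False]] add_left_mono mult_left_mono) auto
    have "(2 * q e - 1)\<^sup>2 * (?a / (?a + n * F e)) + q e * (4 / (?a + n * F (e @ [False]))) + (1 - q e) * (4 / (?a + n * F (e @ [True])))
       \<le> K / s l + q e * (4 / s l) + (1 - q e) * (4 / s l)"
    proof (intro add_mono mult_left_mono divide_left_mono)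
      have "(2 * q e - 1)\<^sup>2 * (?a / (?a + n * F e)) = ((2 * q e - 1)\<^sup>2 * ?a) / (?a + n * F e)" by simp
      also have "\<dots> \<le> K / (?a + n * F e)"
        using chi[of e] s(3)[of l] sF' by (intro divide_right_mono) auto
      also have "\<dots> \<le> K / s l"
        using K s(3)[of l] sF' by (intro divide_left_mono mult_pos_pos) auto
      finally show "(2 * q e - 1)\<^sup>2 * (?a / (?a + n * F e)) \<le> K / s l" .
      have pos: "0 < (?a + n * F (e @ [\<sigma>])) * s l" for \<sigma>
        using s(3)[of l] sF[of \<sigma>] by (intro mult_pos_pos) auto
      show "0 < (?a + n * F (e @ [False])) * s l" "0 < (?a + n * F (e @ [True])) * s l" by (rule pos)+
    qed (use sF prior.qq_bounds[of e] in auto)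
    also have "\<dots> = u l" by (simp add: u_def add_divide_distrib diff_divide_distrib algebra_simps)
    finally have "(\<integral>\<^sup>+\<omega>. risk e (hist e n \<omega>) \<partial>M) \<le> ennreal (u l)"
      by (intro order_trans[OF nn_integral_risk_le[OF \<open>1 \<le> ?a\<close>]] ennreal_leI)
    then show ?thesis using prior.F_nonneg[of e] by (simp add: ennreal_mult' mult_left_mono)
  qed
  have u0: "0 \<le> u l" for l using K s(3)[of l] by (simp add: u_def)
  have "(\<integral>\<^sup>+\<omega>. posterior_KL \<X> B \<A> f0 n (\<lambda>i. X i \<omega>) \<partial>M) \<le> (\<Sum>l. ennreal (u l))"
    unfolding nn_integral_posterior_KL
  proof (intro suminf_le)
    fix l
    have "(\<Sum>e\<in>level l. ennreal (F e) * (\<integral>\<^sup>+\<omega>. risk e (hist e n \<omega>) \<partial>M)) \<le> (\<Sum>e\<in>level l. ennreal (F e * u l))"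
      by (intro sum_mono node)
    also have "\<dots> = ennreal (\<Sum>e\<in>level l. F e * u l)"
      using u0 prior.F_nonneg by (intro sum_ennreal) auto
    also have "(\<Sum>e\<in>level l. F e * u l) = u l" by (simp only: sum_distrib_right[symmetric] prior.F_sum mult_1)
    finally show "(\<Sum>e\<in>level l. ennreal (F e) * (\<integral>\<^sup>+\<omega>. risk e (hist e n \<omega>) \<partial>M)) \<le> ennreal (u l)" .
  qed auto
  also have "\<dots> \<le> ennreal (K' * (2 + 1 / (1 - 2 powr (- \<beta>))) * real n powr (- (\<beta> / (1 + \<beta>))))"
  proof (rule suminf_geometric_crossover[OF \<beta> n u0])
    show "0 \<le> K'" using K m by (simp add: K'_def)
    fix l
    have "u l \<le> (K + 4) / a (Suc l)"
      unfolding u_def using K s(1,3)[of l] a_pos[of "Suc l"] by (intro divide_left_mono) auto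
    also have "\<dots> = (K + 4) * 1 * 2 powr (- \<beta> * real (Suc l))" by (simp add: lev powr_minus divide_inverse)
    also have "\<dots> \<le> K' * 2 powr (- \<beta> * real (Suc l))"
      unfolding K'_def using K by (intro mult_right_mono mult_left_mono) auto
    finally show "u l \<le> K' * 2 powr (- \<beta> * real (Suc l))" .
    have "u l \<le> (K + 4) / (n * (m * (1 / 2) ^ Suc l))"
      unfolding u_def using K s(2,3)[of l] n m by (intro divide_left_mono) auto
    also have "\<dots> = (K + 4) * (1 / m) * (2 ^ Suc l / n)" by (simp add: power_one_over field_simps)
    also have "\<dots> \<le> K' * (2 ^ Suc l / n)"
      unfolding K'_def using K n by (intro mult_right_mono mult_left_mono) auto
    finally show "u l \<le> K' * (2 ^ Suc l / n)" .
  qed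
  finally show "(\<integral>\<^sup>+\<omega>. posterior_KL \<X> B \<A> f0 n (\<lambda>i. X i \<omega>) \<partial>M) \<le>
      ennreal ((K' * (2 + 1 / (1 - 2 powr (- \<beta>)))) * real n powr (- (\<beta> / (1 + \<beta>))))" .
qed

end

text \<open>On a dyadic interval of length \<open>h\<close> the density oscillates around a
  reference value by at most \<open>L * h powr \<alpha>\<close>, and with the lower bound
  \<open>m\<close> this controls the distance of the split from \<open>1 / 2\<close>. The growth of
  \<open>a\<close> compensates the square of that distance.\<close>

lemma posterior_KL_rate:
  fixes M :: "'w measure" and B :: "bool list \<Rightarrow> real set" and m L \<alpha> :: real
  assumes S: "polya_tree_sampling M {0..1} B \<A> a f0 X" and dyadic: "dyadic_tree B"
    and m: "0 < m" and L: "0 < L" and \<alpha>: "0 \<le> \<alpha>" "\<alpha> \<le> 1"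
    and lower: "\<forall>t\<in>{0..1}. f0 t > m"
    and hoelder: "\<forall>x\<in>{0..1}. \<forall>y\<in>{0..1}. \<bar>f0 x - f0 y\<bar> \<le> L * \<bar>x - y\<bar> powr \<alpha>"
    and lev: "\<forall>l. a l = 2 powr (2 * \<alpha> * real l)"
  shows "\<exists>C. \<forall>\<^sub>F n in sequentially. (\<integral>\<^sup>+\<omega>. posterior_KL {0..1} B \<A> f0 n (\<lambda>i. X i \<omega>) \<partial>M) \<le>
    ennreal (C * real n powr (- (2 * \<alpha> / (1 + 2 * \<alpha>))))"
proof -
  interpret polya_tree_sampling M "{0..1}" B \<A> a f0 X by (rule S)
  \<comment> \<open>For \<open>\<alpha> = 0\<close> the summability assumption on the parameters fails.\<close>
  have "\<alpha> \<noteq> 0"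
  proof
    assume "\<alpha> = 0"
    then have "summable (\<lambda>l. real l)" using summable_level lev by simp
    then have "(\<lambda>l. real l) \<longlonglongrightarrow> 0" by (rule summable_LIMSEQ_zero)
    then have "\<forall>\<^sub>F l in sequentially. real l < 1" by (rule order_tendstoD) simp
    then obtain k where "\<And>l. l \<ge> k \<Longrightarrow> real l < 1" by (auto simp: eventually_sequentially)
    from this[of "Suc k"] show False by simp
  qed
  then have \<beta>: "0 < 2 * \<alpha>" using \<alpha> by simp
  have F_ge: "m * (1 / 2) ^ length e \<le> F e" for e
  proof -
    have "m * (1 / 2) ^ length e = (\<integral>x. indicator (B e) x * m \<partial>leb_on {0..1})"
      using measure_B[of e] by (simp add: Int_absorb2 B_sub)
    also have "\<dots> \<le> F e"
      unfolding mass_def using lower by (intro integral_mono mass_integrable f0_integrable) (auto simp: indicator_def less_imp_le)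
    finally show ?thesis .
  qed
  have chi: "(2 * q e - 1)\<^sup>2 * child_level e \<le> 4 * (L / m)\<^sup>2" for e
  proof -
    define h where "h = (1 / 2 :: real) ^ length e"
    have h: "0 < h" by (simp add: h_def)
    define \<delta> where "\<delta> = L * h powr \<alpha>"
    have "B e \<noteq> {}" using measure_B[of e] by auto
    then obtain y where y: "y \<in> B e" by auto
    have osc: "\<bar>f0 x - f0 y\<bar> \<le> \<delta>" if x: "x \<in> B e" for x
    proof -
      have "B e \<subseteq> {dyadic_left e .. dyadic_left e + h}" using dyadic by (simp add: dyadic_tree_def h_def)
      then have "x \<in> {dyadic_left e .. dyadic_left e + h}" "y \<in> {dyadic_left e .. dyadic_left e + h}" using x y by blast+
      then have "\<bar>x - y\<bar> \<le> h" by auto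
      then have "\<bar>x - y\<bar> powr \<alpha> \<le> h powr \<alpha>" using \<alpha> by (intro powr_mono2) auto
      moreover have "\<bar>f0 x - f0 y\<bar> \<le> L * \<bar>x - y\<bar> powr \<alpha>" using hoelder x y B_sub[of e] by blast
      ultimately show ?thesis unfolding \<delta>_def using L by (meson mult_left_mono less_imp_le order_trans)
    qed
    have child: "\<bar>F (e @ [\<sigma>]) - f0 y * (h / 2)\<bar> \<le> \<delta> * (h / 2)" for \<sigma>
    proof -
      let ?I = "indicator (B (e @ [\<sigma>])) :: real \<Rightarrow> real"
      have const: "(\<integral>x. ?I x * r \<partial>leb_on {0..1}) = r * (h / 2)" for r
        using measure_B[of "e @ [\<sigma>]"] by (simp add: Int_absorb2 B_sub h_def)
      have eq: "F (e @ [\<sigma>]) - f0 y * (h / 2) = (\<integral>x. ?I x * f0 x - ?I x * f0 y \<partial>leb_on {0..1})"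
        unfolding const[symmetric] mass_def
        by (intro Bochner_Integration.integral_diff[symmetric] mass_integrable f0_integrable) simp
      have "\<bar>F (e @ [\<sigma>]) - f0 y * (h / 2)\<bar> \<le> (\<integral>x. \<bar>?I x * f0 x - ?I x * f0 y\<bar> \<partial>leb_on {0..1})"
        unfolding eq by (rule integral_abs_bound)
      also have "\<dots> \<le> (\<integral>x. ?I x * \<delta> \<partial>leb_on {0..1})"
      proof (rule integral_mono)
        show "integrable (leb_on {0..1}) (\<lambda>x. \<bar>?I x * f0 x - ?I x * f0 y\<bar>)"
          by (intro integrable_abs Bochner_Integration.integrable_diff mass_integrable f0_integrable) simp
        show "integrable (leb_on {0..1}) (\<lambda>x. ?I x * \<delta>)" by (rule mass_integrable) simp
        show "\<bar>?I x * f0 x - ?I x * f0 y\<bar> \<le> ?I x * \<delta>" for x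
          using osc[of x] B_split[of e] by (cases \<sigma>) (auto simp: indicator_def)
      qed
      also have "\<dots> = \<delta> * (h / 2)" by (rule const)
      finally show ?thesis .
    qed
    have "\<bar>(2 * q e - 1) * F e\<bar> = \<bar>F (e @ [False]) - F (e @ [True])\<bar>"
      by (simp add: prior.F_qq algebra_simps)
    also have "\<dots> \<le> \<delta> * (h / 2) + \<delta> * (h / 2)" using child[of False] child[of True] by linarith
    also have "\<dots> = \<delta> * h" by simp
    finally have "\<bar>2 * q e - 1\<bar> * F e \<le> \<delta> * h" using prior.F_nonneg[of e] by (simp add: abs_mult)
    moreover have "\<bar>2 * q e - 1\<bar> * (m * h) \<le> \<bar>2 * q e - 1\<bar> * F e"
      using F_ge[of e] by (intro mult_left_mono) (auto simp: h_def)
    ultimately have "\<bar>2 * q e - 1\<bar> * m * h \<le> \<delta> * h" by (simp only: mult.assoc)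
    then have "\<bar>2 * q e - 1\<bar> * m \<le> \<delta>" using h by (rule mult_right_le_imp_le)
    then have "\<bar>2 * q e - 1\<bar> \<le> \<delta> / m" using m by (simp add: field_simps)
    then have "\<bar>2 * q e - 1\<bar>\<^sup>2 \<le> (\<delta> / m)\<^sup>2" by (intro power_mono) auto
    then have "(2 * q e - 1)\<^sup>2 * child_level e \<le> (\<delta> / m)\<^sup>2 * child_level e"
      using a_pos[of "Suc (length e)"] by (intro mult_right_mono) auto
    \<comment> \<open>The parameter belongs to the children, one level below the interval of length
      \<open>h\<close>; hence the leftover factor \<open>2 powr (2 * \<alpha>)\<close>.\<close>
    also have "\<dots> = (L / m)\<^sup>2 * 2 powr (2 * \<alpha>)"
    proof -
      have "h = 2 powr (- real (length e))" by (simp add: h_def powr_minus powr_realpow power_one_over inverse_eq_divide)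
      then have "(h powr \<alpha>)\<^sup>2 * child_level e = 2 powr (2 * \<alpha>)"
        by (simp add: lev powr_powr power2_eq_square powr_add[symmetric] algebra_simps)
      then show ?thesis by (simp add: \<delta>_def power_divide power_mult_distrib)
    qed
    also have "\<dots> \<le> (L / m)\<^sup>2 * 4"
    proof (intro mult_left_mono)
      have "2 powr (2 * \<alpha>) \<le> 2 powr (2::real)" using \<alpha> by (intro powr_mono) auto
      then show "2 powr (2 * \<alpha>) \<le> 4" by simp
    qed simp
    finally show ?thesis by (simp add: mult.commute)
  qed
  show ?thesis
    using posterior_KL_rate_of_node_bounds[OF \<beta> _ m F_ge chi] lev by (simp add: mult.assoc)
qed

theorem theorem1:
  shows
    "(\<forall>(M :: 'w measure) (\<X> :: 'a::euclidean_space set) B \<A> a f0 X.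
       polya_tree_sampling M \<X> B \<A> a f0 X \<longrightarrow>
         (\<forall>n. (\<lambda>\<omega>. posterior_KL \<X> B \<A> f0 n (\<lambda>i. X i \<omega>)) \<in> borel_measurable M) \<and>
         (AE \<omega> in M. (\<lambda>n. posterior_KL \<X> B \<A> f0 n (\<lambda>i. X i \<omega>)) \<longlonglongrightarrow> 0) \<and>
         (\<lambda>n. \<integral>\<^sup>+\<omega>. posterior_KL \<X> B \<A> f0 n (\<lambda>i. X i \<omega>) \<partial>M) \<longlonglongrightarrow> 0)
     \<and>
     (\<forall>(M :: 'w measure) (\<X> :: real set) B \<A> a f0 X (m :: real) (L :: real) (\<alpha> :: real).
       polya_tree_sampling M \<X> B \<A> a f0 X \<longrightarrow>
       \<X> = {0..1} \<longrightarrow> dyadic_tree B \<longrightarrow>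
       0 < m \<longrightarrow> 0 < L \<longrightarrow> 0 \<le> \<alpha> \<longrightarrow> \<alpha> \<le> 1 \<longrightarrow>
       (\<forall>t\<in>{0..1}. f0 t > m) \<longrightarrow>
       (\<forall>x\<in>{0..1}. \<forall>y\<in>{0..1}. \<bar>f0 x - f0 y\<bar> \<le> L * \<bar>x - y\<bar> powr \<alpha>) \<longrightarrow>
       (\<forall>l. a l = 2 powr (2 * \<alpha> * real l)) \<longrightarrow>
         (\<exists>C. \<forall>\<^sub>F n in sequentially.
            (\<integral>\<^sup>+\<omega>. posterior_KL \<X> B \<A> f0 n (\<lambda>i. X i \<omega>) \<partial>M)
              \<le> ennreal (C * real n powr (- (2 * \<alpha> / (1 + 2 * \<alpha>))))))"
  proof (intro conjI allI impI, goal_cases)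
  case (1 M \<X> B \<A> a f0 X n)
  then show ?case by (rule polya_tree_sampling.posterior_KL_measurable)
next
  case (2 M \<X> B \<A> a f0 X)
  then show ?case by (rule polya_tree_sampling.posterior_KL_AE)
next
  case (3 M \<X> B \<A> a f0 X)
  then show ?case by (rule polya_tree_sampling.posterior_KL_L1)
next
  case (4 M \<X> B \<A> a f0 X m L \<alpha>)
  show ?case
    unfolding 4(2) by (rule posterior_KL_rate[OF 4(1)[unfolded 4(2)] 4(3-10)])
qed

end
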